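(* Let $\mathcal B$ be a set, $N:\mathcal B\times\mathcal B\to\mathbb Z$ a symmetric function, and $\mathfrak F=\mathfrak F_N(\mathcal B)$ the corresponding free vertex algebra. Let $a,b,c\in\mathcal B$ and let $n=N(a,b)-k-1$ for some integer $k\ge0$. Then in $\mathfrak F$ $$N(c,\,b_{(n)}a)=\begin{cases}N(a,c)+N(b,c)+k&\text{if } N(b,c)>0\ \text{ or }\ 0\le k\le -N(b,c),\\ N(a,c)&\text{if } N(b,c)=0\ \text{ or }\ 0<-N(b,c)\le k.\end{cases}$$
   Context: All spaces are over a field $\Bbbk$ of characteristic $0$. A vertex algebra is a superspace $A=A_{\bar0}\oplus A_{\bar1}$ with even bilinear products $(a,b)\mapsto a_{(n)}b$, $n\in\mathbb Z$, and a distinguished even element $\mathbf 1$. Put $Da=a_{(-2)}\mathbf 1$, $D^{(k)}=\frac1{k!}D^k$, $Y(a)(z)=\sum_{n\in\mathbb Z}a_{(n)}z^{-n-1}$, where $a_{(n)}$ is viewed as an operator on $A$. Axioms: (V1) $a_{(n)}b=0$ for $n\gg0$; (V2) $\mathbf 1_{(n)}a=\delta_{n,-1}a$, $a_{(n)}\mathbf 1=0$ for $n\ge0$ and $a_{(n)}\mathbf 1=D^{(-n-1)}a$ for $n<0$; (V3) $(Da)_{(n)}b=-n\,a_{(n-1)}b$ and $a_{(n)}(Db)=n\,a_{(n-1)}b+D(a_{(n)}b)$; (V4) locality: for parity-homogeneous $a,b$ there is $M\in\mathbb Z$ such that $Y(a)(w)Y(b)(z)\,\iota_{w,z}(w-z)^M=(-1)^{p(a)p(b)}Y(b)(z)Y(a)(w)\,\iota_{z,w}(w-z)^M$,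 where $p$ is the parity and $\iota_{w,z}$ (resp. $\iota_{z,w}$) means expansion in nonnegative powers of $z$ (resp. of $w$). Homomorphisms preserve $\mathbf 1$ and all products. Free vertex algebra: for a set $\mathcal B$ and a symmetric $N:\mathcal B\times\mathcal B\to\mathbb Z$, $\mathfrak F_N(\mathcal B)$ is the vertex algebra generated by $\mathcal B$, where $a\in\mathcal B$ has parity $N(a,a)\bmod 2$ and $a_{(n)}b=0$ for $a,b\in\mathcal B$, $n\ge N(a,b)$, which is universal with these properties: for any vertex algebra $A$ and any map $\iota:\mathcal B\to A$ with $\iota(a)$ of parity $N(a,a)\bmod 2$ and $\iota(a)_{(n)}\iota(b)=0$ whenever $n\ge N(a,b)$, there is a unique vertex algebra homomorphism $\mathfrak F_N(\mathcal B)\to A$ extending $\iota$. For elements $x,y$ of a vertex algebra, the order of locality is $N(x,y)=\min\{n\in\mathbb Z: x_{(m)}y=0\ \ \forall\,m\ge n\}$ (equivalently, the minimal $M$ for which the locality identity in (V4) holds for $x,y$). *)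

theory Defs
  imports Complex_Main "HOL-Library.Poly_Mapping" "HOL-Library.Z2"
begin

section \<open>Vertex algebras\<close>

text \<open>
  The underlying superspace is a graded subspace of an ambient vector space, with the parity taken
  in \<open>\<int>/2\<close>, rendered by the two-element field \<^typ>\<open>bit\<close>. Outside the carrier the products
  are unconstrained.
\<close>

record 'v va =
  part :: "bit \<Rightarrow> 'v set"
  nprod :: "int \<Rightarrow> 'v \<Rightarrow> 'v \<Rightarrow> 'v"
  vac :: 'v

definition va_carrier :: "('v::ab_group_add, 'm) va_scheme \<Rightarrow> 'v set" where
  "va_carrier A = {x + y | x y. x \<in> part A 0 \<and> y \<in> part A 1}"

definition va_D :: "('v, 'm) va_scheme \<Rightarrow> 'v \<Rightarrow> 'v" where
  "va_D A a = nprod A (-2) a (vac A)"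

definition va_Ddiv ::
    "('k::field_char_0 \<Rightarrow> 'v \<Rightarrow> 'v) \<Rightarrow> ('v, 'm) va_scheme \<Rightarrow> nat \<Rightarrow> 'v \<Rightarrow> 'v" where
  "va_Ddiv scale A k a = scale (1 / fact k) ((va_D A ^^ k) a)"

text \<open>The operator coefficient of \<open>z\<^sup>m\<close> in \<open>Y(a)(z)\<close>.\<close>

definition Y_coeff :: "('v, 'm) va_scheme \<Rightarrow> 'v \<Rightarrow> int \<Rightarrow> 'v \<Rightarrow> 'v" where
  "Y_coeff A a m = nprod A (- m - 1) a"

text \<open>
  The coefficient of \<open>w\<^sup>i z\<^sup>j\<close> in the expansion of \<open>(w - z)\<^sup>M\<close> in nonnegative powers of \<open>z\<close>,
  respectively of \<open>w\<close>.
\<close>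

definition iota_wz :: "int \<Rightarrow> int \<Rightarrow> int \<Rightarrow> 'k::field_char_0" where
  "iota_wz M i j =
     (if 0 \<le> j \<and> i + j = M then (of_int M gchoose nat j) * (-1) ^ nat j else 0)"

definition iota_zw :: "int \<Rightarrow> int \<Rightarrow> int \<Rightarrow> 'k::field_char_0" where
  "iota_zw M i j =
     (if 0 \<le> i \<and> i + j = M then (of_int M gchoose nat i) * (-1) powi j else 0)"

definition koszul_sign :: "bit \<Rightarrow> bit \<Rightarrow> 'k::field_char_0" where
  "koszul_sign p q = (if p = 1 \<and> q = 1 then -1 else 1)"

text \<open>
  The two sides of the locality identity, compared at each \<open>w\<^sup>r z\<^sup>s\<close> after application to a
  vector \<open>c\<close>. If \<open>a\<^sub>n c = b\<^sub>n c = 0\<close> for all large \<open>n\<close>, both sums over \<open>(i, j)\<close> have finite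
  support, so they are the genuine coefficients.
\<close>

definition local_at ::
    "('k::field_char_0 \<Rightarrow> 'v::ab_group_add \<Rightarrow> 'v) \<Rightarrow> ('v, 'm) va_scheme \<Rightarrow>
      bit \<Rightarrow> bit \<Rightarrow> 'v \<Rightarrow> 'v \<Rightarrow> int \<Rightarrow> bool" where
  "local_at scale A p q a b M \<longleftrightarrow>
     (\<forall>c \<in> va_carrier A. \<forall>r s.
        Sum_any (\<lambda>(i, j).
            scale (iota_wz M i j) (Y_coeff A a (r - i) (Y_coeff A b (s - j) c))) =
        scale (koszul_sign p q) (Sum_any (\<lambda>(i, j).
            scale (iota_zw M i j) (Y_coeff A b (s - j) (Y_coeff A a (r - i) c)))))"

locale vertex_algebra = vector_space scale
  for scale :: "'k::field_char_0 \<Rightarrow> 'v::ab_group_add \<Rightarrow> 'v" +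
  fixes A :: "('v, 'm) va_scheme"
  assumes part_subspace: "subspace (part A p)"
    and part_direct: "part A 0 \<inter> part A 1 = {0}"
    and nprod_even: "\<lbrakk>a \<in> part A p; b \<in> part A q\<rbrakk> \<Longrightarrow> nprod A n a b \<in> part A (p + q)"
    and nprod_add_left: "\<lbrakk>a \<in> va_carrier A; a' \<in> va_carrier A; b \<in> va_carrier A\<rbrakk> \<Longrightarrow>
          nprod A n (a + a') b = nprod A n a b + nprod A n a' b"
    and nprod_add_right: "\<lbrakk>a \<in> va_carrier A; b \<in> va_carrier A; b' \<in> va_carrier A\<rbrakk> \<Longrightarrow>
          nprod A n a (b + b') = nprod A n a b + nprod A n a b'"
    and nprod_scale_left: "\<lbrakk>a \<in> va_carrier A; b \<in> va_carrier A\<rbrakk> \<Longrightarrow>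
          nprod A n (scale r a) b = scale r (nprod A n a b)"
    and nprod_scale_right: "\<lbrakk>a \<in> va_carrier A; b \<in> va_carrier A\<rbrakk> \<Longrightarrow>
          nprod A n a (scale r b) = scale r (nprod A n a b)"
    and vac_even: "vac A \<in> part A 0"
    and truncation: "\<lbrakk>a \<in> va_carrier A; b \<in> va_carrier A\<rbrakk> \<Longrightarrow>
          \<exists>n\<^sub>0. \<forall>n \<ge> n\<^sub>0. nprod A n a b = 0"
    and vac_left: "a \<in> va_carrier A \<Longrightarrow> nprod A n (vac A) a = (if n = -1 then a else 0)"
    and vac_right_nonneg: "\<lbrakk>a \<in> va_carrier A; 0 \<le> n\<rbrakk> \<Longrightarrow> nprod A n a (vac A) = 0"
    and vac_right_neg: "\<lbrakk>a \<in> va_carrier A; n < 0\<rbrakk> \<Longrightarrow>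
          nprod A n a (vac A) = va_Ddiv scale A (nat (- n - 1)) a"
    and D_left: "\<lbrakk>a \<in> va_carrier A; b \<in> va_carrier A\<rbrakk> \<Longrightarrow>
          nprod A n (va_D A a) b = scale (- of_int n) (nprod A (n - 1) a b)"
    and D_right: "\<lbrakk>a \<in> va_carrier A; b \<in> va_carrier A\<rbrakk> \<Longrightarrow>
          nprod A n a (va_D A b) = scale (of_int n) (nprod A (n - 1) a b) + va_D A (nprod A n a b)"
    and locality: "\<lbrakk>a \<in> part A p; b \<in> part A q\<rbrakk> \<Longrightarrow> \<exists>M. local_at scale A p q a b M"

definition va_hom ::
    "('k \<Rightarrow> 'v::ab_group_add \<Rightarrow> 'v) \<Rightarrow> ('v, 'm) va_scheme \<Rightarrow>
     ('k \<Rightarrow> 'w::ab_group_add \<Rightarrow> 'w) \<Rightarrow> ('w, 'n) va_scheme \<Rightarrow> ('v \<Rightarrow> 'w) \<Rightarrow> bool" where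
  "va_hom s A t B f \<longleftrightarrow>
     (\<forall>p. \<forall>x \<in> part A p. f x \<in> part B p) \<and>
     (\<forall>x \<in> va_carrier A. \<forall>y \<in> va_carrier A. f (x + y) = f x + f y) \<and>
     (\<forall>r. \<forall>x \<in> va_carrier A. f (s r x) = t r (f x)) \<and>
     f (vac A) = vac B \<and>
     (\<forall>n. \<forall>x \<in> va_carrier A. \<forall>y \<in> va_carrier A. f (nprod A n x y) = nprod B n (f x) (f y))"

definition is_order_of_locality :: "('v::zero, 'm) va_scheme \<Rightarrow> 'v \<Rightarrow> 'v \<Rightarrow> int \<Rightarrow> bool" where
  "is_order_of_locality A x y n \<longleftrightarrow>
     (\<forall>m \<ge> n. nprod A m x y = 0) \<and> (\<forall>n'. (\<forall>m \<ge> n'. nprod A m x y = 0) \<longrightarrow> n \<le> n')"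


section \<open>Free vertex algebras\<close>

definition va_generated ::
    "('k::field_char_0 \<Rightarrow> 'v::ab_group_add \<Rightarrow> 'v) \<Rightarrow> ('v, 'm) va_scheme \<Rightarrow> 'v set \<Rightarrow> bool" where
  "va_generated scale A S \<longleftrightarrow>
     (\<forall>W \<subseteq> va_carrier A.
        module.subspace scale W \<and> vac A \<in> W \<and> S \<subseteq> W \<and>
        (\<forall>n. \<forall>x \<in> W. \<forall>y \<in> W. nprod A n x y \<in> W) \<longrightarrow> W = va_carrier A)"

definition locality_map ::
    "'b set \<Rightarrow> ('b \<Rightarrow> 'b \<Rightarrow> int) \<Rightarrow> ('v::zero, 'm) va_scheme \<Rightarrow> ('b \<Rightarrow> 'v) \<Rightarrow> bool" where
  "locality_map \<B> N A \<iota> \<longleftrightarrow>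
     (\<forall>a \<in> \<B>. \<iota> a \<in> part A (of_int (N a a))) \<and>
     (\<forall>a \<in> \<B>. \<forall>b \<in> \<B>. \<forall>n \<ge> N a b. nprod A n (\<iota> a) (\<iota> b) = 0)"

definition universal_hom ::
    "('k::field_char_0 \<Rightarrow> 'v::ab_group_add \<Rightarrow> 'v) \<Rightarrow> 'v va \<Rightarrow> 'b set \<Rightarrow> ('b \<Rightarrow> 'v) \<Rightarrow>
     ('k \<Rightarrow> 'w::ab_group_add \<Rightarrow> 'w) \<Rightarrow> 'w va \<Rightarrow> ('b \<Rightarrow> 'w) \<Rightarrow> bool" where
  "universal_hom s F \<B> g t A \<iota> \<longleftrightarrow>
     (\<exists>\<phi>. va_hom s F t A \<phi> \<and> (\<forall>b \<in> \<B>. \<phi> (g b) = \<iota> b) \<and>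
       (\<forall>\<psi>. va_hom s F t A \<psi> \<and> (\<forall>b \<in> \<B>. \<psi> (g b) = \<iota> b) \<longrightarrow>
          (\<forall>x \<in> va_carrier F. \<psi> x = \<phi> x)))"

text \<open>
  A definition cannot quantify over all types, so the universal property is required for vertex
  algebras inside one fixed vector space, which is large enough: a vertex algebra generated by an
  image of \<open>\<B>\<close> is spanned by iterated products of generators and \<open>\<one>\<close>, hence is isomorphic to one
  whose carrier is a subspace of the vector space with the following words as basis. Theorem
  \<open>free_vertex_algebra_universal\<close> below derives the universal property for vertex algebras over
  arbitrary types.
\<close>

datatype 'b va_word = Vac | Gen 'b | Prd int "'b va_word" "'b va_word"

definition pm_scale :: "'k::field_char_0 \<Rightarrow> ('a \<Rightarrow>\<^sub>0 'k) \<Rightarrow> ('a \<Rightarrow>\<^sub>0 'k)" where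
  "pm_scale r f = Poly_Mapping.map ((*) r) f"

text \<open>\<open>g\<close> is the canonical map \<open>\<B> \<rightarrow> F\<close>.\<close>

definition is_free_vertex_algebra ::
    "('k::field_char_0 \<Rightarrow> 'v::ab_group_add \<Rightarrow> 'v) \<Rightarrow> 'v va \<Rightarrow> 'b set \<Rightarrow> ('b \<Rightarrow> 'b \<Rightarrow> int) \<Rightarrow>
     ('b \<Rightarrow> 'v) \<Rightarrow> bool" where
  "is_free_vertex_algebra scale F \<B> N g \<longleftrightarrow>
     vertex_algebra scale F \<and> locality_map \<B> N F g \<and> va_generated scale F (g ` \<B>) \<and>
     (\<forall>(A :: ('b va_word \<Rightarrow>\<^sub>0 'k) va) \<iota>.
        vertex_algebra pm_scale A \<and> locality_map \<B> N A \<iota> \<longrightarrow>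
        universal_hom scale F \<B> g pm_scale A \<iota>)"


section \<open>The universal property over arbitrary types\<close>

lemma lookup_pm_scale [simp]:
  "Poly_Mapping.lookup (pm_scale r f) x = r * Poly_Mapping.lookup f x"
  unfolding pm_scale_def by (simp add: Poly_Mapping.map.rep_eq when_def)

lemma vector_space_pm_scale: "vector_space pm_scale"
  by unfold_locales (auto intro!: poly_mapping_eqI simp: lookup_add algebra_simps)

context vertex_algebra
begin

lemma in_carrier: "x \<in> part A p \<Longrightarrow> x \<in> va_carrier A"
proof (cases "p = 0")
  case True
  assume "x \<in> part A p"
  with True show ?thesis unfolding va_carrier_def
    using subspace_0[OF part_subspace, of 1] by force
next
  case False
  assume "x \<in> part A p"
  with False show ?thesis unfolding va_carrier_def
    using subspace_0[OF part_subspace, of 0] by force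
qed

lemma subspace_carrier: "subspace (va_carrier A)"
  using subspace_sums[OF part_subspace part_subspace, of 0 1]
  unfolding va_carrier_def by (simp add: conj_commute)

lemma nprod_closed:
  assumes "a \<in> va_carrier A" "b \<in> va_carrier A" shows "nprod A n a b \<in> va_carrier A"
proof -
  obtain x y where a: "a = x + y" "x \<in> part A 0" "y \<in> part A 1"
    using assms unfolding va_carrier_def by blast
  obtain u v where b: "b = u + v" "u \<in> part A 0" "v \<in> part A 1"
    using assms unfolding va_carrier_def by blast
  note ab = a(2,3) b(2,3)
  note c = ab[THEN in_carrier]
  have "nprod A n a b = nprod A n x u + nprod A n y u + (nprod A n x v + nprod A n y v)"
    using c assms by (simp add: a(1) b(1) nprod_add_right nprod_add_left)
  then show ?thesis
    using ab by (auto intro!: subspace_add[OF subspace_carrier] intro: in_carrier nprod_even)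
qed

lemma vac_closed: "vac A \<in> va_carrier A"
  using vac_even in_carrier by blast

lemma D_closed: "a \<in> va_carrier A \<Longrightarrow> va_D A a \<in> va_carrier A"
  unfolding va_D_def by (intro nprod_closed vac_closed)

lemma D_pow_closed: "a \<in> va_carrier A \<Longrightarrow> (va_D A ^^ k) a \<in> va_carrier A"
  by (induction k) (auto intro: D_closed)

lemma nprod_zero_left: "b \<in> va_carrier A \<Longrightarrow> nprod A n 0 b = 0"
  using nprod_scale_left[of 0 b n 0] subspace_0[OF subspace_carrier] by simp

lemma nprod_zero_right: "b \<in> va_carrier A \<Longrightarrow> nprod A n b 0 = 0"
  using nprod_scale_right[of b 0 n 0] subspace_0[OF subspace_carrier] by simp

end

lemma subalgebra:
  fixes A :: "'v::ab_group_add va" and s :: "'k::field_char_0 \<Rightarrow> 'v \<Rightarrow> 'v"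
  assumes "vertex_algebra s A"
    and W: "module.subspace s W" "vac A \<in> W" "\<And>n x y. x \<in> W \<Longrightarrow> y \<in> W \<Longrightarrow> nprod A n x y \<in> W"
    and WA: "W = {x + y | x y. x \<in> part A 0 \<inter> W \<and> y \<in> part A 1 \<inter> W}"
  shows "vertex_algebra s (A\<lparr>part := \<lambda>p. part A p \<inter> W\<rparr>)" (is "vertex_algebra s ?B")
    and "va_carrier (A\<lparr>part := \<lambda>p. part A p \<inter> W\<rparr>) = W"
proof -
  interpret vertex_algebra s A by fact
  show C: "va_carrier ?B = W" unfolding va_carrier_def using WA by simp
  have sub: "x \<in> W \<Longrightarrow> x \<in> va_carrier A" for x
    using WA unfolding va_carrier_def by blast
  have D: "va_D ?B = va_D A" by (rule ext) (simp add: va_D_def)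
  have loc: "local_at s A p q a b M \<Longrightarrow> local_at s ?B p q a b M" for p q a b M
    using sub unfolding local_at_def C by (auto simp: Y_coeff_def)
  show "vertex_algebra s ?B"
  proof (unfold_locales, unfold C D va_Ddiv_def, goal_cases)
    case (1 p) then show ?case using part_subspace W(1) subspace_inter by simp
  next
    case 2 then show ?case using part_direct subspace_0[OF W(1)] by auto
  next
    case (3 a p b q n) then show ?case using nprod_even W(3) by auto
  next
    case (9 a b) then show ?case using truncation sub by simp
  next
    case (15 a p b q)
    then obtain M where "local_at s A p q a b M" using locality[of a p b q] by auto
    then show ?case by (intro exI[of _ M] loc)
  qed (use sub W vac_even in \<open>auto simp: nprod_add_left nprod_add_right nprod_scale_left
        nprod_scale_right vac_left vac_right_nonneg vac_right_neg va_Ddiv_def D_left D_right\<close>)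
qed

lemma transport:
  fixes A :: "'v::ab_group_add va" and s :: "'k::field_char_0 \<Rightarrow> 'v \<Rightarrow> 'v"
    and t :: "'k \<Rightarrow> 'w::ab_group_add \<Rightarrow> 'w"
  assumes "vertex_algebra s A" and "Vector_Spaces.linear s t h" and inj: "inj_on h (va_carrier A)"
  defines "g \<equiv> inv_into (va_carrier A) h"
  defines "B \<equiv> \<lparr>part = \<lambda>p. h ` part A p, nprod = \<lambda>n x y. h (nprod A n (g x) (g y)),
    vac = h (vac A)\<rparr>"
  shows "vertex_algebra t B" and "va_hom t B s A g" and "va_carrier B = h ` va_carrier A"
proof -
  interpret vertex_algebra s A by fact
  interpret h: Vector_Spaces.linear s t h by fact
  let ?C = "va_carrier A"
  have gh [simp]: "x \<in> ?C \<Longrightarrow> g (h x) = x" for x unfolding g_def using inj by simp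
  have nz: "x \<in> ?C \<Longrightarrow> h x = 0 \<longleftrightarrow> x = 0" for x
    using inj subspace_0[OF subspace_carrier] by (metis h.zero gh)
  note [simp] = vac_closed nprod_closed D_closed
  have sc [simp]: "x \<in> ?C \<Longrightarrow> s r x \<in> ?C" for r x by (rule subspace_scale[OF subspace_carrier])
  have ad [simp]: "x \<in> ?C \<Longrightarrow> y \<in> ?C \<Longrightarrow> x + y \<in> ?C" for x y
    by (rule subspace_add[OF subspace_carrier])
  have zero [simp]: "0 \<in> ?C" by (rule subspace_0[OF subspace_carrier])
  show C: "va_carrier B = h ` ?C"
    unfolding va_carrier_def by (auto simp: B_def h.add image_iff) (use h.add in metis)+
  have nB [simp]: "x \<in> ?C \<Longrightarrow> y \<in> ?C \<Longrightarrow> nprod B n (h x) (h y) = h (nprod A n x y)" for x y n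
    by (simp add: B_def)
  have vB [simp]: "vac B = h (vac A)" by (simp add: B_def)
  have pB [simp]: "part B p = h ` part A p" for p by (simp add: B_def)
  have DB [simp]: "x \<in> ?C \<Longrightarrow> va_D B (h x) = h (va_D A x)" for x
    unfolding va_D_def by simp
  have DnB: "x \<in> ?C \<Longrightarrow> (va_D B ^^ k) (h x) = h ((va_D A ^^ k) x)" for x k
    by (induction k) (simp_all add: D_pow_closed)
  have hscale: "t r (h x) = h (s r x)" for r x by (simp add: h.scale)
  have hadd: "h x + h y = h (x + y)" for x y by (simp add: h.add)
  have hsum: "h (Sum_any f) = Sum_any (\<lambda>i. h (f i))" if "\<And>i. f i \<in> ?C" for f :: "int \<times> int \<Rightarrow> 'v"
    using nz[OF that] by (simp add: Sum_any.expand_set h.sum)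
  have loc: "local_at t B p q (h a) (h b) M"
    if "local_at s A p q a b M" and [simp]: "a \<in> ?C" "b \<in> ?C" for p q a b M
    unfolding local_at_def C
  proof (intro ballI allI, elim imageE, goal_cases)
    case (1 x r u c)
    have [simp]: "c \<in> ?C" by fact
    have "h (Sum_any (\<lambda>(i, j). s (iota_wz M i j) (Y_coeff A a (r - i) (Y_coeff A b (u - j) c)))) =
        h (s (koszul_sign p q)
          (Sum_any (\<lambda>(i, j). s (iota_zw M i j) (Y_coeff A b (u - j) (Y_coeff A a (r - i) c)))))"
      using that(1) by (simp add: local_at_def)
    then show ?case unfolding \<open>x = h c\<close>
      by (simp add: h.scale hsum Y_coeff_def split_beta)
  qed
  show "va_hom t B s A g"
    unfolding va_hom_def C by (auto simp: hscale hadd in_carrier)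
  interpret t: vector_space t by (rule h.vs2.vector_space_axioms)
  show "vertex_algebra t B"
  proof (unfold_locales, unfold C va_Ddiv_def pB vB, goal_cases)
    case (1 p) then show ?case by (intro h.subspace_image part_subspace)
  next
    case 2
    have "h x = 0" if "x \<in> part A 0" "y \<in> part A 1" "h x = h y" for x y
      using that part_direct by (metis IntI gh in_carrier singletonD h.zero)
    moreover have "0 \<in> h ` part A p" for p
      using subspace_0[OF part_subspace, of p] h.zero by (metis image_eqI)
    ultimately show ?case by auto
  next
    case (3 a p b q n)
    then obtain x y where "a = h x" "b = h y" "x \<in> part A p" "y \<in> part A q" by blast
    then show ?case using nprod_even nB in_carrier by (metis imageI)
  next
    case (9 a b)
    then obtain x y where xy: "a = h x" "b = h y" "x \<in> ?C" "y \<in> ?C" by blast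
    obtain n\<^sub>0 where "\<forall>n \<ge> n\<^sub>0. nprod A n x y = 0" using truncation[OF xy(3,4)] by blast
    then show ?case using xy by (intro exI[of _ n\<^sub>0]) simp
  next
    case (15 a p b q)
    then obtain x y where xy: "a = h x" "b = h y" "x \<in> part A p" "y \<in> part A q" by blast
    obtain M where "local_at s A p q x y M" using locality[OF xy(3,4)] by blast
    then have "local_at t B p q a b M"
      unfolding xy(1,2) by (intro loc in_carrier[OF xy(3)] in_carrier[OF xy(4)])
    then show ?case by blast
  qed (use vac_even in \<open>auto simp: hscale hadd nprod_add_left nprod_add_right nprod_scale_left
      nprod_scale_right vac_left vac_right_nonneg vac_right_neg va_Ddiv_def D_left D_right DnB h.neg\<close>)
qed

lemma va_hom_closed:
  assumes "vertex_algebra s A" and f: "va_hom s A t B f" and x: "x \<in> va_carrier A"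
  shows "f x \<in> va_carrier B"
proof -
  interpret vertex_algebra s A by fact
  obtain u v where uv: "x = u + v" "u \<in> part A 0" "v \<in> part A 1"
    using x unfolding va_carrier_def by blast
  then have "f x = f u + f v" "f u \<in> part B 0" "f v \<in> part B 1"
    using f in_carrier unfolding va_hom_def by blast+
  then show ?thesis unfolding va_carrier_def[of B] by blast
qed

lemma va_hom_comp:
  assumes "vertex_algebra s A" and "va_hom s A t B f" and "va_hom t B u C g"
  shows "va_hom s A u C (g \<circ> f)"
  using va_hom_closed[OF assms(1,2)] assms(2,3) unfolding va_hom_def by simp

primrec eval_word :: "'v va \<Rightarrow> 'b set \<Rightarrow> ('b \<Rightarrow> 'v) \<Rightarrow> 'b va_word \<Rightarrow> 'v" where
  "eval_word A \<B> \<iota> Vac = vac A"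
| "eval_word A \<B> \<iota> (Gen b) = (if b \<in> \<B> then \<iota> b else vac A)"
| "eval_word A \<B> \<iota> (Prd n u v) = nprod A n (eval_word A \<B> \<iota> u) (eval_word A \<B> \<iota> v)"

theorem free_vertex_algebra_universal:
  fixes F :: "'v::ab_group_add va" and A :: "'w::ab_group_add va"
    and s :: "'k::field_char_0 \<Rightarrow> 'v \<Rightarrow> 'v" and t :: "'k \<Rightarrow> 'w \<Rightarrow> 'w" and g :: "'b \<Rightarrow> 'v"
  assumes free: "is_free_vertex_algebra s F \<B> N g"
    and "vertex_algebra t A" and loc: "locality_map \<B> N A \<iota>"
  shows "universal_hom s F \<B> g t A \<iota>"
proof -
  interpret F: vertex_algebra s F using free by (simp add: is_free_vertex_algebra_def)
  interpret A: vertex_algebra t A by fact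
  interpret P: vector_space "pm_scale :: 'k \<Rightarrow> ('b va_word \<Rightarrow>\<^sub>0 'k) \<Rightarrow> _"
    by (rule vector_space_pm_scale)
  interpret AP: vector_space_pair t "pm_scale :: 'k \<Rightarrow> ('b va_word \<Rightarrow>\<^sub>0 'k) \<Rightarrow> _" ..
  let ?e = "eval_word A \<B> \<iota>"
  define W where "W = A.span (range ?e)"
  have homog: "\<exists>p. ?e w \<in> part A p" for w
    using loc A.vac_even A.nprod_even by (induction w) (auto simp: locality_map_def, blast+)
  have WC: "W \<subseteq> va_carrier A" unfolding W_def
    using homog A.in_carrier by (intro A.span_minimal A.subspace_carrier) blast
  have subW: "A.subspace W" by (simp add: W_def)
  have vacW: "vac A \<in> W" unfolding W_def by (metis A.span_base eval_word.simps(1) rangeI)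
  have eC: "?e w \<in> va_carrier A" for w using homog A.in_carrier by blast
  have W1: "nprod A n (?e u) y \<in> W" if "y \<in> W" for n u y
  proof -
    have "A.subspace {y \<in> va_carrier A. nprod A n (?e u) y \<in> W}"
      using eC by (intro A.subspaceI) (auto simp: A.nprod_zero_right A.nprod_add_right
          A.nprod_scale_right A.subspace_carrier subW A.subspace_0 A.subspace_add A.subspace_scale)
    moreover have "nprod A n (?e u) (?e v) \<in> W" for v
      unfolding W_def by (metis A.span_base eval_word.simps(3) rangeI)
    ultimately have "W \<subseteq> {y \<in> va_carrier A. nprod A n (?e u) y \<in> W}"
      using eC by (subst W_def, intro A.span_minimal) auto
    then show ?thesis using that by blast
  qed
  have W2: "nprod A n x y \<in> W" if "x \<in> W" "y \<in> W" for n x y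
  proof -
    have "y \<in> va_carrier A" using that WC by blast
    then have "A.subspace {x \<in> va_carrier A. nprod A n x y \<in> W}"
      by (intro A.subspaceI) (auto simp: A.nprod_zero_left A.nprod_add_left
          A.nprod_scale_left A.subspace_carrier subW A.subspace_0 A.subspace_add A.subspace_scale)
    then have "W \<subseteq> {x \<in> va_carrier A. nprod A n x y \<in> W}"
      using eC W1[OF that(2)] by (subst W_def, intro A.span_minimal) auto
    then show ?thesis using that by blast
  qed
  let ?S = "{x + y | x y. x \<in> part A 0 \<inter> W \<and> y \<in> part A 1 \<inter> W}"
  have subS: "A.subspace ?S"
    using A.subspace_sums[OF A.subspace_inter[OF A.part_subspace subW]
        A.subspace_inter[OF A.part_subspace subW], of 0 1] by simp
  have "?e w \<in> ?S" for w
  proof -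
    have w: "?e w \<in> W" by (simp add: W_def A.span_base)
    obtain p where p: "?e w \<in> part A p" using homog by blast
    have z: "0 \<in> part A q \<inter> W" for q
      using A.subspace_0[OF A.part_subspace] A.subspace_0[OF subW] by blast
    show ?thesis
    proof (cases "p = 0")
      case True
      then have "?e w = ?e w + 0" "?e w \<in> part A 0 \<inter> W" using p w by auto
      then show ?thesis using z by blast
    next
      case False
      then have "?e w = 0 + ?e w" "?e w \<in> part A 1 \<inter> W" using p w by auto
      then show ?thesis using z by blast
    qed
  qed
  then have "W \<subseteq> ?S" unfolding W_def by (intro A.span_minimal subS[unfolded W_def]) blast
  moreover have "?S \<subseteq> W" using A.subspace_add[OF subW] by blast
  ultimately have WA: "W = ?S" by blast
  define A' where "A' = A\<lparr>part := \<lambda>p. part A p \<inter> W\<rparr>"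
  have va': "vertex_algebra t A'" and CA': "va_carrier A' = W"
    unfolding A'_def by (rule subalgebra[OF \<open>vertex_algebra t A\<close> subW vacW W2 WA]; assumption)+
  obtain Bs where Bs: "Bs \<subseteq> range ?e" "A.independent Bs" "range ?e \<subseteq> A.span Bs"
    using A.maximal_independent_subset by blast
  have spanBs: "A.span Bs = W"
    unfolding W_def using Bs by (metis A.span_eq A.span_superset order_trans)
  define f where "f = (\<lambda>x. Poly_Mapping.single (inv ?e x) (1::'k))"
  obtain h where h: "Vector_Spaces.linear t pm_scale h" "\<And>x. x \<in> Bs \<Longrightarrow> h x = f x"
    using AP.linear_independent_extend[OF Bs(2), of f] by blast
  interpret h: Vector_Spaces.linear t pm_scale h by fact
  have injf: "inj_on f Bs"
  proof (rule inj_onI)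
    fix x y assume xy: "x \<in> Bs" "y \<in> Bs" "f x = f y"
    have "inv ?e x = inv ?e y"
      using arg_cong[OF xy(3), of "\<lambda>p. Poly_Mapping.lookup p (inv ?e x)"]
      by (auto simp: f_def lookup_single when_def split: if_splits)
    then show "x = y" using xy Bs(1) by (metis f_inv_into_f subsetD)
  qed
  have indf: "P.independent (f ` Bs)"
    unfolding P.dependent_explicit
  proof (clarify, goal_cases)
    case (1 T u v)
    obtain w where w: "v = f w" "w \<in> Bs" using 1 by blast
    let ?w = "inv ?e w"
    have "0 = Poly_Mapping.lookup (\<Sum>y\<in>T. pm_scale (u y) y) ?w" using 1 by simp
    also have "\<dots> = (\<Sum>y\<in>T. u y * Poly_Mapping.lookup y ?w)"
      by (induction T rule: infinite_finite_induct) (simp_all add: lookup_add)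
    also have "\<dots> = (\<Sum>y\<in>T. if y = v then u v else 0)"
    proof (rule sum.cong)
      fix y assume "y \<in> T"
      then obtain z where z: "y = f z" "z \<in> Bs" using 1 by blast
      have "inv ?e z = ?w \<Longrightarrow> z = w" using z w Bs(1) by (metis f_inv_into_f subsetD)
      then show "u y * Poly_Mapping.lookup y ?w = (if y = v then u v else 0)"
        using z w inj_on_eq_iff[OF injf z(2) w(2)] by (auto simp: f_def lookup_single when_def)
    qed simp
    also have "\<dots> = u v" using 1 by simp
    finally show ?case using 1 by simp
  qed
  have imh: "h ` Bs = f ` Bs" using h(2) by simp
  have "inj_on h Bs" using injf h(2) by (simp cong: inj_on_cong)
  then have injh: "inj_on h (va_carrier A')"
    unfolding CA' using h.inj_on_span_iff_independent_image[of Bs] indf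
    by (simp add: imh spanBs)
  let ?g = "inv_into (va_carrier A') h"
  let ?A2 = "\<lparr>part = \<lambda>p. h ` part A' p, nprod = \<lambda>n x y. h (nprod A' n (?g x) (?g y)),
    vac = h (vac A')\<rparr>"
  note tr = transport[OF va' h(1) injh]
  interpret A': vertex_algebra t A' by (rule va')
  have \<iota>W: "b \<in> \<B> \<Longrightarrow> \<iota> b \<in> W" for b
    unfolding W_def by (metis A.span_base eval_word.simps(2) rangeI)
  have g\<iota>: "b \<in> \<B> \<Longrightarrow> ?g (h (\<iota> b)) = \<iota> b" for b using injh \<iota>W CA' by simp
  have "locality_map \<B> N ?A2 (h \<circ> \<iota>)"
    using loc \<iota>W g\<iota> h.zero unfolding locality_map_def by (simp add: A'_def)
  then have "universal_hom s F \<B> g pm_scale ?A2 (h \<circ> \<iota>)"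
    using free tr(1) unfolding is_free_vertex_algebra_def by blast
  then obtain \<phi> where \<phi>: "va_hom s F pm_scale ?A2 \<phi>" "\<And>b. b \<in> \<B> \<Longrightarrow> \<phi> (g b) = h (\<iota> b)"
    unfolding universal_hom_def by auto
  have "va_hom s F t A' (?g \<circ> \<phi>)"
    by (rule va_hom_comp[OF F.vertex_algebra_axioms \<phi>(1) tr(2)])
  then have hom: "va_hom s F t A (?g \<circ> \<phi>)"
    unfolding va_hom_def by (simp add: A'_def)
  have \<phi>\<iota>: "\<forall>b \<in> \<B>. (?g \<circ> \<phi>) (g b) = \<iota> b" using \<phi>(2) g\<iota> by simp
  have "\<psi> x = \<chi> x" if \<psi>: "va_hom s F t A \<psi>" "\<forall>b \<in> \<B>. \<psi> (g b) = \<iota> b"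
    and \<chi>: "va_hom s F t A \<chi>" "\<forall>b \<in> \<B>. \<chi> (g b) = \<iota> b" and x: "x \<in> va_carrier F" for \<psi> \<chi> x
  proof -
    let ?E = "{x \<in> va_carrier F. \<psi> x = \<chi> x}"
    have s0: "\<psi> 0 = 0" "\<chi> 0 = 0"
      using \<psi>(1) \<chi>(1) F.subspace_0[OF F.subspace_carrier] unfolding va_hom_def
      by (metis F.scale_zero_left A.scale_zero_left)+
    have "F.subspace ?E"
      using \<psi>(1) \<chi>(1) s0 unfolding va_hom_def
      by (intro F.subspaceI) (auto intro: F.subspace_0 F.subspace_add F.subspace_scale
          simp: F.subspace_carrier)
    moreover have "g ` \<B> \<subseteq> ?E"
      using \<psi>(2) \<chi>(2) free F.in_carrier
      unfolding is_free_vertex_algebra_def locality_map_def by fastforce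
    moreover have "vac F \<in> ?E" using \<psi>(1) \<chi>(1) F.vac_closed unfolding va_hom_def by simp
    moreover have "\<forall>n. \<forall>x \<in> ?E. \<forall>y \<in> ?E. nprod F n x y \<in> ?E"
      using \<psi>(1) \<chi>(1) F.nprod_closed unfolding va_hom_def by simp
    moreover have "?E \<subseteq> va_carrier F" by blast
    ultimately have "?E = va_carrier F"
      using free unfolding is_free_vertex_algebra_def va_generated_def by blast
    then show ?thesis using x by blast
  qed
  then show ?thesis unfolding universal_hom_def using hom \<phi>\<iota> by blast
qed

end

theory Submission
  imports Defs "HOL-Library.Function_Algebras"
begin

text \<open>
  Write \<open>Y(c)(w) Y(b)(z) a\<close> for the generating series of all products \<open>c\<^sub>m (b\<^sub>n a)\<close>. Two facts
  determine when \<open>c\<^sub>m (b\<^sub>n a)\<close> vanishes.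

  \<^bold>\<open>Upper bound.\<close> In every vertex algebra, if \<open>x\<^sub>m y = 0\<close> for all \<open>m \<ge> N\<close>, then the locality
  identity of \<open>x\<close> and \<open>y\<close> holds already with exponent \<open>N\<close> (lemma \<open>bracket_of_order\<close>). Applied to
  \<open>c\<close> and \<open>b\<close>, it shows that \<open>G = (w - z)^N(c,b) Y(c)(w) Y(b)(z) a\<close> is at the same time bounded
  below in \<open>z\<close> by \<open>-N(b,a)\<close>, as seen from the order \<open>c b a\<close>, and bounded below in \<open>w\<close> by
  \<open>-N(c,a)\<close>, as seen from the order \<open>b c a\<close>. Hence \<open>Y(c)(w) Y(b)(z) a = (w - z)^(-N(c,b)) G\<close>,
  expanded in nonnegative powers of \<open>z\<close>, and the coefficient of \<open>z^(k - N(b,a))\<close> involves only the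
  terms \<open>w^(-N(c,b) - j)\<close> of that expansion with \<open>0 \<le> j \<le> k\<close> and nonzero binomial coefficient. If
  \<open>N(c,b) > 0\<close>, all binomial coefficients are nonzero and the most singular term has \<open>j = k\<close>; if
  \<open>N(c,b) \<le> 0\<close>, it has \<open>j = min k (-N(c,b))\<close>. This gives \<open>order_upper_bound\<close>.

  \<^bold>\<open>Lower bound.\<close> It suffices to find one vertex algebra, with elements satisfying the relations
  of the free one, in which the leading coefficient is nonzero: the universal homomorphism
  transports this to \<open>\<FF>\<close>. The free vertex algebra embeds into a lattice vertex algebra with
  correlation functions \<open>\<Prod> (z\<^sub>i - z\<^sub>j)^(-N(i,j))\<close>, but only products of three generators matter.
  Therefore it is enough to have three letters, one for each of \<open>a, b, c\<close>, each of which is used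
  at most once. The space on which the fields act consists of Laurent polynomials \<open>F\<close> in those of
  the variables \<open>z\<^sub>0, z\<^sub>1, z\<^sub>2\<close> whose letters have not been used, and the field of the letter \<open>i\<close>
  maps \<open>F\<close> to \<open>F(z\<^sub>i = z) \<cdot> \<Prod>\<^sub>j \<iota> (z\<^sub>j - z)^(-N(i,j))\<close>, up to a sign. These fields are mutually
  local by construction (\<open>slot_field_bracket\<close>). If some of \<open>a, b, c\<close> coincide, the corresponding generator
  is the sum of the fields of its letters.

  That mutually local fields generate a vertex algebra under their \<open>n\<close>-th products is the theorem
  of Li. By Zorn's lemma they lie in a maximal system of mutually local fields; Dong's lemma
  (\<open>dong_lemma\<close>) shows that such a system is closed under the products, and \<open>fprod_local\<close> that the
  resulting vertex operators are local (\<open>vertex_algebra_field_va\<close>). Evaluating an iterated product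
  of the three generators on a monomial that behaves like a vacuum vector gives the leading
  coefficient (\<open>nonvanishing_model\<close>).
\<close>

section \<open>Formal distributions in two variables\<close>

type_synonym 'u distribution2 = "int \<Rightarrow> int \<Rightarrow> 'u"
type_synonym 'u distribution3 = "int \<Rightarrow> int \<Rightarrow> int \<Rightarrow> 'u"
type_synonym 'u modes = "int \<Rightarrow> 'u \<Rightarrow> 'u"

text \<open>
  A formal distribution in \<open>w\<close> and \<open>z\<close> is given by the function that sends \<open>r\<close> and \<open>s\<close> to the
  coefficient of \<open>w^r z^s\<close>; this is multiplication by \<open>w - z\<close>.
\<close>
definition mul_diff :: "('u::ab_group_add) distribution2 \<Rightarrow> 'u distribution2" where
  "mul_diff F r s = F (r - 1) s - F r (s - 1)"

definition vanishes_below :: "int \<Rightarrow> ('u::zero) distribution2 \<Rightarrow> bool" where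
  "vanishes_below s0 F \<longleftrightarrow> (\<forall>r s. s < s0 \<longrightarrow> F r s = 0)"

definition lower_bounded :: "('u::zero) distribution2 \<Rightarrow> bool" where
  "lower_bounded F \<longleftrightarrow> (\<exists>s0. vanishes_below s0 F)"

lemma vanishes_belowD: "vanishes_below s0 F \<Longrightarrow> s < s0 \<Longrightarrow> F r s = 0"
  by (simp add: vanishes_below_def)

lemma lower_boundedI: "(\<And>r s. s < s0 \<Longrightarrow> F r s = 0) \<Longrightarrow> lower_bounded F"
  unfolding lower_bounded_def vanishes_below_def by blast

lemma lower_boundedE:
  assumes "lower_bounded F" obtains s0 where "vanishes_below s0 F"
  using assms lower_bounded_def by blast

lemma mul_diff_add: "mul_diff (F + G) = mul_diff F + mul_diff G"
  by (intro ext) (simp add: mul_diff_def)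

lemma mul_diff_minus: "mul_diff (F - G) = mul_diff F - mul_diff G"
  by (intro ext) (simp add: mul_diff_def)

lemma mul_diff_0: "mul_diff 0 = 0"
  by (intro ext) (simp add: mul_diff_def)

lemma mul_diff_pow_add: "(mul_diff ^^ k) (F + G) = (mul_diff ^^ k) F + (mul_diff ^^ k) G"
  by (induction k) (simp_all only: funpow.simps id_apply o_apply mul_diff_add)

lemma mul_diff_pow_minus: "(mul_diff ^^ k) (F - G) = (mul_diff ^^ k) F - (mul_diff ^^ k) G"
  by (induction k) (simp_all only: funpow.simps id_apply o_apply mul_diff_minus)

lemma mul_diff_pow_0: "(mul_diff ^^ k) 0 = 0"
  by (induction k) (simp_all only: funpow.simps id_apply o_apply mul_diff_0)

lemma mul_diff_pow_hom:
  fixes F :: "('u::ab_group_add) distribution2" and h :: "'u \<Rightarrow> 'w::ab_group_add"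
  assumes "\<And>x y. h (x - y) = h x - h y"
  shows "(mul_diff ^^ k) (\<lambda>r s. h (F r s)) = (\<lambda>r s. h ((mul_diff ^^ k) F r s))"
proof (induction k)
  case (Suc k)
  have "(mul_diff ^^ Suc k) (\<lambda>r s. h (F r s)) = mul_diff (\<lambda>r s. h ((mul_diff ^^ k) F r s))"
    unfolding funpow.simps o_apply Suc ..
  also have "\<dots> = (\<lambda>r s. h (mul_diff ((mul_diff ^^ k) F) r s))"
    unfolding mul_diff_def by (simp only: assms)
  finally show ?case unfolding funpow.simps o_apply .
qed (simp only: funpow.simps id_apply)

lemma lower_bounded_minus:
  fixes F G :: "('u::ab_group_add) distribution2"
  assumes "lower_bounded F" "lower_bounded G" shows "lower_bounded (F - G)"
proof -
  obtain a b where "vanishes_below a F" "vanishes_below b G" using assms lower_bounded_def by metis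
  then show ?thesis by (intro lower_boundedI[of "min a b"]) (simp add: vanishes_below_def)
qed

lemma vanishes_below_mul_diff: "vanishes_below a F \<Longrightarrow> vanishes_below a (mul_diff F)"
  by (simp add: vanishes_below_def mul_diff_def)

lemma lower_bounded_mul_diff: "lower_bounded F \<Longrightarrow> lower_bounded (mul_diff F)"
  using vanishes_below_mul_diff lower_bounded_def by blast

text \<open>
  If \<open>(w - z) G = 0\<close>, the coefficient of \<open>w^r z^s\<close> in \<open>G\<close> depends only on \<open>r + s\<close>, so it can be
  moved to a power of \<open>z\<close> at which \<open>G\<close> vanishes.
\<close>
lemma mul_diff_inj:
  assumes "lower_bounded G" and "mul_diff G = 0"
  shows "G = 0"
proof -
  obtain s0 where s0: "vanishes_below s0 G" using assms by (elim lower_boundedE)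
  have "G r s = 0" for r s
  proof (induction "nat (s - s0 + 1)" arbitrary: r s)
    case 0
    then show ?case using s0 by (intro vanishes_belowD) auto
  next
    case (Suc k)
    then have "G (r + 1) (s - 1) = 0" by simp
    moreover have "mul_diff G (r + 1) s = 0" using assms(2) by simp
    ultimately show ?case by (simp add: mul_diff_def)
  qed
  then show ?thesis by (intro ext) simp
qed

lemma mul_diff_pow_inj:
  assumes "lower_bounded G" and "(mul_diff ^^ k) G = 0"
  shows "G = 0"
  using assms
proof (induction k arbitrary: G)
  case (Suc k)
  from Suc.prems(2) have "(mul_diff ^^ k) (mul_diff G) = 0"
    by (simp only: funpow_Suc_right o_apply)
  then have "mul_diff G = 0" using Suc.IH Suc.prems(1) lower_bounded_mul_diff by blast
  then show ?case using mul_diff_inj Suc.prems by blast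
qed (simp only: funpow.simps id_apply)

locale char0_space = vector_space scale
  for scale :: "'k::field_char_0 \<Rightarrow> 'u::ab_group_add \<Rightarrow> 'u" (infixr "*s" 75)
begin

text \<open>
  Multiplication by \<open>(w - z)^n\<close>, expanded in nonnegative powers of \<open>z\<close> (\<open>expand_wz\<close>) or of \<open>w\<close>
  (\<open>expand_zw\<close>). The sum over \<open>j\<close> is finite if the powers of \<open>z\<close>, respectively of \<open>w\<close>, are bounded
  below.
\<close>
definition expand_wz :: "int \<Rightarrow> 'u distribution2 \<Rightarrow> 'u distribution2" where
  "expand_wz n F r s =
     Sum_any (\<lambda>j::nat. ((of_int n gchoose j) * (-1) ^ j) *s F (r - n + int j) (s - int j))"

definition expand_zw :: "int \<Rightarrow> 'u distribution2 \<Rightarrow> 'u distribution2" where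
  "expand_zw n F r s = ((-1) powi n) *s expand_wz n (\<lambda>r s. F s r) s r"

lemma expand_wz_eq_sum:
  assumes "vanishes_below s0 F" and "s - int m < s0"
  shows "expand_wz n F r s =
    (\<Sum>j<m. ((of_int n gchoose j) * (-1) ^ j) *s F (r - n + int j) (s - int j))"
  unfolding expand_wz_def
proof (rule Sum_any.expand_superset)
  have "F (r - n + int j) (s - int j) = 0" if "m \<le> j" for j
    using assms(2) that by (intro vanishes_belowD[OF assms(1)]) simp
  then show "{j. ((of_int n gchoose j) * (-1) ^ j) *s F (r - n + int j) (s - int j) \<noteq> 0} \<subseteq> {..<m}"
    by (auto simp: not_less[symmetric])
qed simp

lemma vanishes_below_expand_wz:
  "vanishes_below s0 F \<Longrightarrow> vanishes_below s0 (expand_wz n F)"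
  using expand_wz_eq_sum[of s0 F _ 0] by (simp add: vanishes_below_def)

lemma expand_wz_lowest: "vanishes_below s0 F \<Longrightarrow> expand_wz n F r s0 = F (r - n) s0"
  using expand_wz_eq_sum[of s0 F s0 1] by simp

lemma lower_bounded_expand_wz: "lower_bounded F \<Longrightarrow> lower_bounded (expand_wz n F)"
  unfolding lower_bounded_def using vanishes_below_expand_wz by blast

lemma expand_wz_add:
  assumes "lower_bounded F" "lower_bounded G"
  shows "expand_wz n (F + G) = expand_wz n F + expand_wz n G"
proof (intro ext)
  fix r s
  obtain a b where a: "vanishes_below a F" and b: "vanishes_below b G"
    using assms unfolding lower_bounded_def by metis
  define c m where "c = min a b" and "m = nat (s - c + 1)"
  have m: "s - int m < c" by (simp add: m_def)
  have F: "vanishes_below c F" and G: "vanishes_below c G" and FG: "vanishes_below c (F + G)"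
    using a b by (simp_all add: c_def vanishes_below_def)
  show "expand_wz n (F + G) r s = (expand_wz n F + expand_wz n G) r s"
    unfolding plus_fun_apply expand_wz_eq_sum[OF FG m] expand_wz_eq_sum[OF F m]
      expand_wz_eq_sum[OF G m] by (simp add: scale_right_distrib sum.distrib)
qed

lemma expand_wz_plus:
  "lower_bounded F \<Longrightarrow> lower_bounded G \<Longrightarrow>
    expand_wz n (\<lambda>r s. F r s + G r s) r s = expand_wz n F r s + expand_wz n G r s"
  using expand_wz_add[of F G n] by (simp add: plus_fun_def)

lemma expand_wz_hom:
  assumes "lower_bounded F" and h: "\<And>x y. h (x + y) = h x + h y" "\<And>c x. h (c *s x) = c *s h x"
  shows "expand_wz n (\<lambda>r s. h (F r s)) = (\<lambda>r s. h (expand_wz n F r s))"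
proof (intro ext)
  fix r s
  obtain a where a: "vanishes_below a F" using assms by (elim lower_boundedE)
  define m where "m = nat (s - a + 1)"
  have m: "s - int m < a" by (simp add: m_def)
  have h0: "h 0 = 0" using h(2)[of 0 0] by simp
  have ha: "vanishes_below a (\<lambda>r s. h (F r s))" using a h0 by (simp add: vanishes_below_def)
  have hsum: "h (sum f A) = (\<Sum>x\<in>A. h (f x))" for f and A :: "nat set"
    by (induction A rule: infinite_finite_induct) (simp_all add: h0 h)
  show "expand_wz n (\<lambda>r s. h (F r s)) r s = h (expand_wz n F r s)"
    by (simp add: expand_wz_eq_sum[OF a m] expand_wz_eq_sum[OF ha m] hsum h)
qed

lemma expand_wz_scale:
  assumes "lower_bounded F"
  shows "expand_wz n (\<lambda>r s. c *s F r s) = (\<lambda>r s. c *s expand_wz n F r s)"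
  by (rule expand_wz_hom[OF assms]) (simp_all add: scale_right_distrib mult.commute)

lemma expand_wz_minus:
  assumes "lower_bounded F" "lower_bounded G"
  shows "expand_wz n (F - G) = expand_wz n F - expand_wz n G"
proof -
  have "lower_bounded (F - G)" using assms lower_bounded_minus by blast
  from expand_wz_add[OF this assms(2), of n] show ?thesis by simp
qed

text \<open>
  This is Pascal's rule for the generalized binomial coefficients.
\<close>
lemma expand_wz_Suc:
  assumes "lower_bounded F"
  shows "expand_wz (n + 1) F = expand_wz n (mul_diff F)"
proof (intro ext)
  fix r s
  obtain a where a: "vanishes_below a F" using assms by (elim lower_boundedE)
  define m where "m = nat (s - a + 1)"
  have m: "s - int (Suc m) < a" by (simp add: m_def)
  define f where "f j = F (r - 1 - n + int j) (s - int j)" for j :: nat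
  define c where "c x j = (of_int x gchoose j) * (-1 :: 'k) ^ j" for x :: int and j :: nat
  have da: "vanishes_below a (mul_diff F)" using a vanishes_below_mul_diff by blast
  have fz: "f (Suc m) = 0" unfolding f_def using m by (intro vanishes_belowD[OF a]) simp
  have "expand_wz n (mul_diff F) r s = (\<Sum>j<Suc m. c n j *s (f j - f (Suc j)))"
    by (subst expand_wz_eq_sum[OF da m]) (auto simp: mul_diff_def f_def c_def algebra_simps)
  also have "\<dots> = (\<Sum>j<Suc m. c n j *s f j) - (\<Sum>j<Suc m. c n j *s f (Suc j))"
    by (simp add: scale_right_diff_distrib sum_subtractf)
  also have "(\<Sum>j<Suc m. c n j *s f (Suc j)) = (\<Sum>j<m. c n j *s f (Suc j))"
    using fz by simp
  also have "(\<Sum>j<Suc m. c n j *s f j) = f 0 + (\<Sum>j<m. c n (Suc j) *s f (Suc j))"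
    by (subst sum.lessThan_Suc_shift) (simp add: c_def)
  also have "f 0 + (\<Sum>j<m. c n (Suc j) *s f (Suc j)) - (\<Sum>j<m. c n j *s f (Suc j))
      = f 0 + (\<Sum>j<m. c (n + 1) (Suc j) *s f (Suc j))"
  proof -
    have "c (n + 1) (Suc j) = c n (Suc j) - c n j" for j
      unfolding c_def using gbinomial_Suc_Suc[of "of_int n :: 'k" j] by (simp add: algebra_simps)
    then show ?thesis by (simp add: scale_left_diff_distrib sum_subtractf)
  qed
  also have "\<dots> = (\<Sum>j<Suc m. c (n + 1) j *s f j)"
    by (subst sum.lessThan_Suc_shift) (simp add: c_def)
  also have "\<dots> = expand_wz (n + 1) F r s"
    by (subst expand_wz_eq_sum[OF a m]) (auto simp: f_def c_def algebra_simps)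
  finally show "expand_wz (n + 1) F r s = expand_wz n (mul_diff F) r s" ..
qed

lemma expand_wz_shift_left:
  "expand_wz n (\<lambda>r s. F (r - i) s) r s = expand_wz n F (r - i) s"
  by (simp add: expand_wz_def algebra_simps)

lemma expand_wz_shift_right:
  "expand_wz n (\<lambda>r s. F r (s - i)) r s = expand_wz n F r (s - i)"
  by (simp add: expand_wz_def algebra_simps)

lemma expand_wz_mul_diff:
  assumes "lower_bounded F"
  shows "expand_wz n (mul_diff F) = mul_diff (expand_wz n F)"
proof -
  have 1: "mul_diff F = (\<lambda>r s. F (r - 1) s) - (\<lambda>r s. F r (s - 1))"
    by (intro ext) (simp add: mul_diff_def)
  obtain a where a: "vanishes_below a F" using assms by (elim lower_boundedE)
  have "lower_bounded (\<lambda>r s. F (r - 1) s)" "lower_bounded (\<lambda>r s. F r (s - 1))"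
    using a by (intro lower_boundedI[of a]; simp add: vanishes_below_def)+
  then show ?thesis unfolding 1
    by (intro ext) (simp add: expand_wz_minus mul_diff_def
      expand_wz_shift_left[where i = 1] expand_wz_shift_right[where i = 1])
qed

lemma expand_wz_pow:
  assumes "lower_bounded F"
  shows "expand_wz (n + int k) F = (mul_diff ^^ k) (expand_wz n F)"
proof (induction k)
  case (Suc k)
  have "expand_wz (n + int (Suc k)) F = expand_wz ((n + int k) + 1) F" by (simp add: algebra_simps)
  also have "\<dots> = mul_diff (expand_wz (n + int k) F)"
    using assms by (simp only: expand_wz_Suc expand_wz_mul_diff)
  finally show ?case using Suc by simp
qed simp

lemma expand_wz_0: "expand_wz 0 F = F"
proof (intro ext)
  fix r s
  have "expand_wz 0 F r s = (\<Sum>j<Suc 0. ((0 gchoose j) * (-1) ^ j) *s F (r + int j) (s - int j))"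
    unfolding expand_wz_def
    by (rule trans[OF Sum_any.expand_superset[where A = "{..<Suc 0}"]])
      (auto simp: gbinomial_0_left split: if_splits)
  then show "expand_wz 0 F r s = F r s" by simp
qed

lemma expand_wz_nat: "lower_bounded F \<Longrightarrow> expand_wz (int k) F = (mul_diff ^^ k) F"
  using expand_wz_pow[of F 0 k] by (simp add: expand_wz_0)

text \<open>Both sides become equal after multiplication by a power of \<open>w - z\<close>, which is injective.\<close>
lemma expand_wz_expand_wz:
  assumes F: "lower_bounded F"
  shows "expand_wz m (expand_wz n F) = expand_wz (m + n) F"
proof -
  define k l where "k = nat (- m)" and "l = nat m"
  then have m: "m + int k = int l" by simp
  let ?A = "expand_wz m (expand_wz n F)" and ?B = "expand_wz (m + n) F"
  have A: "(mul_diff ^^ k) ?A = (mul_diff ^^ l) (expand_wz n F)"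
    using F lower_bounded_expand_wz
    by (simp add: expand_wz_pow[symmetric] m expand_wz_nat)
  have "m + n + int k = n + int l" using m by simp
  then have "(mul_diff ^^ k) ?B = expand_wz (n + int l) F"
    using expand_wz_pow[OF F, of "m + n" k] by (simp only:)
  then have "(mul_diff ^^ k) (?A - ?B) = 0"
    using F by (simp add: mul_diff_pow_minus A expand_wz_pow)
  moreover have "lower_bounded (?A - ?B)"
    using F lower_bounded_expand_wz lower_bounded_minus by blast
  ultimately have "?A - ?B = 0" by (rule mul_diff_pow_inj[rotated])
  then show ?thesis by simp
qed

text \<open>
  The product rule for the derivative by \<open>w\<close>, and below for the derivative by \<open>z\<close>, of
  \<open>(w - z)^n F\<close>; on coefficients these are the absorption identities of binomial coefficients.
\<close>
lemma expand_wz_deriv_w: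
  assumes "lower_bounded F"
  shows "of_int (r + 1) *s expand_wz n F (r + 1) s =
    of_int n *s expand_wz (n - 1) F r s +
    expand_wz n (\<lambda>r s. of_int (r + 1) *s F (r + 1) s) r s"
proof -
  obtain a where a: "vanishes_below a F" using assms by (elim lower_boundedE)
  define m where "m = nat (s - a + 1)"
  have m: "s - int m < a" by (simp add: m_def)
  have "of_int (r + 1) * ((of_int n gchoose j) * (-1) ^ j) =
      of_int n * ((of_int (n - 1) gchoose j) * (-1) ^ j)
      + (of_int n gchoose j) * (-1) ^ j * (of_int (r - n + int j + 1) :: 'k)" for j
  proof -
    have "of_int n * ((of_int (n - 1) gchoose j) * (-1) ^ j) =
        (of_int n - of_nat j) * (of_int n gchoose j) * (-1 :: 'k) ^ j"
      using gbinomial_absorb_comp[of "of_int n :: 'k" j] by (simp add: mult.assoc[symmetric])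
    then show ?thesis by (simp only:) (simp add: algebra_simps)
  qed
  then have "of_int (r + 1) *s ((of_int n gchoose j) * (-1) ^ j) *s x =
      of_int n *s ((of_int (n - 1) gchoose j) * (-1) ^ j) *s x
      + ((of_int n gchoose j) * (-1) ^ j) *s (of_int (r - n + int j + 1) :: 'k) *s x" for j x
    by (simp only: scale_scale scale_left_distrib[symmetric])
  then have "(\<Sum>j<m. of_int (r + 1) *s ((of_int n gchoose j) * (-1) ^ j) *s F (r + 1 - n + int j)
      (s - int j))
    = (\<Sum>j<m. of_int n *s ((of_int (n - 1) gchoose j) * (-1) ^ j) *s F (r + 1 - n + int j)
        (s - int j))
      + (\<Sum>j<m. ((of_int n gchoose j) * (-1) ^ j) *s (of_int (r - n + int j + 1) :: 'k) *s F
          (r + 1 - n + int j) (s - int j))"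
    by (simp only: sum.distrib[symmetric])
  moreover have da: "vanishes_below a (\<lambda>r s. of_int (r + 1) *s F (r + 1) s)"
    using a by (simp add: vanishes_below_def)
  have e: "r - (n - 1) + int j = r + 1 - n + int j" "r - n + int j + 1 = r + 1 - n + int j" for j
      by simp_all
  ultimately show ?thesis
    unfolding expand_wz_eq_sum[OF a m] expand_wz_eq_sum[OF da m] scale_sum_right e by simp
qed

lemma expand_wz_deriv_z:
  assumes "lower_bounded F"
  shows "of_int (s + 1) *s expand_wz n F r (s + 1) =
    - (of_int n *s expand_wz (n - 1) F r s) +
    expand_wz n (\<lambda>r s. of_int (s + 1) *s F r (s + 1)) r s"
proof -
  obtain a where a: "vanishes_below a F" using assms by (elim lower_boundedE)
  define m where "m = nat (s - a + 2)"
  have m1: "s + 1 - int (Suc m) < a" and m2: "s - int (Suc m) < a - 1" and m3: "s - int m < a"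
    by (simp_all add: m_def)
  have da: "vanishes_below (a - 1) (\<lambda>r s. of_int (s + 1) *s F r (s + 1))"
    using a by (simp add: vanishes_below_def)
  define f where "f j = F (r - n + int j) (s + 1 - int j)" for j :: nat
  define c where "c x j = (of_int x gchoose j) * (-1 :: 'k) ^ j" for x :: int and j :: nat
  have 1: "expand_wz n F r (s + 1) = (\<Sum>j<Suc m. c n j *s f j)"
    by (subst expand_wz_eq_sum[OF a m1]) (auto simp: f_def c_def)
  have 2: "expand_wz n (\<lambda>r s. of_int (s + 1) *s F r (s + 1)) r s
      = (\<Sum>j<Suc m. c n j *s of_int (s + 1 - int j) *s f j)"
    by (subst expand_wz_eq_sum[OF da m2])
        (auto simp: f_def c_def algebra_simps simp del: sum.lessThan_Suc)
  have 3: "expand_wz (n - 1) F r s = (\<Sum>j<m. c (n - 1) j *s f (Suc j))"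
    by (subst expand_wz_eq_sum[OF a m3]) (auto simp: f_def c_def algebra_simps)
  have "of_int (s + 1) *s (\<Sum>j<Suc m. c n j *s f j) -
      (\<Sum>j<Suc m. c n j *s of_int (s + 1 - int j) *s f j)
      = (\<Sum>j<Suc m. (of_nat j * c n j) *s f j)"
    by (simp add: scale_sum_right sum_subtractf[symmetric] scale_left_diff_distrib[symmetric]
        algebra_simps del: sum.lessThan_Suc)
  also have "\<dots> = (\<Sum>j<m. (of_nat (Suc j) * c n (Suc j)) *s f (Suc j))"
    by (subst sum.lessThan_Suc_shift) simp
  also have "\<dots> = (\<Sum>j<m. - (of_int n *s c (n - 1) j *s f (Suc j)))"
  proof (rule sum.cong)
    fix j
    have "of_nat (Suc j) * c n (Suc j) = - (of_int n * c (n - 1) j)"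
      unfolding c_def using gbinomial_absorption[of j "of_int n :: 'k"]
      by (metis (no_types, lifting) mult.assoc mult_minus1 mult_minus_right of_int_1 of_int_diff
          power_Suc)
    then show "(of_nat (Suc j) * c n (Suc j)) *s f (Suc j)
        = - (of_int n *s c (n - 1) j *s f (Suc j))"
      by simp
  qed simp
  finally have "of_int (s + 1) *s expand_wz n F r (s + 1)
      - expand_wz n (\<lambda>r s. of_int (s + 1) *s F r (s + 1)) r s
      = - (of_int n *s expand_wz (n - 1) F r s)"
    unfolding 1 2 3 by (simp add: scale_sum_right sum_negf)
  then show ?thesis by (simp add: algebra_simps)
qed

end

section \<open>Locality of fields\<close>

text \<open>
  Multiplication of a distribution in \<open>w, z, u\<close> by \<open>w - z\<close>, \<open>w - u\<close> and \<open>z - u\<close>.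
\<close>
definition mul12 :: "('u::ab_group_add) distribution3 \<Rightarrow> 'u distribution3" where
  "mul12 E r s t = E (r - 1) s t - E r (s - 1) t"

definition mul13 :: "('u::ab_group_add) distribution3 \<Rightarrow> 'u distribution3" where
  "mul13 E r s t = E (r - 1) s t - E r s (t - 1)"

definition mul23 :: "('u::ab_group_add) distribution3 \<Rightarrow> 'u distribution3" where
  "mul23 E r s t = E r (s - 1) t - E r s (t - 1)"

lemma mul12_pow: "(mul12 ^^ k) E = (\<lambda>r s t. (mul_diff ^^ k) (\<lambda>r s. E r s t) r s)"
proof (induction k)
  case (Suc k)
  show ?case unfolding funpow.simps o_apply Suc by (intro ext) (simp only: mul12_def mul_diff_def)
qed simp

lemma mul13_pow: "(mul13 ^^ k) E = (\<lambda>r s t. (mul_diff ^^ k) (\<lambda>r t. E r s t) r t)"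
proof (induction k)
  case (Suc k)
  show ?case unfolding funpow.simps o_apply Suc by (intro ext) (simp only: mul13_def mul_diff_def)
qed simp

lemma mul23_pow: "(mul23 ^^ k) E = (\<lambda>r s t. (mul_diff ^^ k) (\<lambda>s t. E r s t) s t)"
proof (induction k)
  case (Suc k)
  show ?case unfolding funpow.simps o_apply Suc by (intro ext) (simp only: mul23_def mul_diff_def)
qed simp

lemma mul12_minus: "mul12 (X - Y) = mul12 X - mul12 Y"
  and mul13_minus: "mul13 (X - Y) = mul13 X - mul13 Y"
  and mul23_minus: "mul23 (X - Y) = mul23 X - mul23 Y"
  by (intro ext; simp add: mul12_def mul13_def mul23_def)+

lemma mul13_mul12: "mul13 (mul12 X) = mul12 (mul13 X)"
  and mul23_mul12: "mul23 (mul12 X) = mul12 (mul23 X)"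
  and mul13_mul23: "mul13 (mul23 X) = mul23 (mul13 X)"
  by (intro ext; simp add: mul12_def mul13_def mul23_def)+

lemma mul13_minus_mul12: "mul13 X - mul12 X = mul23 X"
  by (intro ext) (simp add: mul12_def mul13_def mul23_def)

lemma additive_pow:
  fixes A :: "'a::ab_group_add \<Rightarrow> 'a"
  assumes "\<And>x y. A (x - y) = A x - A y"
  shows "(A ^^ k) (x - y) = (A ^^ k) x - (A ^^ k) y" and "(A ^^ k) 0 = 0"
proof -
  show *: "(A ^^ k) (x - y) = (A ^^ k) x - (A ^^ k) y" for x y
    by (induction k) (simp_all add: assms)
  show "(A ^^ k) 0 = 0" using *[of 0 0] by simp
qed

lemma pow_commute:
  assumes "\<And>x. A (C x) = C (A x)"
  shows "(A ^^ k) ((C ^^ l) x) = (C ^^ l) ((A ^^ k) x)"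
proof -
  have 1: "(A ^^ k) (C x) = C ((A ^^ k) x)" for x
    by (induction k) (simp_all add: assms)
  show ?thesis by (induction l) (simp_all add: 1)
qed

text \<open>
  Each monomial of degree \<open>p + q\<close> in the commuting operators \<open>A\<close> and \<open>C\<close> contains \<open>A^p\<close> or \<open>C^q\<close>.
\<close>
lemma nilpotent_diff:
  fixes A C :: "'a::ab_group_add \<Rightarrow> 'a"
  assumes A: "\<And>x y. A (x - y) = A x - A y" and C: "\<And>x y. C (x - y) = C x - C y"
    and AC: "\<And>x. A (C x) = C (A x)"
  shows "(A ^^ p) y = 0 \<Longrightarrow> (C ^^ q) y = 0 \<Longrightarrow> ((\<lambda>x. A x - C x) ^^ (p + q)) y = 0"
proof (induction "p + q" arbitrary: p q y)
  case 0
  then show ?case by simp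
next
  case (Suc n)
  let ?B = "\<lambda>x. A x - C x"
  have B: "?B (x - y) = ?B x - ?B y" for x y by (simp add: A C)
  show ?case
  proof (cases "y = 0")
    case True
    then show ?thesis using additive_pow(2)[of ?B] B by blast
  next
    case False
    then obtain p' q' where pq: "p = Suc p'" "q = Suc q'"
      using Suc.prems by (cases p; cases q) auto
    have "(A ^^ p') (A y) = 0" "(C ^^ q') (C y) = 0"
      using Suc.prems unfolding pq by (simp_all add: funpow_swap1)
    moreover have "(C ^^ q) (A y) = 0" "(A ^^ p) (C y) = 0"
      using Suc.prems pow_commute[of A C 1 q y] pow_commute[of A C p 1 y] AC
        additive_pow(2)[OF A, of 1] additive_pow(2)[OF C, of 1] by simp_all
    ultimately have "(?B ^^ (p' + q)) (A y) = 0" "(?B ^^ (p + q')) (C y) = 0"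
      using Suc.hyps(1)[of p' q "A y"] Suc.hyps(1)[of p q' "C y"] Suc.hyps(2) pq by simp_all
    moreover have "p + q = Suc n" "p' + q = n" "p + q' = n" using Suc.hyps(2) pq by simp_all
    ultimately show ?thesis
      using additive_pow(1)[OF B, of n "A y" "C y"] by (simp only: funpow_Suc_right o_apply) simp
  qed
qed

context char0_space
begin

lemma mul_diff_pow_flip: "(mul_diff ^^ k) (\<lambda>r s. F s r) = (\<lambda>r s. (-1) ^ k *s (mul_diff ^^ k) F s r)"
proof (induction k)
  case (Suc k)
  show ?case unfolding funpow.simps o_apply Suc
    by (intro ext) (simp add: mul_diff_def scale_right_diff_distrib)
qed simp

lemma expand_zw_pow:
  assumes "lower_bounded (\<lambda>r s. F s r)"
  shows "expand_zw (n + int k) F = (mul_diff ^^ k) (expand_zw n F)"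
proof -
  have 1: "(mul_diff ^^ k) (\<lambda>r s. c *s G r s) = (\<lambda>r s. c *s (mul_diff ^^ k) G r s)" for c G
    by (rule mul_diff_pow_hom) (rule scale_right_diff_distrib)
  have 2: "expand_zw n F = (\<lambda>r s. (-1) powi n *s (\<lambda>r s. expand_wz n (\<lambda>r s. F s r) s r) r s)"
    by (intro ext) (simp add: expand_zw_def)
  have 3: "expand_zw (n + int k) F
      = (\<lambda>r s. (-1) powi n *s (-1) ^ k *s (mul_diff ^^ k) (expand_wz n (\<lambda>r s. F s r)) s r)"
    by (intro ext) (simp add: expand_zw_def expand_wz_pow[OF assms] power_int_add)
  show ?thesis
    using 3 1[of "(-1) powi n" "\<lambda>r s. expand_wz n (\<lambda>r s. F s r) s r"]
      mul_diff_pow_flip[of k "expand_wz n (\<lambda>r s. F s r)"] 2 by simp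
qed

lemma expand_zw_nat:
  assumes "lower_bounded (\<lambda>r s. F s r)"
  shows "expand_zw (int k) F = (mul_diff ^^ k) F"
proof -
  have "expand_zw 0 F = F" by (intro ext) (simp add: expand_zw_def expand_wz_0)
  then show ?thesis using expand_zw_pow[OF assms, of 0 k] by simp
qed

text \<open>
  A field \<open>\<phi>\<close> is indexed by the exponent of \<open>z\<close> in \<open>\<phi>(z)\<close>, so that its \<open>n\<close>-th mode is
  \<open>\<phi> (- n - 1)\<close>.
\<close>
definition field_op :: "'u modes \<Rightarrow> bool" where
  "field_op \<phi> \<longleftrightarrow> (\<forall>r. Vector_Spaces.linear scale scale (\<phi> r)) \<and> (\<forall>v. \<exists>r0. \<forall>r<r0. \<phi> r v = 0)"

lemma field_opI:
  assumes "\<And>r x y. \<phi> r (x + y) = \<phi> r x + \<phi> r y" "\<And>r c x. \<phi> r (c *s x) = c *s \<phi> r x"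
    "\<And>v. \<exists>r0. \<forall>r<r0. \<phi> r v = 0"
  shows "field_op \<phi>"
proof -
  have "Vector_Spaces.linear scale scale (\<phi> r)" for r
    by unfold_locales (simp_all add: assms)
  then show ?thesis unfolding field_op_def using assms(3) by blast
qed

lemma
  assumes "field_op \<phi>"
  shows field_add: "\<phi> r (x + y) = \<phi> r x + \<phi> r y"
    and field_scale: "\<phi> r (c *s x) = c *s \<phi> r x"
    and field_diff: "\<phi> r (x - y) = \<phi> r x - \<phi> r y"
    and field_0: "\<phi> r 0 = 0"
    and field_sum: "\<phi> r (sum f A) = (\<Sum>i\<in>A. \<phi> r (f i))"
proof -
  interpret Vector_Spaces.linear scale scale "\<phi> r" using assms by (simp add: field_op_def)
  show "\<phi> r (x + y) = \<phi> r x + \<phi> r y" "\<phi> r (c *s x) = c *s \<phi> r x" "\<phi> r (x - y) = \<phi> r x - \<phi> r y"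
    "\<phi> r 0 = 0" "\<phi> r (sum f A) = (\<Sum>i\<in>A. \<phi> r (f i))"
    by (rule add scale diff zero sum)+
qed

lemma field_truncE:
  assumes "field_op \<phi>" obtains r0 where "\<And>r. r < r0 \<Longrightarrow> \<phi> r v = 0"
  using assms unfolding field_op_def by blast

lemma lower_bounded_comp:
  assumes "field_op \<phi>" "field_op \<psi>"
  shows "lower_bounded (\<lambda>r s. \<phi> (f r) (\<psi> s v))"
proof -
  obtain s0 where "\<And>s. s < s0 \<Longrightarrow> \<psi> s v = 0" using field_truncE[OF assms(2)] by blast
  then show ?thesis by (intro lower_boundedI[of s0]) (simp add: field_0[OF assms(1)])
qed

text \<open>
  The difference of the two sides of the locality identity with exponent \<open>n\<close>; the scalar \<open>e\<close>
  stands for the Koszul sign.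
\<close>
definition bracket ::
    "'k \<Rightarrow> int \<Rightarrow> 'u modes \<Rightarrow> 'u modes \<Rightarrow> 'u \<Rightarrow> 'u distribution2" where
  "bracket e n \<phi> \<psi> v r s =
     expand_wz n (\<lambda>r s. \<phi> r (\<psi> s v)) r s - e *s expand_zw n (\<lambda>r s. \<psi> s (\<phi> r v)) r s"

lemma bracket_pow:
  assumes "field_op \<phi>" "field_op \<psi>"
  shows "bracket e (n + int k) \<phi> \<psi> v = (mul_diff ^^ k) (bracket e n \<phi> \<psi> v)"
proof -
  have *: "bracket e n \<phi> \<psi> v = expand_wz n (\<lambda>r s. \<phi> r (\<psi> s v))
      - (\<lambda>r s. e *s expand_zw n (\<lambda>r s. \<psi> s (\<phi> r v)) r s)" for n
    by (intro ext) (simp add: bracket_def)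
  have 1: "(mul_diff ^^ k) (\<lambda>r s. e *s G r s) = (\<lambda>r s. e *s (mul_diff ^^ k) G r s)" for G
    by (rule mul_diff_pow_hom) (rule scale_right_diff_distrib)
  show ?thesis unfolding * mul_diff_pow_minus 1
    by (simp only: expand_wz_pow expand_zw_pow lower_bounded_comp[OF assms]
      lower_bounded_comp[OF assms(2,1)])
qed

lemma bracket_nat:
  assumes "field_op \<phi>" "field_op \<psi>"
  shows "bracket e (int k) \<phi> \<psi> v = (mul_diff ^^ k) (\<lambda>r s. \<phi> r (\<psi> s v) - e *s \<psi> s (\<phi> r v))"
proof -
  have "bracket e 0 \<phi> \<psi> v = (\<lambda>r s. \<phi> r (\<psi> s v) - e *s \<psi> s (\<phi> r v))"
    by (intro ext) (simp add: bracket_def expand_wz_0 expand_zw_def)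
  then show ?thesis using bracket_pow[OF assms, of e 0 k v] by simp
qed

text \<open>
  The exponent may be taken nonnegative, because an identity with exponent \<open>n\<close> implies those with
  larger exponents (\<open>bracket_pow\<close>). Then no expansion is involved.
\<close>
definition is_local :: "'k \<Rightarrow> 'u modes \<Rightarrow> 'u modes \<Rightarrow> bool" where
  "is_local e \<phi> \<psi> \<longleftrightarrow> (\<exists>k. \<forall>v. bracket e (int k) \<phi> \<psi> v = 0)"

lemma local_mono:
  assumes "field_op \<phi>" "field_op \<psi>" "\<And>v. bracket e n \<phi> \<psi> v = 0" "n \<le> m"
  shows "bracket e m \<phi> \<psi> v = 0"
proof -
  have "m = n + int (nat (m - n))" using assms(4) by simp
  then show ?thesis using bracket_pow[OF assms(1,2), of e n "nat (m - n)" v] assms(3)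
    by (metis mul_diff_pow_0)
qed

definition expand12 :: "int \<Rightarrow> 'u distribution3 \<Rightarrow> 'u distribution3" where
  "expand12 n E r s t = expand_wz n (\<lambda>r s. E r s t) r s"

definition expand21 :: "int \<Rightarrow> 'u distribution3 \<Rightarrow> 'u distribution3" where
  "expand21 n E r s t = expand_zw n (\<lambda>r s. E r s t) r s"

lemma expand12_mul13:
  assumes "\<And>t. lower_bounded (\<lambda>r s. E r s t)"
  shows "expand12 n (mul13 E) = mul13 (expand12 n E)"
proof (intro ext)
  fix r s t
  have 1: "(\<lambda>r s. mul13 E r s t) = (\<lambda>r s. E (r - 1) s t) - (\<lambda>r s. E r s (t - 1))"
    by (intro ext) (simp add: mul13_def)
  obtain a where "vanishes_below a (\<lambda>r s. E r s t)" by (rule lower_boundedE[OF assms])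
  then have 2: "lower_bounded (\<lambda>r s. E (r - 1) s t)"
    by (intro lower_boundedI[of a]) (simp add: vanishes_below_def)
  show "expand12 n (mul13 E) r s t = mul13 (expand12 n E) r s t"
    unfolding expand12_def 1 unfolding expand_wz_minus[OF 2 assms]
    by (simp only: minus_apply mul13_def expand_wz_shift_left[of n "\<lambda>r s. E r s t" 1])
qed

lemma expand12_mul23:
  assumes "\<And>t. lower_bounded (\<lambda>r s. E r s t)"
  shows "expand12 n (mul23 E) = mul23 (expand12 n E)"
proof (intro ext)
  fix r s t
  have 1: "(\<lambda>r s. mul23 E r s t) = (\<lambda>r s. E r (s - 1) t) - (\<lambda>r s. E r s (t - 1))"
    by (intro ext) (simp add: mul23_def)
  obtain a where "vanishes_below a (\<lambda>r s. E r s t)" by (rule lower_boundedE[OF assms])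
  then have 2: "lower_bounded (\<lambda>r s. E r (s - 1) t)"
    by (intro lower_boundedI[of a]) (simp add: vanishes_below_def)
  show "expand12 n (mul23 E) r s t = mul23 (expand12 n E) r s t"
    unfolding expand12_def 1 unfolding expand_wz_minus[OF 2 assms]
    by (simp only: minus_apply mul23_def expand_wz_shift_right[of n "\<lambda>r s. E r s t" 1])
qed

lemma lower_bounded_mul13:
  assumes "\<And>t. lower_bounded (\<lambda>r s. E r s t)" shows "lower_bounded (\<lambda>r s. mul13 E r s t)"
proof -
  obtain a b where "vanishes_below a (\<lambda>r s. E r s t)" "vanishes_below b (\<lambda>r s. E r s (t - 1))"
    using assms by (metis lower_boundedE)
  then show ?thesis
    by (intro lower_boundedI[of "min a b"]) (simp add: vanishes_below_def mul13_def)
qed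

lemma lower_bounded_mul23:
  assumes "\<And>t. lower_bounded (\<lambda>r s. E r s t)" shows "lower_bounded (\<lambda>r s. mul23 E r s t)"
proof -
  obtain a b where "vanishes_below a (\<lambda>r s. E r s t)" "vanishes_below b (\<lambda>r s. E r s (t - 1))"
    using assms by (metis lower_boundedE)
  then show ?thesis
    by (intro lower_boundedI[of "min a b"]) (simp add: vanishes_below_def mul23_def)
qed

lemma lower_bounded_mul13_pow:
  assumes "\<And>t. lower_bounded (\<lambda>r s. E r s t)" shows "lower_bounded (\<lambda>r s. (mul13 ^^ k) E r s t)"
  using assms by (induction k arbitrary: t) (simp_all add: lower_bounded_mul13)

lemma lower_bounded_mul23_pow:
  assumes "\<And>t. lower_bounded (\<lambda>r s. E r s t)" shows "lower_bounded (\<lambda>r s. (mul23 ^^ k) E r s t)"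
  using assms by (induction k arbitrary: t) (simp_all add: lower_bounded_mul23)

lemma expand12_mul_pow:
  assumes "\<And>t. lower_bounded (\<lambda>r s. E r s t)"
  shows "expand12 n ((mul13 ^^ p) ((mul23 ^^ q) E)) = (mul13 ^^ p) ((mul23 ^^ q) (expand12 n E))"
proof -
  have 1: "expand12 n ((mul23 ^^ q) E) = (mul23 ^^ q) (expand12 n E)"
    using assms by (induction q) (simp_all add: expand12_mul23 lower_bounded_mul23_pow)
  have "lower_bounded (\<lambda>r s. (mul23 ^^ q) E r s t)" for t
    using assms lower_bounded_mul23_pow by blast
  then have "expand12 n ((mul13 ^^ p) ((mul23 ^^ q) E))
      = (mul13 ^^ p) (expand12 n ((mul23 ^^ q) E))"
    by (induction p) (simp_all add: expand12_mul13 lower_bounded_mul13_pow)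
  then show ?thesis by (simp add: 1)
qed

lemma expand21_mul_pow:
  assumes "\<And>t. lower_bounded (\<lambda>s r. E r s t)"
  shows "expand21 n ((mul13 ^^ p) ((mul23 ^^ q) E)) = (mul13 ^^ p) ((mul23 ^^ q) (expand21 n E))"
proof -
  have sw: "(mul13 ^^ q) ((mul23 ^^ p) (\<lambda>r s t. E s r t))
      = (\<lambda>r s t. (mul13 ^^ p) ((mul23 ^^ q) E) s r t)"
    for p q and E :: "'u distribution3"
  proof -
    have "(mul23 ^^ p) (\<lambda>r s t. E s r t) = (\<lambda>r s t. (mul13 ^^ p) E s r t)"
      by (simp only: mul13_pow mul23_pow)
    then have "(mul13 ^^ q) ((mul23 ^^ p) (\<lambda>r s t. E s r t))
        = (mul13 ^^ q) (\<lambda>r s t. (mul13 ^^ p) E s r t)"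
      by (rule arg_cong)
    also have "\<dots> = (\<lambda>r s t. (mul23 ^^ q) ((mul13 ^^ p) E) s r t)"
      by (simp only: mul13_pow[of q] mul23_pow[of q])
    finally show ?thesis by (simp only: pow_commute[of mul13 mul23, OF mul13_mul23])
  qed
  have sc13: "(mul13 ^^ p) (\<lambda>r s t. c *s E r s t) = (\<lambda>r s t. c *s (mul13 ^^ p) E r s t)"
    and sc23: "(mul23 ^^ p) (\<lambda>r s t. c *s E r s t) = (\<lambda>r s t. c *s (mul23 ^^ p) E r s t)"
    for p c and E :: "'u distribution3"
    by (simp_all add: mul13_pow mul23_pow mul_diff_pow_hom[where h = "scale c"]
        scale_right_diff_distrib)
  have e: "expand21 n E = (\<lambda>r s t. ((-1) powi n) *s expand12 n (\<lambda>r s t. E s r t) s r t)" for E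
    by (intro ext) (simp add: expand21_def expand12_def expand_zw_def)
  have "expand12 n (\<lambda>r s t. (mul13 ^^ p) ((mul23 ^^ q) E) s r t)
      = expand12 n ((mul13 ^^ q) ((mul23 ^^ p) (\<lambda>r s t. E s r t)))"
    by (rule arg_cong[OF sw[symmetric]])
  also have "\<dots> = (mul13 ^^ q) ((mul23 ^^ p) (expand12 n (\<lambda>r s t. E s r t)))"
    using assms by (intro expand12_mul_pow)
  also have "\<dots> = (\<lambda>r s t. (mul13 ^^ p)
      ((mul23 ^^ q) (\<lambda>r s t. expand12 n (\<lambda>r s t. E s r t) s r t)) s r t)"
    by (rule sw)
  finally show ?thesis by (simp only: e sc13 sc23)
qed

text \<open>
  Moving \<open>\<chi>(u)\<close> past \<open>\<phi>(w)\<close> and \<open>\<psi>(z)\<close> costs a power of \<open>w - u\<close> and one of \<open>z - u\<close>. Multiplication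
  by these commutes with the two expansions of \<open>(w - z)^n\<close>, so \<open>\<chi>(u)\<close> can also be moved past the
  whole bracket.
\<close>
lemma bracket_locality:
  assumes \<phi>: "field_op \<phi>" and \<psi>: "field_op \<psi>" and \<chi>: "field_op \<chi>"
    and 1: "\<And>v. bracket e1 (int p) \<phi> \<chi> v = 0" and 2: "\<And>v. bracket e2 (int p) \<psi> \<chi> v = 0"
  shows "(mul13 ^^ p) ((mul23 ^^ p)
    (\<lambda>r s t. bracket e3 n \<phi> \<psi> (\<chi> t v) r s - (e1 * e2) *s \<chi> t (bracket e3 n \<phi> \<psi> v r s))) = 0"
proof -
  note f = \<phi> \<psi> \<chi>
  let ?M = "\<lambda>X. (mul13 ^^ p) ((mul23 ^^ p) X)"
  have M_minus: "?M (X - Y) = ?M X - ?M Y" for X Y :: "'u distribution3"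
    by (simp only: additive_pow(1)[of mul13, OF mul13_minus]
        additive_pow(1)[of mul23, OF mul23_minus])
  have hom13: "(mul13 ^^ p) (\<lambda>r s t. h (E r s t)) = (\<lambda>r s t. h ((mul13 ^^ p) E r s t))"
    and hom23: "(mul23 ^^ p) (\<lambda>r s t. h (E r s t)) = (\<lambda>r s t. h ((mul23 ^^ p) E r s t))"
    if "\<And>x y. h (x - y) = h x - h y" for h :: "'u \<Rightarrow> 'u" and E
    by (simp_all add: mul13_pow mul23_pow mul_diff_pow_hom[where h = h] that)
  have M_scale: "?M (\<lambda>r s t. c *s E r s t) = (\<lambda>r s t. c *s ?M E r s t)" for c E
    by (simp add: hom13 hom23 scale_right_diff_distrib)
  have lmul: "(mul_diff ^^ p) (\<lambda>r t. \<alpha> r (\<chi> t v))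
      = (\<lambda>r t. e *s (mul_diff ^^ p) (\<lambda>r t. \<chi> t (\<alpha> r v)) r t)"
    if "field_op \<alpha>" "\<And>v. bracket e (int p) \<alpha> \<chi> v = 0" for \<alpha> e v
  proof -
    have "(mul_diff ^^ p) ((\<lambda>r t. \<alpha> r (\<chi> t v)) - (\<lambda>r t. e *s \<chi> t (\<alpha> r v))) = 0"
      using that(2)[of v] unfolding bracket_nat[OF that(1) \<chi>] by (simp only: fun_diff_def)
    then show ?thesis
      unfolding mul_diff_pow_minus
          mul_diff_pow_hom[where h = "scale e", OF scale_right_diff_distrib]
      by simp
  qed
  have swap: "?M (\<lambda>r s t. \<alpha> r (\<beta> s (\<chi> t v)))
      = (\<lambda>r s t. (e * e') *s ?M (\<lambda>r s t. \<chi> t (\<alpha> r (\<beta> s v))) r s t)"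
    if "field_op \<alpha>" "field_op \<beta>" "\<And>v. bracket e (int p) \<alpha> \<chi> v = 0"
        "\<And>v. bracket e' (int p) \<beta> \<chi> v = 0"
    for \<alpha> \<beta> e e'
  proof -
    have "(mul23 ^^ p) (\<lambda>r s t. \<alpha> r (\<beta> s (\<chi> t v)))
        = (\<lambda>r s t. \<alpha> r ((mul_diff ^^ p) (\<lambda>s t. \<beta> s (\<chi> t v)) s t))"
      unfolding mul23_pow by (simp only: mul_diff_pow_hom[of "\<alpha> _", OF field_diff[OF that(1)]])
    also have "\<dots> = (\<lambda>r s t. e' *s (\<alpha> r ((mul_diff ^^ p) (\<lambda>s t. \<chi> t (\<beta> s v)) s t)))"
      by (simp only: lmul[OF that(2,4)] field_scale[OF that(1)])
    also have "\<dots> = (\<lambda>r s t. e' *s (mul23 ^^ p) (\<lambda>r s t. \<alpha> r (\<chi> t (\<beta> s v))) r s t)"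
      unfolding mul23_pow by (simp only: mul_diff_pow_hom[of "\<alpha> _", OF field_diff[OF that(1)]])
    finally have "?M (\<lambda>r s t. \<alpha> r (\<beta> s (\<chi> t v)))
        = (\<lambda>r s t. e' *s (mul23 ^^ p) ((mul13 ^^ p) (\<lambda>r s t. \<alpha> r (\<chi> t (\<beta> s v)))) r s t)"
      by (simp only: hom13[of "scale _", OF scale_right_diff_distrib]
        pow_commute[of mul13 mul23, OF mul13_mul23])
    also have "(mul13 ^^ p) (\<lambda>r s t. \<alpha> r (\<chi> t (\<beta> s v)))
        = (\<lambda>r s t. e *s (mul13 ^^ p) (\<lambda>r s t. \<chi> t (\<alpha> r (\<beta> s v))) r s t)"
      unfolding mul13_pow by (simp only: lmul[OF that(1,3)])
    finally show ?thesis
      by (simp only: hom23[of "scale _", OF scale_right_diff_distrib] scale_scale mult.commute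
        pow_commute[of mul13 mul23, OF mul13_mul23])
  qed
  define X1 where "X1 = (\<lambda>r s t. \<phi> r (\<psi> s (\<chi> t v))) - (\<lambda>r s t. (e1 * e2) *s \<chi> t (\<phi> r (\<psi> s v)))"
  define X2 where "X2 = (\<lambda>r s t. \<psi> s (\<phi> r (\<chi> t v))) - (\<lambda>r s t. (e1 * e2) *s \<chi> t (\<psi> s (\<phi> r v)))"
  have X1: "?M X1 = 0" unfolding X1_def M_minus M_scale swap[OF \<phi> \<psi> 1 2] by simp
  have X2: "?M X2 = 0"
  proof -
    have "?M (\<lambda>r s t. \<psi> s (\<phi> r (\<chi> t v)))
      = (\<lambda>r s t. ?M (\<lambda>r s t. \<psi> r (\<phi> s (\<chi> t v))) s r t)" for v
      by (subst pow_commute[of mul13 mul23, OF mul13_mul23]) (simp add: mul13_pow mul23_pow)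
    moreover have "?M (\<lambda>r s t. \<chi> t (\<psi> s (\<phi> r v)))
      = (\<lambda>r s t. ?M (\<lambda>r s t. \<chi> t (\<psi> r (\<phi> s v))) s r t)" for v
      by (subst pow_commute[of mul13 mul23, OF mul13_mul23]) (simp add: mul13_pow mul23_pow)
    ultimately show ?thesis
      by (simp only: X2_def M_minus M_scale swap[OF \<psi> \<phi> 2 1] mult.commute[of e2 e1] diff_self)
  qed
  have lb: "lower_bounded (\<lambda>r s. \<alpha> r (\<beta> s (\<chi> t v)))" "lower_bounded (\<lambda>r s. \<chi> t (\<alpha> r (\<beta> s v)))"
    "lower_bounded (\<lambda>r s. c *s \<chi> t (\<alpha> r (\<beta> s v)))"
    if "field_op \<alpha>" "field_op \<beta>" for \<alpha> \<beta> c t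
  proof -
    show "lower_bounded (\<lambda>r s. \<alpha> r (\<beta> s (\<chi> t v)))" by (rule lower_bounded_comp[OF that])
    have "lower_bounded (\<lambda>r s. \<alpha> r (\<beta> s v))" by (rule lower_bounded_comp[OF that])
    then obtain s0 where "vanishes_below s0 (\<lambda>r s. \<alpha> r (\<beta> s v))" by (elim lower_boundedE)
    then show "lower_bounded (\<lambda>r s. \<chi> t (\<alpha> r (\<beta> s v)))"
      "lower_bounded (\<lambda>r s. c *s \<chi> t (\<alpha> r (\<beta> s v)))"
      by (auto intro!: lower_boundedI[of s0] simp: vanishes_below_def field_0[OF \<chi>])
  qed
  have lb1: "lower_bounded (\<lambda>r s. X1 r s t)" for t
    using lower_bounded_minus[OF lb(1)[OF \<phi> \<psi>, of t] lb(3)[OF \<phi> \<psi>, of "e1 * e2" t]]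
    by (simp add: X1_def fun_diff_def)
  have lb2: "lower_bounded (\<lambda>s r. X2 r s t)" for t
    using lower_bounded_minus[OF lb(1)[OF \<psi> \<phi>, of t] lb(3)[OF \<psi> \<phi>, of "e1 * e2" t]]
    by (simp add: X2_def fun_diff_def)
  have "bracket e3 n \<phi> \<psi> (\<chi> t v) r s - (e1 * e2) *s \<chi> t (bracket e3 n \<phi> \<psi> v r s)
      = expand12 n X1 r s t - e3 *s expand21 n X2 r s t" for r s t
  proof -
    have ch: "\<chi> t (expand_wz n (\<lambda>r s. \<alpha> r (\<beta> s v)) r s) = expand_wz n (\<lambda>r s. \<chi> t (\<alpha> r (\<beta> s v))) r s"
      if "field_op \<alpha>" "field_op \<beta>" for \<alpha> \<beta> r s
      using expand_wz_hom[OF lower_bounded_comp[OF that, of "\<lambda>r. r"], of "\<chi> t"]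
        field_add[OF \<chi>] field_scale[OF \<chi>] by simp
    have e12: "expand12 n X1 r s t = expand_wz n (\<lambda>r s. \<phi> r (\<psi> s (\<chi> t v))) r s
        - (e1 * e2) *s \<chi> t (expand_wz n (\<lambda>r s. \<phi> r (\<psi> s v)) r s)"
      using expand_wz_minus[OF lb(1)[OF \<phi> \<psi>, of t] lb(3)[OF \<phi> \<psi>, of "e1 * e2" t], of n]
      unfolding expand12_def X1_def ch[OF \<phi> \<psi>]
      by (simp add: fun_diff_def expand_wz_scale[OF lb(2)[OF \<phi> \<psi>]])
    have e21: "expand21 n X2 r s t = expand_zw n (\<lambda>r s. \<psi> s (\<phi> r (\<chi> t v))) r s
        - (e1 * e2) *s \<chi> t (expand_zw n (\<lambda>r s. \<psi> s (\<phi> r v)) r s)"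
      using expand_wz_minus[OF lb(1)[OF \<psi> \<phi>, of t] lb(3)[OF \<psi> \<phi>, of "e1 * e2" t], of n]
      unfolding expand21_def X2_def expand_zw_def field_scale[OF \<chi>] ch[OF \<psi> \<phi>]
      by (simp add: fun_diff_def expand_wz_scale[OF lb(2)[OF \<psi> \<phi>]] scale_right_diff_distrib
          mult.commute)
    show ?thesis
      unfolding e12 e21 bracket_def field_diff[OF \<chi>] field_scale[OF \<chi>]
      by (simp add: algebra_simps)
  qed
  then have "(\<lambda>r s t. bracket e3 n \<phi> \<psi> (\<chi> t v) r s - (e1 * e2) *s \<chi> t (bracket e3 n \<phi> \<psi> v r s))
      = expand12 n X1 - (\<lambda>r s t. e3 *s expand21 n X2 r s t)"
    by (intro ext) simp
  moreover have "expand12 n 0 = 0" "expand21 n 0 = 0"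
    by (intro ext; simp add: expand12_def expand21_def expand_zw_def expand_wz_def)+
  ultimately show ?thesis
    by (simp only: M_minus M_scale expand12_mul_pow[OF lb1, symmetric]
        expand21_mul_pow[OF lb2, symmetric]
      X1 X2) (intro ext, simp)
qed

text \<open>
  The coefficient of \<open>w^(-1)\<close> in the bracket with exponent \<open>n\<close>: the \<open>n\<close>-th product of fields.
\<close>
definition fprod :: "'k \<Rightarrow> int \<Rightarrow> 'u modes \<Rightarrow> 'u modes \<Rightarrow> 'u modes" where
  "fprod e n \<phi> \<psi> s v = bracket e n \<phi> \<psi> v (-1) s"

text \<open>
  Let \<open>d\<close> be the distribution of the previous lemma. It is annihilated by \<open>(w - u)^p (z - u)^p\<close>
  and, since \<open>\<phi>\<close> and \<open>\<psi>\<close> are local, by a power of \<open>w - z\<close>. Hence it is annihilated by a power of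
  \<open>z - u = (w - u) - (w - z)\<close>, and this persists for its coefficient at \<open>w^(-1)\<close>.
\<close>
lemma dong_lemma:
  assumes \<phi>: "field_op \<phi>" and \<psi>: "field_op \<psi>" and \<chi>: "field_op \<chi>"
    and \<theta>: "field_op (fprod e3 n \<phi> \<psi>)"
    and "is_local e1 \<phi> \<chi>" "is_local e2 \<psi> \<chi>" "is_local e3 \<phi> \<psi>"
  shows "is_local (e1 * e2) (fprod e3 n \<phi> \<psi>) \<chi>"
proof -
  obtain k1 k2 k3 where k: "\<And>v. bracket e1 (int k1) \<phi> \<chi> v = 0" "\<And>v. bracket e2 (int k2) \<psi> \<chi> v = 0"
    "\<And>v. bracket e3 (int k3) \<phi> \<psi> v = 0"
    using assms(5-7) unfolding is_local_def by metis
  define p where "p = max k1 k2"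
  define q where "q = nat (int k3 - n)"
  have p: "bracket e1 (int p) \<phi> \<chi> v = 0" "bracket e2 (int p) \<psi> \<chi> v = 0" for v
    using local_mono[OF \<phi> \<chi> k(1)] local_mono[OF \<psi> \<chi> k(2)] by (simp_all add: p_def)
  have q: "bracket e3 (n + int q) \<phi> \<psi> v = 0" for v
    using local_mono[OF \<phi> \<psi> k(3)] by (simp add: q_def)
  have "bracket (e1 * e2) (int (p + q + p)) (fprod e3 n \<phi> \<psi>) \<chi> v = 0" for v
  proof -
    define d where "d = (\<lambda>r s t. bracket e3 n \<phi> \<psi> (\<chi> t v) r s
        - (e1 * e2) *s \<chi> t (bracket e3 n \<phi> \<psi> v r s))"
    have 1: "(mul13 ^^ p) ((mul23 ^^ p) d) = 0"
      unfolding d_def by (rule bracket_locality[OF \<phi> \<psi> \<chi> p])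
    have "(mul12 ^^ q) d = 0"
    proof -
      have h: "h (x - y) = h x - h y" if "h = (\<lambda>x. (e1 * e2) *s \<chi> t x)" for h t and x y :: 'u
        by (simp add: that field_diff[OF \<chi>] scale_right_diff_distrib)
      have dd: "(\<lambda>r s. d r s t)
          = bracket e3 n \<phi> \<psi> (\<chi> t v) - (\<lambda>r s. (e1 * e2) *s \<chi> t (bracket e3 n \<phi> \<psi> v r s))" for t
        unfolding d_def by (intro ext) simp
      have z: "(mul_diff ^^ q) (bracket e3 n \<phi> \<psi> v) = 0" for v
        using q[of v] bracket_pow[OF \<phi> \<psi>, of e3 n q v] by simp
      show ?thesis
        unfolding mul12_pow dd mul_diff_pow_minus
            mul_diff_pow_hom[of "\<lambda>x. (e1 * e2) *s \<chi> _ x", OF h[OF refl]] z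
        by (intro ext) (simp add: field_0[OF \<chi>])
    qed
    then have "(mul12 ^^ q) ((mul23 ^^ p) d) = 0"
      using pow_commute[of mul23 mul12 p q d, OF mul23_mul12]
          additive_pow(2)[of "mul23 :: 'u distribution3 \<Rightarrow> _", OF mul23_minus]
      by (simp only:)
    then have "((\<lambda>x. mul13 x - mul12 x) ^^ (p + q)) ((mul23 ^^ p) d) = 0"
      using 1 by (intro nilpotent_diff mul12_minus mul13_minus mul13_mul12)
    then have "(mul23 ^^ (p + q + p)) d = 0"
      by (simp add: mul13_minus_mul12 funpow_add)
    then have "(mul_diff ^^ (p + q + p)) (\<lambda>s t. d (-1) s t) = 0"
      unfolding mul23_pow by (auto dest!: fun_cong intro!: ext)
    then show ?thesis
      unfolding bracket_nat[OF \<theta> \<chi>] d_def fprod_def .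
  qed
  then show ?thesis unfolding is_local_def by blast
qed

end

section \<open>Bounding the order of locality of a product\<close>

context char0_space
begin

lemma expand_wz_iota:
  "Sum_any (\<lambda>(i, j). iota_wz M i j *s F (r - i) (s - j)) = expand_wz M F r s"
proof -
  define f where "f = (\<lambda>(i, j). (iota_wz M i j :: 'k) *s F (r - i) (s - j))"
  define g where "g j = ((of_int M gchoose j) * (-1) ^ j) *s F (r - M + int j) (s - int j)"
      for j :: nat
  define l where "l j = (M - int j, int j)" for j :: nat
  have fl: "f (l j) = g j" for j by (simp add: f_def l_def g_def iota_wz_def algebra_simps)
  have "inj l" by (rule injI) (simp add: l_def)
  have "f x = 0" if "x \<notin> range l" for x
  proof -
    have "snd x < 0 \<or> fst x + snd x \<noteq> M"
    proof (rule ccontr)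
      assume *: "\<not> ?thesis"
      then have "x = l (nat (snd x))" by (auto simp: l_def prod_eq_iff)
      then show False using that by blast
    qed
    then show ?thesis by (auto simp: f_def iota_wz_def split_beta)
  qed
  then have "{x. f x \<noteq> 0} = l ` {j. g j \<noteq> 0}" using fl by force
  then have "Sum_any f = sum f (l ` {j. g j \<noteq> 0})" by (simp add: Sum_any.expand_set)
  also have "\<dots> = sum g {j. g j \<noteq> 0}"
    by (subst sum.reindex) (use \<open>inj l\<close> in \<open>auto simp: fl inj_on_def\<close>)
  finally show ?thesis by (simp add: f_def g_def[abs_def] expand_wz_def Sum_any.expand_set)
qed

lemma expand_zw_iota:
  assumes "lower_bounded (\<lambda>r s. F s r)"
  shows "Sum_any (\<lambda>(i, j). iota_zw M i j *s F (r - i) (s - j)) = expand_zw M F r s"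
proof -
  define f where "f = (\<lambda>(i, j). (iota_zw M i j :: 'k) *s F (r - i) (s - j))"
  have "(-1) powi (M - int j) = (-1) powi M * (-1 :: 'k) ^ j" for j
  proof -
    have "(-1) powi (M - int j) = (-1) powi M / (-1 :: 'k) ^ j" by (simp add: power_int_diff)
    then show ?thesis by (cases "even j") auto
  qed
  then have *: "iota_zw M (int j) (M - int j)
      = (-1) powi M * (iota_wz M (M - int j) (int j) :: 'k)" for j
    by (simp add: iota_zw_def iota_wz_def)
  have iota: "iota_zw M i j = (-1) powi M * (iota_wz M j i :: 'k)" for i j
  proof (cases "0 \<le> i \<and> i + j = M")
    case True
    then have "i = int (nat i)" "j = M - int (nat i)" by auto
    then show ?thesis using *[of "nat i"] by (simp only:)
  next
    case False
    then show ?thesis by (auto simp: iota_zw_def iota_wz_def)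
  qed
  define h where "h = (\<lambda>(i, j). (iota_wz M i j :: 'k) *s F (r - j) (s - i))"
  have "Sum_any f = Sum_any (\<lambda>x. (-1) powi M *s h x)"
    by (rule Sum_any.reindex_cong[of "\<lambda>(i, j). (j, i)"])
      (auto simp: f_def h_def iota fun_eq_iff intro!: bijI injI simp: image_def)
  also have "\<dots> = (-1) powi M *s Sum_any h"
  proof -
    have "{x. (-1) powi M *s h x \<noteq> 0} = {x. h x \<noteq> 0}" by (auto simp: scale_eq_0_iff)
    then show ?thesis by (simp add: Sum_any.expand_set scale_sum_right)
  qed
  also have "Sum_any h = expand_wz M (\<lambda>r s. F s r) s r"
    unfolding h_def using expand_wz_iota[of M "\<lambda>r s. F s r" s r] by simp
  finally show ?thesis by (simp add: f_def expand_zw_def)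
qed

lemma bracket_add:
  assumes "field_op \<phi>" "field_op \<psi>"
  shows "bracket e n \<phi> \<psi> (x + y) r s = bracket e n \<phi> \<psi> x r s + bracket e n \<phi> \<psi> y r s"
proof -
  note lb = lower_bounded_comp[OF assms, of "\<lambda>r. r"] lower_bounded_comp[OF assms(2,1), of "\<lambda>r. r"]
  show ?thesis
    unfolding bracket_def expand_zw_def field_add[OF assms(1)] field_add[OF assms(2)]
      expand_wz_plus[OF lb(1) lb(1)] expand_wz_plus[OF lb(2) lb(2)]
    by (simp add: algebra_simps)
qed

lemma mul_diff_pow_inj':
  fixes H :: "'u distribution2"
  assumes "\<And>r s. r < r0 \<Longrightarrow> H r s = 0" and "(mul_diff ^^ k) H = 0"
  shows "H = 0"
proof -
  have "(mul_diff ^^ k) (\<lambda>r s. H s r) = 0"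
    unfolding mul_diff_pow_flip[of k H] assms(2) by (intro ext) simp
  moreover have "lower_bounded (\<lambda>r s. H s r)" by (rule lower_boundedI[of r0]) (rule assms)
  ultimately have *: "(\<lambda>r s. H s r) = 0" by (rule mul_diff_pow_inj[rotated])
  have "H r s = 0" for r s using fun_cong[OF fun_cong[OF *, of s], of r] by simp
  then show ?thesis by (intro ext) simp
qed

end

text \<open>
  If only nonnegative powers of \<open>u\<close> occur in \<open>E\<close>, then the constant term in \<open>u\<close> of
  \<open>(w - u)^p (z - u)^q E\<close> is \<open>w^p z^q\<close> times that of \<open>E\<close>.
\<close>
lemma mul_pow_lowest:
  assumes "\<And>r s t. t < 0 \<Longrightarrow> E r s t = 0"
  shows "(mul13 ^^ p) ((mul23 ^^ q) E) r s 0 = E (r - int p) (s - int q) 0"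
proof -
  have 1: "(\<forall>r s t. t < 0 \<longrightarrow> (mul23 ^^ q) E r s t = 0) \<and>
      (\<forall>r s. (mul23 ^^ q) E r s 0 = E r (s - int q) 0)"
    by (induction q) (simp_all only: funpow.simps o_apply mul23_def, auto simp: assms algebra_simps)
  have "(\<forall>r s t. t < 0 \<longrightarrow> (mul13 ^^ p) X r s t = 0) \<and>
      (\<forall>r s. (mul13 ^^ p) X r s 0 = X (r - int p) s 0)"
    if "\<forall>r s t. t < 0 \<longrightarrow> X r s t = 0" for X :: "int \<Rightarrow> int \<Rightarrow> int \<Rightarrow> 'a"
    by (induction p) (simp_all only: funpow.simps o_apply mul13_def, auto simp: that algebra_simps)
  then show ?thesis using 1 by simp
qed

sublocale vertex_algebra \<subseteq> char0_space scale ..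

context vertex_algebra
begin

notation scale (infixr "*s" 75)

text \<open>
  The products of a vertex algebra are linear only on its carrier. Composing with a projection
  onto the carrier yields vertex operators that are fields on the ambient space.
\<close>
definition proj :: "'v \<Rightarrow> 'v" where
  "proj = (SOME \<pi>. Vector_Spaces.linear scale scale \<pi> \<and> range \<pi> \<subseteq> va_carrier A \<and>
     (\<forall>v \<in> va_carrier A. \<pi> v = v))"

lemma proj: "Vector_Spaces.linear scale scale proj" "proj v \<in> va_carrier A"
  "v \<in> va_carrier A \<Longrightarrow> proj v = v"
proof -
  interpret vector_space_pair scale scale ..
  have "\<exists>\<pi>. range \<pi> \<subseteq> va_carrier A \<and> Vector_Spaces.linear scale scale \<pi> \<and>
      (\<forall>v \<in> va_carrier A. \<pi> (id v) = v)"
    by (rule linear_exists_left_inverse_on)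
        (use linear_id[unfolded id_def] subspace_carrier in \<open>auto simp: id_def\<close>)
  then have "\<exists>\<pi>. Vector_Spaces.linear scale scale \<pi> \<and> range \<pi> \<subseteq> va_carrier A \<and>
      (\<forall>v \<in> va_carrier A. \<pi> v = v)"
    by auto
  from someI_ex[OF this, folded proj_def]
  show "Vector_Spaces.linear scale scale proj" "proj v \<in> va_carrier A"
    "v \<in> va_carrier A \<Longrightarrow> proj v = v" by auto
qed

lemma proj_add: "proj (x + y) = proj x + proj y" and proj_scale: "proj (c *s x) = c *s proj x"
  using Vector_Spaces.linear.axioms(3)[OF proj(1)] by (auto dest: module_hom.add module_hom.scale)

definition vop :: "'v \<Rightarrow> int \<Rightarrow> 'v \<Rightarrow> 'v" where
  "vop a r v = nprod A (- r - 1) a (proj v)"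

lemma vop_carrier: "v \<in> va_carrier A \<Longrightarrow> vop a r v = nprod A (- r - 1) a v"
  by (simp add: vop_def proj)

lemma vop_closed: "a \<in> va_carrier A \<Longrightarrow> vop a r v \<in> va_carrier A"
  by (simp add: vop_def nprod_closed proj)

lemma field_op_vop:
  assumes "a \<in> va_carrier A" shows "field_op (vop a)"
proof (rule field_opI)
  show "\<exists>r0. \<forall>r<r0. vop a r v = 0" for v
  proof -
    obtain n0 where "\<forall>n\<ge>n0. nprod A n a (proj v) = 0" using truncation[OF assms proj(2)] by blast
    then show ?thesis by (intro exI[of _ "- n0"]) (simp add: vop_def)
  qed
qed (use assms in \<open>simp_all add: vop_def proj_add proj_scale nprod_add_right nprod_scale_right
    proj(2)\<close>)

lemma local_at_iff_bracket:
  assumes a: "a \<in> va_carrier A" and b: "b \<in> va_carrier A"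
  shows "local_at scale A p q a b M \<longleftrightarrow> (\<forall>v. bracket (koszul_sign p q) M (vop a) (vop b) v = 0)"
proof -
  note fa = field_op_vop[OF a] and fb = field_op_vop[OF b]
  have 1: "Sum_any (\<lambda>(i, j). iota_wz M i j *s Y_coeff A a (r - i) (Y_coeff A b (s - j) c))
      = expand_wz M (\<lambda>r s. vop a r (vop b s c)) r s"
    and 2: "Sum_any (\<lambda>(i, j). iota_zw M i j *s Y_coeff A b (s - j) (Y_coeff A a (r - i) c))
      = expand_zw M (\<lambda>r s. vop b s (vop a r c)) r s" if "c \<in> va_carrier A" for c r s
    using expand_wz_iota[of M "\<lambda>r s. vop a r (vop b s c)" r s]
      expand_zw_iota[of "\<lambda>r s. vop b s (vop a r c)" M r s, OF lower_bounded_comp[OF fb fa]] that a b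
    by (simp_all add: Y_coeff_def vop_carrier nprod_closed)
  have "vop a r (proj v) = vop a r v" for a r v by (simp add: vop_def proj)
  then have 3: "bracket e M (vop a) (vop b) v = bracket e M (vop a) (vop b) (proj v)" for e v
    by (intro ext) (simp add: bracket_def)
  have "local_at scale A p q a b M \<longleftrightarrow>
      (\<forall>c\<in>va_carrier A. bracket (koszul_sign p q) M (vop a) (vop b) c = 0)"
    unfolding local_at_def by (simp add: 1 2 bracket_def fun_eq_iff)
  also have "\<dots> \<longleftrightarrow> (\<forall>v. bracket (koszul_sign p q) M (vop a) (vop b) v = 0)"
    using 3 proj(2) by metis
  finally show ?thesis .
qed

lemma vop_vac_neg: "a \<in> va_carrier A \<Longrightarrow> r < 0 \<Longrightarrow> vop a r (vac A) = 0"
  by (simp add: vop_carrier vac_closed vac_right_nonneg)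

lemma vop_vac_0: "a \<in> va_carrier A \<Longrightarrow> vop a 0 (vac A) = a"
  by (simp add: vop_carrier vac_closed vac_right_neg va_Ddiv_def)

lemma D_vop:
  assumes "a \<in> va_carrier A" "x \<in> va_carrier A"
  shows "va_D A (vop a r x) = vop a r (va_D A x) + of_int (r + 1) *s vop a (r + 1) x"
  using D_right[OF assms, of "- r - 1"] assms
  by (simp add: vop_carrier D_closed algebra_simps scale_left_diff_distrib scale_minus_left)

lemma D_vac: "va_D A (vac A) = 0"
  by (simp add: va_D_def vac_left vac_closed)

text \<open>
  Formally \<open>Y(a)(w) Y(b)(z) \<one> = exp(z D) Y(a)(w - z) b\<close>, and \<open>(w - z)^N Y(a)(w - z) b\<close> has no
  negative powers if \<open>a\<^sub>m b = 0\<close> for \<open>m \<ge> N\<close>. In place of the exponential, the proof uses that \<open>D\<close>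
  acts as the sum of the derivatives by \<open>w\<close> and \<open>z\<close>, which determines the coefficients recursively
  from those at \<open>z^0\<close>.
\<close>
lemma product_vac_regular:
  assumes a: "a \<in> va_carrier A" and b: "b \<in> va_carrier A" and N: "\<And>m. N \<le> m \<Longrightarrow> nprod A m a b = 0"
    and "r < 0"
  shows "expand_wz N (\<lambda>r s. vop a r (vop b s (vac A))) r s = 0"
proof -
  define F where "F = (\<lambda>r s. vop a r (vop b s (vac A)))"
  define h where "h = (\<lambda>x. va_D A (proj x))"
  have h: "h (x + y) = h x + h y" "h (c *s x) = c *s h x" for c x y
    by (simp_all add: h_def va_D_def proj_add proj_scale nprod_add_left nprod_scale_left proj(2)
        vac_closed)
  have F0: "vanishes_below 0 F"
    using a b by (simp add: vanishes_below_def F_def vop_vac_neg field_0[OF field_op_vop])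
  then have lb: "lower_bounded F" unfolding lower_bounded_def by blast
  have lb1: "lower_bounded (\<lambda>r s. of_int (r + 1) *s F (r + 1) s)"
    using F0 by (intro lower_boundedI[of 0]) (simp add: vanishes_below_def)
  have lb2: "lower_bounded (\<lambda>r s. of_int (s + 1) *s F r (s + 1))"
    using F0 by (intro lower_boundedI[of "-1"]) (simp add: vanishes_below_def)
  let ?G = "expand_wz N F"
  have DF: "h (F r s) = of_int (r + 1) *s F (r + 1) s + of_int (s + 1) *s F r (s + 1)" for r s
    using D_vop[OF a vop_closed[OF b, of s "vac A"], of r] D_vop[OF b vac_closed, of s] a b
    by (simp add: h_def F_def proj vop_closed D_vac field_0[OF field_op_vop]
        field_add[OF field_op_vop] field_scale[OF field_op_vop]
      algebra_simps)
  have DG: "of_int (s + 1) *s ?G r (s + 1) = h (?G r s) - of_int (r + 1) *s ?G (r + 1) s" for r s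
  proof -
    have "h (?G r s) = expand_wz N (\<lambda>r s. h (F r s)) r s" using expand_wz_hom[OF lb h, of N] by simp
    also have "\<dots> = expand_wz N (\<lambda>r s. of_int (r + 1) *s F (r + 1) s) r s
        + expand_wz N (\<lambda>r s. of_int (s + 1) *s F r (s + 1)) r s"
      using expand_wz_add[OF lb1 lb2, of N] by (simp add: DF plus_fun_def)
    finally show ?thesis
      using expand_wz_deriv_w[OF lb, of r N s] expand_wz_deriv_z[OF lb, of s N r] by simp
  qed
  have "?G r (int k) = 0" if "r < 0" for r k
    using that
  proof (induction k arbitrary: r)
    case 0
    have "?G r 0 = F (r - N) 0" by (rule expand_wz_lowest[OF F0])
    then show ?case using 0 b N by (simp add: F_def vop_vac_0 vop_carrier)
  next
    case (Suc k)
    have "r + 1 = 0 \<or> ?G (r + 1) (int k) = 0"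
    proof (cases "r + 1 = 0")
      case False
      then have "r + 1 < 0" using Suc.prems by simp
      then show ?thesis using Suc.IH by blast
    qed simp
    moreover have "h (?G r (int k)) = 0" using Suc h(2)[of 0 0] by simp
    ultimately have "of_int (int k + 1) *s ?G r (int k + 1) = 0"
      using DG[of "int k" r] by (metis diff_zero of_int_0 scale_zero_left scale_zero_right)
    moreover have "of_int (int k + 1) \<noteq> (0 :: 'k)"
        by (metis of_int_of_nat_eq of_nat_0_neq of_nat_Suc add.commute)
    ultimately show ?case by (simp add: scale_eq_0_iff add.commute)
  qed
  moreover have "?G r s = 0" if "s < 0"
    using vanishes_belowD[OF vanishes_below_expand_wz[OF F0] that] .
  ultimately show ?thesis
    using \<open>r < 0\<close> unfolding F_def[symmetric] by (metis int_nat_eq not_less nat_0_le)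
qed

text \<open>
  On the vacuum the bracket with exponent \<open>N\<close> contains no negative powers of \<open>w\<close>, and it is
  annihilated by a power of \<open>w - z\<close>, so it is zero. On another vector \<open>x\<close>, the constant term of
  \<open>Y(x)(u) \<one>\<close>, it is zero because \<open>Y(x)(u)\<close> can be moved past the bracket at the cost of powers of
  \<open>w - u\<close> and \<open>z - u\<close>, which become powers of \<open>w\<close> and \<open>z\<close> at \<open>u = 0\<close>.
\<close>
lemma bracket_of_order:
  assumes a: "a \<in> part A p" and b: "b \<in> part A q" and N: "\<And>m. N \<le> m \<Longrightarrow> nprod A m a b = 0"
  shows "bracket (koszul_sign p q) N (vop a) (vop b) v = 0"
proof -
  note ac = in_carrier[OF a] and bc = in_carrier[OF b]
  note fa = field_op_vop[OF ac] and fb = field_op_vop[OF bc]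
  let ?b = "bracket (koszul_sign p q) N (vop a) (vop b)"
  have loc: "\<exists>k. \<forall>v. bracket (koszul_sign p q) (int k) (vop x) (vop y) v = 0"
    if x: "x \<in> part A p" and y: "y \<in> part A q" for x y p q
  proof -
    obtain M where "\<And>v. bracket (koszul_sign p q) M (vop x) (vop y) v = 0"
      using locality[OF x y] local_at_iff_bracket[OF in_carrier[OF x] in_carrier[OF y]] by blast
    then have "bracket (koszul_sign p q) (int (nat M)) (vop x) (vop y) v = 0" for v
      by (rule local_mono[OF field_op_vop[OF in_carrier[OF x]]
          field_op_vop[OF in_carrier[OF y]]]) simp
    then show ?thesis by blast
  qed
  have vac: "?b (vac A) = 0"
  proof -
    \<comment> \<open>Both summands of the bracket contain only nonnegative powers of \<open>w\<close>.\<close>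
    have "?b (vac A) r s = 0" if "r < 0" for r s
    proof -
      have "vanishes_below 0 (\<lambda>s r. vop b s (vop a r (vac A)))"
        using ac bc by (simp add: vanishes_below_def vop_vac_neg field_0[OF fb])
      from vanishes_belowD[OF vanishes_below_expand_wz[OF this] that]
      show ?thesis
        using product_vac_regular[OF ac bc N that] by (simp add: bracket_def expand_zw_def)
    qed
    moreover obtain k where k: "bracket (koszul_sign p q) (int k) (vop a) (vop b) v = 0" for v
      using loc[OF a b] by blast
    have "bracket (koszul_sign p q) (N + int (nat (int k - N))) (vop a) (vop b) (vac A) = 0"
      by (rule local_mono[OF fa fb k]) simp
    then have "(mul_diff ^^ nat (int k - N)) (?b (vac A)) = 0"
      unfolding bracket_pow[OF fa fb] .
    ultimately show ?thesis by (rule mul_diff_pow_inj'[of 0 "?b (vac A)"])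
  qed
  have hom: "?b x = 0" if x: "x \<in> part A u" for x u
  proof -
    note xc = in_carrier[OF x]
    obtain k1 k2 where k1: "\<And>v. bracket (koszul_sign p u) (int k1) (vop a) (vop x) v = 0"
      and k2: "\<And>v. bracket (koszul_sign q u) (int k2) (vop b) (vop x) v = 0"
      using loc[OF a x] loc[OF b x] by blast
    define k where "k = max k1 k2"
    have k: "bracket (koszul_sign p u) (int k) (vop a) (vop x) v = 0"
      "bracket (koszul_sign q u) (int k) (vop b) (vop x) v = 0" for v
      using local_mono[OF fa field_op_vop[OF xc] k1] local_mono[OF fb field_op_vop[OF xc] k2]
      by (simp_all add: k_def)
    define E where "E r s t = ?b (vop x t (vac A)) r s" for r s t
    have z: "?b 0 r s = 0" for r s
      using bracket_add[OF fa fb, of "koszul_sign p q" N 0 0 r s] by simp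
    have "(mul13 ^^ k) ((mul23 ^^ k) E) = 0"
      using bracket_locality[OF fa fb field_op_vop[OF xc] k, where v = "vac A" and n = N
          and ?e3.0 = "koszul_sign p q"]
      by (simp add: vac E_def[abs_def] field_0[OF field_op_vop[OF xc]])
    moreover have "E r s t = 0" if "t < 0" for r s t
      using that xc by (simp add: E_def vop_vac_neg z)
    ultimately have "E (r - int k) (s - int k) 0 = 0" for r s
      using mul_pow_lowest[of E k k r s] by simp
    then have "E (r + int k - int k) (s + int k - int k) 0 = 0" for r s by blast
    then have "E r s 0 = 0" for r s by simp
    then show ?thesis using xc by (intro ext) (simp add: E_def vop_vac_0)
  qed
  have c: "?b x = 0" if "x \<in> va_carrier A" for x
  proof -
    obtain y z where "x = y + z" "y \<in> part A 0" "z \<in> part A 1"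
      using \<open>x \<in> va_carrier A\<close> unfolding va_carrier_def by blast
    then show ?thesis using hom by (intro ext) (simp add: bracket_add[OF fa fb])
  qed
  have "vop a r (proj v) = vop a r v" for a r v by (simp add: vop_def proj)
  then have "?b v = ?b (proj v)" by (intro ext) (simp add: bracket_def)
  then show ?thesis using c proj(2) by simp
qed

text \<open>
  \<open>G r j\<close> is the coefficient of \<open>w^r z^(j - Nba)\<close> in \<open>(w - z)^Ncb Y(c)(w) Y(b)(z) a\<close>. By locality
  this equals, up to sign, \<open>(w - z)^Ncb Y(b)(z) Y(c)(w) a\<close>, expanded in nonnegative powers of \<open>w\<close>;
  therefore it has no powers of \<open>w\<close> below \<open>-Nca\<close>.
\<close>
lemma triple_product_expansion:
  assumes a: "a \<in> va_carrier A" and b: "b \<in> part A q" and c: "c \<in> part A p"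
    and cb: "\<And>m. Ncb \<le> m \<Longrightarrow> nprod A m c b = 0"
    and ca: "\<And>m. Nca \<le> m \<Longrightarrow> nprod A m c a = 0"
    and ba: "\<And>m. Nba \<le> m \<Longrightarrow> nprod A m b a = 0"
  obtains G where
    "\<And>m k. nprod A m c (nprod A (Nba - int k - 1) b a) =
      (\<Sum>j\<le>k. ((of_int (- Ncb) gchoose j) * (-1) ^ j) *s G (Ncb + int j - m - 1) (k - j))"
    "\<And>r j. r < - Nca \<Longrightarrow> G r j = 0"
proof -
  note bc = in_carrier[OF b] and cc = in_carrier[OF c]
  define F where "F = (\<lambda>r s. vop c r (vop b s a))"
  define F' where "F' = (\<lambda>r s. vop b s (vop c r a))"
  define H where "H = expand_wz Ncb F"
  have F: "vanishes_below (- Nba) F"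
    using a bc cc ba by (simp add: vanishes_below_def F_def vop_carrier field_0[OF field_op_vop])
  then have lb: "lower_bounded F" unfolding lower_bounded_def by blast
  have F': "vanishes_below (- Nca) (\<lambda>s r. F' r s)"
    using a bc cc ca by (simp add: vanishes_below_def F'_def vop_carrier field_0[OF field_op_vop])
  have "bracket (koszul_sign p q) Ncb (vop c) (vop b) a = 0" using bracket_of_order[OF c b cb] .
  then have H: "H r s = koszul_sign p q *s expand_zw Ncb F' r s" for r s
    by (simp add: H_def F_def F'_def bracket_def fun_eq_iff)
  have H0: "H r s = 0" if "r < - Nca" for r s
    unfolding H expand_zw_def
    using vanishes_belowD[OF vanishes_below_expand_wz[OF F'] that] by simp
  have Hb: "vanishes_below (- Nba) H" unfolding H_def by (rule vanishes_below_expand_wz[OF F])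
  have "F r s = expand_wz (- Ncb) H r s" for r s
    unfolding H_def expand_wz_expand_wz[OF lb] by (simp add: expand_wz_0)
  moreover have "expand_wz (- Ncb) H r (- Nba + int k)
    = (\<Sum>j<Suc k. ((of_int (- Ncb) gchoose j) * (-1) ^ j) *s H (r + Ncb + int j)
        (- Nba + int k - int j))" for r k
    using expand_wz_eq_sum[OF Hb, of "- Nba + int k" "Suc k" "- Ncb" r] by simp
  moreover have "nprod A m c (nprod A (Nba - int k - 1) b a) = F (- m - 1) (- Nba + int k)" for m k
    using a bc cc by (simp add: F_def vop_carrier nprod_closed)
  ultimately have "nprod A m c (nprod A (Nba - int k - 1) b a)
      = (\<Sum>j<Suc k. ((of_int (- Ncb) gchoose j) * (-1) ^ j)
      *s H (- m - 1 + Ncb + int j) (- Nba + int k - int j))" for m k by simp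
  also have "\<dots> m k = (\<Sum>j\<le>k. ((of_int (- Ncb) gchoose j) * (-1) ^ j) *s
      H (Ncb + int j - m - 1) (- Nba + int (k - j)))" for m k
    unfolding lessThan_Suc_atMost by (rule sum.cong) (auto simp: of_nat_diff algebra_simps)
  finally show thesis using H0 by (intro that[of "\<lambda>r j. H r (- Nba + int j)"]) auto
qed

theorem order_upper_bound:
  assumes a: "a \<in> va_carrier A" and b: "b \<in> part A q" and c: "c \<in> part A p"
    and cb: "\<And>m. Ncb \<le> m \<Longrightarrow> nprod A m c b = 0"
    and ca: "\<And>m. Nca \<le> m \<Longrightarrow> nprod A m c a = 0"
    and ba: "\<And>m. Nba \<le> m \<Longrightarrow> nprod A m b a = 0"
  shows "Nca + Ncb + int k \<le> m \<Longrightarrow> nprod A m c (nprod A (Nba - int k - 1) b a) = 0"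
    and "Ncb \<le> 0 \<Longrightarrow> Nca \<le> m \<Longrightarrow> nprod A m c (nprod A (Nba - int k - 1) b a) = 0"
proof -
  obtain G where G: "\<And>m k. nprod A m c (nprod A (Nba - int k - 1) b a) =
      (\<Sum>j\<le>k. ((of_int (- Ncb) gchoose j) * (-1) ^ j) *s G (Ncb + int j - m - 1) (k - j))"
    and G0: "\<And>r j. r < - Nca \<Longrightarrow> G r j = 0"
    using triple_product_expansion[OF assms] by blast
  show "nprod A m c (nprod A (Nba - int k - 1) b a) = 0" if "Nca + Ncb + int k \<le> m"
    unfolding G using that by (intro sum.neutral) (auto intro!: G0)
  show "nprod A m c (nprod A (Nba - int k - 1) b a) = 0" if "Ncb \<le> 0" "Nca \<le> m"
    unfolding G
  proof (intro sum.neutral ballI)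
    fix j
    have "(of_int (- Ncb) gchoose j :: 'k) = 0" if "- Ncb < int j"
    proof -
      have "of_int (- Ncb) = (of_nat (nat (- Ncb)) :: 'k)" using \<open>Ncb \<le> 0\<close> by simp
      moreover have "nat (- Ncb) < j" using that \<open>Ncb \<le> 0\<close> by linarith
      ultimately show ?thesis by (simp add: binomial_gbinomial[symmetric] binomial_eq_0)
    qed
    then show "((of_int (- Ncb) gchoose j) * (-1) ^ j) *s G (Ncb + int j - m - 1) (k - j) = 0"
      using that by (cases "- Ncb < int j") (auto intro!: G0)
  qed
qed

end

section \<open>Products of fields\<close>

context char0_space
begin

definition coef :: "int \<Rightarrow> nat \<Rightarrow> 'k" where
  "coef n j = (of_int n gchoose j) * (-1) ^ j"

lemma expand_wz_eq_sum':
  assumes "\<And>j. m \<le> j \<Longrightarrow> F (r - n + int j) (s - int j) = 0"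
  shows "expand_wz n F r s = (\<Sum>j<m. coef n j *s F (r - n + int j) (s - int j))"
  unfolding expand_wz_def coef_def
proof (rule Sum_any.expand_superset)
  show "{j. ((of_int n gchoose j) * (-1) ^ j) *s F (r - n + int j) (s - int j) \<noteq> 0} \<subseteq> {..<m}"
    using assms by (auto simp: not_less[symmetric])
qed simp

lemma expand_wz_zero:
  "expand_wz n (\<lambda>r s. 0) r s = 0"
  by (simp add: expand_wz_def)

text \<open>
  The two halves of the product of fields, in which \<open>\<phi>\<close> multiplies \<open>\<chi>\<close> from the left and from the
  right.
\<close>
definition lmult :: "'u modes \<Rightarrow> int \<Rightarrow> 'u modes \<Rightarrow> 'u modes" where
  "lmult \<phi> m \<chi> t v = expand_wz m (\<lambda>r t. \<phi> r (\<chi> t v)) (-1) t"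

definition rmult :: "'u modes \<Rightarrow> int \<Rightarrow> 'u modes \<Rightarrow> 'u modes" where
  "rmult \<phi> m \<chi> t v = expand_zw m (\<lambda>r t. \<chi> t (\<phi> r v)) (-1) t"

lemma fprod_eq: "fprod e m \<phi> \<chi> t v = lmult \<phi> m \<chi> t v - e *s rmult \<phi> m \<chi> t v"
  by (simp add: fprod_def bracket_def lmult_def rmult_def)

lemma lmult_eq_sum:
  assumes "field_op \<phi>" and "\<And>i. K \<le> i \<Longrightarrow> \<chi> (t - int i) v = 0"
  shows "lmult \<phi> m \<chi> t v = (\<Sum>i<K. coef m i *s \<phi> (int i - m - 1) (\<chi> (t - int i) v))"
  unfolding lmult_def
  by (subst expand_wz_eq_sum'[where m = K]) (use assms in \<open>simp_all add: field_0 algebra_simps\<close>)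

lemma rmult_eq_sum:
  assumes "field_op \<chi>" and "\<And>i. K \<le> i \<Longrightarrow> \<phi> (- 1 - int i) v = 0"
  shows "rmult \<phi> m \<chi> t v = (-1) powi m *s (\<Sum>i<K. coef m i *s \<chi> (t - m + int i) (\<phi> (- 1 - int i) v))"
  unfolding rmult_def expand_zw_def
  by (subst expand_wz_eq_sum'[where m = K]) (use assms in \<open>simp_all add: field_0 algebra_simps\<close>)

lemma field_op_truncE:
  assumes "field_op \<phi>" obtains K :: nat where "\<And>i. int K \<le> i \<Longrightarrow> \<phi> (t - i) v = 0"
proof -
  obtain r0 where r0: "\<And>r. r < r0 \<Longrightarrow> \<phi> r v = 0" using field_truncE[OF assms] by blast
  have "\<phi> (t - i) v = 0" if "int (nat (t - r0 + 1)) \<le> i" for i using that by (intro r0) linarith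
  then show thesis by (rule that)
qed

lemma field_lmult:
  assumes "field_op \<phi>" "field_op \<chi>" shows "field_op (lmult \<phi> m \<chi>)"
proof (rule field_opI)
  note f = field_add[OF assms(1)] field_add[OF assms(2)] field_scale[OF assms(1)]
      field_scale[OF assms(2)]
  note lb = lower_bounded_comp[OF assms, of "\<lambda>r. r"]
  fix t x y c
  show "lmult \<phi> m \<chi> t (x + y) = lmult \<phi> m \<chi> t x + lmult \<phi> m \<chi> t y"
    unfolding lmult_def f by (rule expand_wz_plus[OF lb lb])
  show "lmult \<phi> m \<chi> t (c *s x) = c *s lmult \<phi> m \<chi> t x"
    unfolding lmult_def f by (simp only: expand_wz_scale[OF lb])
next
  fix v
  obtain t0 where "vanishes_below t0 (\<lambda>r t. \<phi> r (\<chi> t v))"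
    using lower_bounded_comp[OF assms, of "\<lambda>r. r" v] by (elim lower_boundedE)
  from vanishes_below_expand_wz[OF this, of m]
  show "\<exists>r0. \<forall>r<r0. lmult \<phi> m \<chi> r v = 0"
    by (intro exI[of _ t0]) (simp add: lmult_def vanishes_below_def)
qed

lemma field_rmult:
  assumes "field_op \<phi>" "field_op \<chi>" shows "field_op (rmult \<phi> m \<chi>)"
proof (rule field_opI)
  note f = field_add[OF assms(1)] field_add[OF assms(2)] field_scale[OF assms(1)]
      field_scale[OF assms(2)]
  note lb = lower_bounded_comp[OF assms(2,1), of "\<lambda>r. r"]
  fix t x y c
  show "rmult \<phi> m \<chi> t (x + y) = rmult \<phi> m \<chi> t x + rmult \<phi> m \<chi> t y"
    unfolding rmult_def expand_zw_def f expand_wz_plus[OF lb lb] by (rule scale_right_distrib)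
  show "rmult \<phi> m \<chi> t (c *s x) = c *s rmult \<phi> m \<chi> t x"
    unfolding rmult_def expand_zw_def f
        by (simp only: expand_wz_scale[OF lb] scale_scale mult.commute)
next
  fix v
  obtain K :: nat where K: "\<And>i. int K \<le> i \<Longrightarrow> \<phi> (- 1 - i) v = 0"
    using field_op_truncE[OF assms(1)] by blast
  have "\<exists>t0. \<forall>i<K. \<forall>t<t0. \<chi> t (\<phi> (- 1 - int i) v) = 0"
  proof (induction K)
    case (Suc K)
    then obtain a b where "\<forall>i<K. \<forall>t<a. \<chi> t (\<phi> (- 1 - int i) v) = 0"
        "\<And>t. t < b \<Longrightarrow> \<chi> t (\<phi> (- 1 - int K) v) = 0"
      using field_truncE[OF assms(2)] by metis
    then show ?case by (intro exI[of _ "min a b"]) (auto simp: less_Suc_eq)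
  qed simp
  then obtain t0 where t0: "\<And>i t. i < K \<Longrightarrow> t < t0 \<Longrightarrow> \<chi> t (\<phi> (- 1 - int i) v) = 0" by blast
  have "rmult \<phi> m \<chi> t v = 0" if "t < t0 + m - int K" for t
  proof -
    have "(\<Sum>i<K. coef m i *s \<chi> (t - m + int i) (\<phi> (- 1 - int i) v)) = 0"
      using that by (intro sum.neutral) (auto intro!: t0)
    then show ?thesis using rmult_eq_sum[OF assms(2), of K \<phi> v m t] K by simp
  qed
  then show "\<exists>r0. \<forall>r<r0. rmult \<phi> m \<chi> r v = 0" by blast
qed

lemma field_op_add: "field_op \<phi> \<Longrightarrow> field_op \<psi> \<Longrightarrow> field_op (\<phi> + \<psi>)"
proof (rule field_opI)
  fix v assume f: "field_op \<phi>" "field_op \<psi>"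
  obtain a b where "\<And>r. r < a \<Longrightarrow> \<phi> r v = 0" "\<And>r. r < b \<Longrightarrow> \<psi> r v = 0"
    using field_truncE[OF f(1)] field_truncE[OF f(2)] by metis
  then show "\<exists>r0. \<forall>r<r0. (\<phi> + \<psi>) r v = 0" by (intro exI[of _ "min a b"]) simp
qed (simp_all add: field_add field_scale scale_right_distrib)

lemma field_op_scale: "field_op \<phi> \<Longrightarrow> field_op (\<lambda>r v. c *s \<phi> r v)"
proof (rule field_opI)
  fix v assume f: "field_op \<phi>"
  obtain a where "\<And>r. r < a \<Longrightarrow> \<phi> r v = 0" using field_truncE[OF f] by metis
  then show "\<exists>r0. \<forall>r<r0. c *s \<phi> r v = 0" by (intro exI[of _ a]) simp
qed (simp_all add: field_add field_scale scale_right_distrib mult.commute)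

lemma field_op_0: "field_op 0"
  by (rule field_opI) simp_all

lemma field_fprod: "field_op \<phi> \<Longrightarrow> field_op \<chi> \<Longrightarrow> field_op (fprod e m \<phi> \<chi>)"
proof -
  assume f: "field_op \<phi>" "field_op \<chi>"
  have "fprod e m \<phi> \<chi> = lmult \<phi> m \<chi> + (\<lambda>t v. (- e) *s rmult \<phi> m \<chi> t v)"
    by (intro ext) (simp add: fprod_eq)
  then show ?thesis
    using field_op_add[OF field_lmult[OF f] field_op_scale[OF field_rmult[OF f]]] by (simp only:)
qed

lemma lmult_add_right:
  assumes "field_op \<phi>" "field_op \<chi>" "field_op \<chi>'"
  shows "lmult \<phi> m (\<chi> + \<chi>') t v = lmult \<phi> m \<chi> t v + lmult \<phi> m \<chi>' t v"
  unfolding lmult_def plus_fun_apply field_add[OF assms(1)]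
  by (intro expand_wz_plus lower_bounded_comp assms)

lemma lmult_add_left:
  assumes "field_op \<chi>" "field_op \<phi>" "field_op \<phi>'"
  shows "lmult (\<phi> + \<phi>') m \<chi> t v = lmult \<phi> m \<chi> t v + lmult \<phi>' m \<chi> t v"
  unfolding lmult_def plus_fun_apply by (intro expand_wz_plus lower_bounded_comp assms)

lemma rmult_add_right:
  assumes "field_op \<phi>" "field_op \<chi>" "field_op \<chi>'"
  shows "rmult \<phi> m (\<chi> + \<chi>') t v = rmult \<phi> m \<chi> t v + rmult \<phi> m \<chi>' t v"
  unfolding rmult_def expand_zw_def plus_fun_apply scale_right_distrib[symmetric]
  by (intro arg_cong[where f = "scale _"] expand_wz_plus lower_bounded_comp assms)

lemma rmult_add_left:
  assumes "field_op \<chi>" "field_op \<phi>" "field_op \<phi>'"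
  shows "rmult (\<phi> + \<phi>') m \<chi> t v = rmult \<phi> m \<chi> t v + rmult \<phi>' m \<chi> t v"
  unfolding rmult_def expand_zw_def plus_fun_apply field_add[OF assms(1)]
      scale_right_distrib[symmetric]
  by (intro arg_cong[where f = "scale _"] expand_wz_plus lower_bounded_comp assms)

lemma mult_scale:
  assumes "field_op \<phi>" "field_op \<chi>"
  shows "lmult \<phi> m (\<lambda>t v. c *s \<chi> t v) t v = c *s lmult \<phi> m \<chi> t v"
    and "lmult (\<lambda>t v. c *s \<phi> t v) m \<chi> t v = c *s lmult \<phi> m \<chi> t v"
    and "rmult \<phi> m (\<lambda>t v. c *s \<chi> t v) t v = c *s rmult \<phi> m \<chi> t v"
    and "rmult (\<lambda>t v. c *s \<phi> t v) m \<chi> t v = c *s rmult \<phi> m \<chi> t v"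
  unfolding lmult_def rmult_def expand_zw_def field_scale[OF assms(1)] field_scale[OF assms(2)]
  by (simp_all only: expand_wz_scale[OF lower_bounded_comp[OF assms]]
      expand_wz_scale[OF lower_bounded_comp[OF assms(2,1)]] scale_scale mult.commute)

lemma fprod_add_right:
  assumes "field_op \<phi>" "field_op \<chi>" "field_op \<chi>'"
  shows "fprod e m \<phi> (\<chi> + \<chi>') = fprod e m \<phi> \<chi> + fprod e m \<phi> \<chi>'"
  by (intro ext) (simp add: fprod_eq lmult_add_right[OF assms] rmult_add_right[OF assms]
      algebra_simps)

lemma fprod_add_left:
  assumes "field_op \<chi>" "field_op \<phi>" "field_op \<phi>'"
  shows "fprod e m (\<phi> + \<phi>') \<chi> = fprod e m \<phi> \<chi> + fprod e m \<phi>' \<chi>"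
  by (intro ext) (simp add: fprod_eq lmult_add_left[OF assms] rmult_add_left[OF assms]
      algebra_simps)

lemma fprod_scale_right:
  assumes "field_op \<phi>" "field_op \<chi>"
  shows "fprod e m \<phi> (\<lambda>t v. c *s \<chi> t v) = (\<lambda>t v. c *s fprod e m \<phi> \<chi> t v)"
  by (intro ext) (simp add: fprod_eq mult_scale[OF assms] scale_right_diff_distrib mult.commute)

lemma fprod_scale_left:
  assumes "field_op \<phi>" "field_op \<chi>"
  shows "fprod e m (\<lambda>t v. c *s \<phi> t v) \<chi> = (\<lambda>t v. c *s fprod e m \<phi> \<chi> t v)"
  by (intro ext) (simp add: fprod_eq mult_scale[OF assms] scale_right_diff_distrib mult.commute)

lemma fprod_0_left: "field_op \<chi> \<Longrightarrow> fprod e m 0 \<chi> = 0"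
  using fprod_scale_left[OF field_op_0, of \<chi> e m 0] by (simp add: zero_fun_def)

lemma fprod_0_right: "field_op \<phi> \<Longrightarrow> fprod e m \<phi> 0 = 0"
  using fprod_scale_right[OF _ field_op_0, of \<phi> e m 0] by (simp add: zero_fun_def)

text \<open>
  The two operators act on different sides of \<open>\<chi>\<close>. The sums over the expansions can be
  interchanged since, on a given vector, only finitely many terms are nonzero.
\<close>
lemma lmult_rmult_commute:
  assumes \<phi>: "field_op \<phi>" and \<psi>: "field_op \<psi>" and \<chi>: "field_op \<chi>"
  shows "lmult \<phi> m (rmult \<psi> n \<chi>) t v = rmult \<psi> n (lmult \<phi> m \<chi>) t v"
proof -
  obtain J :: nat where J: "\<And>j. int J \<le> j \<Longrightarrow> \<psi> (- 1 - j) v = 0"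
    using field_op_truncE[OF \<psi>] by blast
  have "\<exists>I. \<forall>j<J. \<forall>i\<ge>I. \<chi> (t - n + int j - int i) (\<psi> (- 1 - int j) v) = 0"
  proof (induction J)
    case (Suc J)
    then obtain I where I: "\<forall>j<J. \<forall>i\<ge>I. \<chi> (t - n + int j - int i) (\<psi> (- 1 - int j) v) = 0" by blast
    obtain I' :: nat where I': "\<And>i. int I' \<le> i \<Longrightarrow> \<chi> (t - n + int J - i) (\<psi> (- 1 - int J) v) = 0"
      using field_op_truncE[OF \<chi>] by blast
    show ?case using I I' by (intro exI[of _ "max I I'"]) (auto simp: less_Suc_eq)
  qed simp
  then obtain I where I: "\<And>i j. j < J \<Longrightarrow> I \<le> i \<Longrightarrow> \<chi> (t - n + int j - int i) (\<psi> (- 1 - int j) v) = 0"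
    by blast
  have R: "rmult \<psi> n \<chi> t' v = (-1) powi n *s
      (\<Sum>j<J. coef n j *s \<chi> (t' - n + int j) (\<psi> (- 1 - int j) v))" for t'
    using J by (intro rmult_eq_sum[OF \<chi>]) simp
  have R0: "rmult \<psi> n \<chi> (t - int i) v = 0" if "I \<le> i" for i
  proof -
    have "\<chi> (t - int i - n + int j) (\<psi> (- 1 - int j) v) = 0" if "j < J" for j
      using I[OF that \<open>I \<le> i\<close>] by (simp add: algebra_simps)
    then show ?thesis unfolding R by simp
  qed
  have "lmult \<phi> m (rmult \<psi> n \<chi>) t v
      = (\<Sum>i<I. coef m i *s \<phi> (int i - m - 1) (rmult \<psi> n \<chi> (t - int i) v))"
    using R0 by (rule lmult_eq_sum[OF \<phi>])
  also have "\<dots> = (\<Sum>i<I. \<Sum>j<J. ((-1) powi n * coef n j * coef m i) *s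
      \<phi> (int i - m - 1) (\<chi> (t - n + int j - int i) (\<psi> (- 1 - int j) v)))"
    unfolding R by (simp add: field_scale[OF \<phi>] field_sum[OF \<phi>] scale_sum_right algebra_simps)
  also have "\<dots> = (\<Sum>j<J. \<Sum>i<I. ((-1) powi n * coef n j * coef m i) *s
      \<phi> (int i - m - 1) (\<chi> (t - n + int j - int i) (\<psi> (- 1 - int j) v)))"
    by (rule sum.swap)
  also have "\<dots> = (-1) powi n *s (\<Sum>j<J. coef n j *s lmult \<phi> m \<chi> (t - n + int j) (\<psi> (- 1 - int j) v))"
    unfolding scale_sum_right
  proof (rule sum.cong)
    fix j assume "j \<in> {..<J}"
    then have "lmult \<phi> m \<chi> (t - n + int j) (\<psi> (- 1 - int j) v)
        = (\<Sum>i<I. coef m i *s \<phi> (int i - m - 1) (\<chi> (t - n + int j - int i) (\<psi> (- 1 - int j) v)))"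
      by (intro lmult_eq_sum[OF \<phi>] I) auto
    then show "(\<Sum>i<I. ((-1) powi n * coef n j * coef m i) *s
      \<phi> (int i - m - 1) (\<chi> (t - n + int j - int i) (\<psi> (- 1 - int j) v)))
      = (-1) powi n *s coef n j *s lmult \<phi> m \<chi> (t - n + int j) (\<psi> (- 1 - int j) v)"
      by (simp add: scale_sum_right algebra_simps)
  qed simp
  also have "\<dots> = rmult \<psi> n (lmult \<phi> m \<chi>) t v"
    using J by (intro rmult_eq_sum[symmetric] field_lmult \<phi> \<chi>) simp
  finally show ?thesis .
qed

end

text \<open>
  For a double residue \<open>S m n X\<close> of \<open>(w - u)^m (z - u)^n X\<close>, raising \<open>m\<close> by one instead of \<open>n\<close>
  amounts to multiplying \<open>X\<close> by \<open>(w - u) - (z - u) = w - z\<close>.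
\<close>
lemma mul_diff_pow_iterate:
  assumes "\<And>X m n. \<D> X \<Longrightarrow> S (m + 1) n X - S m (n + 1) X = S m n (mul12 X)"
    and "\<And>X. \<D> X \<Longrightarrow> \<D> (mul12 X)" and "\<D> X"
  shows "(mul_diff ^^ k) (\<lambda>r s. S (- r - 1) (- s - 1) X)
      = (\<lambda>r s. S (- r - 1) (- s - 1) ((mul12 ^^ k) X))"
proof (induction k)
  case (Suc k)
  have D: "\<D> ((mul12 ^^ k) X)" using assms(2,3) by (induction k) simp_all
  have "mul_diff (\<lambda>r s. S (- r - 1) (- s - 1) ((mul12 ^^ k) X)) r s
      = S (- r - 1) (- s - 1) (mul12 ((mul12 ^^ k) X))" for r s
    using assms(1)[OF D, of "- r - 1" "- s - 1"] by (simp add: mul_diff_def)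
  then show ?case unfolding funpow.simps o_apply Suc by (intro ext)
qed simp

context char0_space
begin

text \<open>
  The residue of \<open>(w - u)^m (z - u)^n X\<close> in \<open>w\<close> and \<open>z\<close>, where \<open>T\<close> is one of the two expansions.
\<close>
definition residue ::
    "(int \<Rightarrow> 'u distribution2 \<Rightarrow> 'u distribution2) \<Rightarrow> int \<Rightarrow> int \<Rightarrow> int \<Rightarrow> 'u distribution3 \<Rightarrow> 'u"
  where "residue T t m n X = T m (\<lambda>r t. T n (\<lambda>s t. X r s t) (-1) t) (-1) t"

abbreviation "residue_l \<equiv> residue expand_wz"
abbreviation "residue_r \<equiv> residue expand_zw"

text \<open>
  Distributions of the forms \<open>\<phi>(w) \<psi>(z) \<chi>(u) v\<close> and \<open>\<chi>(u) \<psi>(z) \<phi>(w) v\<close> satisfy \<open>dom_l\<close> and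
  \<open>dom_r\<close>, which make the corresponding residues finite sums.
\<close>
definition dom_l :: "'u distribution3 \<Rightarrow> bool" where
  "dom_l X \<longleftrightarrow> (\<exists>t0. \<forall>r s t. t < t0 \<longrightarrow> X r s t = 0)"

definition dom_r :: "'u distribution3 \<Rightarrow> bool" where
  "dom_r X \<longleftrightarrow> (\<exists>r0. \<forall>r s t. r < r0 \<longrightarrow> X r s t = 0) \<and> (\<forall>r. \<exists>s0. \<forall>s t. s < s0 \<longrightarrow> X r s t = 0)"

lemma dom_l_mul:
  assumes "dom_l X" shows "dom_l (mul12 X)" "dom_l (mul13 X)" "dom_l (mul23 X)"
proof -
  obtain t0 where "\<And>r s t. t < t0 \<Longrightarrow> X r s t = 0" using assms unfolding dom_l_def by blast
  then show "dom_l (mul12 X)" "dom_l (mul13 X)" "dom_l (mul23 X)"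
    unfolding dom_l_def mul12_def mul13_def mul23_def by (intro exI[of _ t0]; simp)+
qed

lemma dom_r_mul:
  assumes "dom_r X" shows "dom_r (mul12 X)" "dom_r (mul13 X)" "dom_r (mul23 X)"
proof -
  obtain r0 where r0: "\<And>r s t. r < r0 \<Longrightarrow> X r s t = 0" using assms unfolding dom_r_def by blast
  have "\<exists>s0. \<forall>s t. s < s0 \<longrightarrow> X r s t = 0 \<and> X r (s - 1) t = 0 \<and> X (r - 1) s t = 0" for r
  proof -
    obtain a b where "\<forall>s t. s < a \<longrightarrow> X r s t = 0" "\<forall>s t. s < b \<longrightarrow> X (r - 1) s t = 0"
      using assms unfolding dom_r_def by metis
    then show ?thesis by (intro exI[of _ "min a b"]) simp
  qed
  then have 1: "\<And>r. \<exists>s0. \<forall>s t. s < s0 \<longrightarrow> mul12 X r s t = 0"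
    "\<And>r. \<exists>s0. \<forall>s t. s < s0 \<longrightarrow> mul13 X r s t = 0" "\<And>r. \<exists>s0. \<forall>s t. s < s0 \<longrightarrow> mul23 X r s t = 0"
    unfolding mul12_def mul13_def mul23_def by (metis diff_self)+
  have 2: "\<forall>r s t. r < r0 \<longrightarrow> mul12 X r s t = 0" "\<forall>r s t. r < r0 \<longrightarrow> mul13 X r s t = 0"
    "\<forall>r s t. r < r0 \<longrightarrow> mul23 X r s t = 0"
    unfolding mul12_def mul13_def mul23_def by (simp_all add: r0)
  show "dom_r (mul12 X)" "dom_r (mul13 X)" "dom_r (mul23 X)"
    unfolding dom_r_def using 1 2 by blast+
qed

lemma residue_step:
  assumes T_Suc: "\<And>n F. R F \<Longrightarrow> T (n + 1) F = T n (mul_diff F)"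
    and T_minus: "\<And>n F G. R F \<Longrightarrow> R G \<Longrightarrow> T n (F - G) = T n F - T n G"
    and T_shift: "\<And>n F r s. T n (\<lambda>r s. F r (s - 1)) r s = T n F r (s - 1)"
    and R_inner: "\<And>Z r. \<D> Z \<Longrightarrow> R (\<lambda>s t. Z r s t)"
    and R_shift: "\<And>Z r. \<D> Z \<Longrightarrow> R (\<lambda>s t. Z r s (t - 1))"
    and R_outer: "\<And>Z n. \<D> Z \<Longrightarrow> R (\<lambda>r t. T n (\<lambda>s t. Z r s t) (-1) t)"
    and \<D>: "\<D> X" "\<D> (mul13 X)" "\<D> (mul23 X)"
  shows "residue T t (m + 1) n X - residue T t m (n + 1) X = residue T t m n (mul12 X)"
proof -
  have "mul_diff (\<lambda>r t. T n (\<lambda>s t. X r s t) (-1) t) = (\<lambda>r t. T n (\<lambda>s t. mul13 X r s t) (-1) t)"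
  proof (intro ext)
    fix r t
    have "(\<lambda>s t. mul13 X r s t) = (\<lambda>s t. X (r - 1) s t) - (\<lambda>s t. X r s (t - 1))"
      by (intro ext) (simp add: mul13_def)
    then have "T n (\<lambda>s t. mul13 X r s t) = T n (\<lambda>s t. X (r - 1) s t) - T n (\<lambda>s t. X r s (t - 1))"
      using T_minus[OF R_inner[OF \<D>(1), of "r - 1"] R_shift[OF \<D>(1), of r], of n] by (simp only:)
    then show "mul_diff (\<lambda>r t. T n (\<lambda>s t. X r s t) (-1) t) r t = T n (\<lambda>s t. mul13 X r s t) (-1) t"
      unfolding mul_diff_def by (simp only: minus_apply T_shift[of n "\<lambda>s t. X r s t"])
  qed
  then have 1: "residue T t (m + 1) n X = residue T t m n (mul13 X)"
    unfolding residue_def T_Suc[OF R_outer[OF \<D>(1)]] by (simp only:)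
  have "mul_diff (\<lambda>s t. X r s t) = (\<lambda>s t. mul23 X r s t)" for r
    by (intro ext) (simp add: mul_diff_def mul23_def)
  then have 2: "residue T t m (n + 1) X = residue T t m n (mul23 X)"
    unfolding residue_def T_Suc[OF R_inner[OF \<D>(1)]] by (simp only:)
  have "(\<lambda>s t. mul12 X r s t) = (\<lambda>s t. mul13 X r s t) - (\<lambda>s t. mul23 X r s t)" for r
    by (intro ext) (simp add: mul12_def mul13_def mul23_def)
  then have "T n (\<lambda>s t. mul12 X r s t) = T n (\<lambda>s t. mul13 X r s t) - T n (\<lambda>s t. mul23 X r s t)"
      for r
    using T_minus[OF R_inner[OF \<D>(2), of r] R_inner[OF \<D>(3), of r], of n] by (simp only:)
  then have "(\<lambda>r t. T n (\<lambda>s t. mul12 X r s t) (-1) t)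
    = (\<lambda>r t. T n (\<lambda>s t. mul13 X r s t) (-1) t) - (\<lambda>r t. T n (\<lambda>s t. mul23 X r s t) (-1) t)"
    by (intro ext) simp
  then have "residue T t m n (mul12 X) = residue T t m n (mul13 X) - residue T t m n (mul23 X)"
    unfolding residue_def
    by (simp only: T_minus[OF R_outer[OF \<D>(2)] R_outer[OF \<D>(3)]] minus_apply)
  then show ?thesis unfolding 1 2 ..
qed

lemma dom_l_regular:
  assumes "dom_l Z"
  shows "lower_bounded (\<lambda>s t. Z r s t)" "lower_bounded (\<lambda>s t. Z r s (t - 1))"
    "lower_bounded (\<lambda>r t. expand_wz n (\<lambda>s t. Z r s t) (-1) t)"
proof -
  obtain t0 where t0: "\<And>r s t. t < t0 \<Longrightarrow> Z r s t = 0" using assms unfolding dom_l_def by blast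
  then show "lower_bounded (\<lambda>s t. Z r s t)" by (intro lower_boundedI)
  show "lower_bounded (\<lambda>s t. Z r s (t - 1))" using t0 by (intro lower_boundedI[of "t0 + 1"]) simp
  have "vanishes_below t0 (\<lambda>s t. Z r s t)" for r using t0 by (simp add: vanishes_below_def)
  from vanishes_belowD[OF vanishes_below_expand_wz[OF this]]
  show "lower_bounded (\<lambda>r t. expand_wz n (\<lambda>s t. Z r s t) (-1) t)" by (intro lower_boundedI)
qed

lemma dom_r_regular:
  assumes "dom_r Z"
  shows "lower_bounded (\<lambda>t s. Z r s t)" "lower_bounded (\<lambda>t s. Z r s (t - 1))"
    "lower_bounded (\<lambda>t r. expand_zw n (\<lambda>s t. Z r s t) (-1) t)"
proof -
  obtain r0 where r0: "\<And>r s t. r < r0 \<Longrightarrow> Z r s t = 0" using assms unfolding dom_r_def by blast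
  obtain s0 where s0: "\<And>s t. s < s0 \<Longrightarrow> Z r s t = 0" using assms unfolding dom_r_def by blast
  then show "lower_bounded (\<lambda>t s. Z r s t)" by (intro lower_boundedI)
  show "lower_bounded (\<lambda>t s. Z r s (t - 1))" using s0 by (intro lower_boundedI[of s0]) simp
  show "lower_bounded (\<lambda>t r. expand_zw n (\<lambda>s t. Z r s t) (-1) t)"
    using r0 by (intro lower_boundedI[of r0]) (simp add: expand_zw_def expand_wz_zero)
qed

lemma expand_zw_minus:
  assumes "lower_bounded (\<lambda>r s. F s r)" "lower_bounded (\<lambda>r s. G s r)"
  shows "expand_zw n (F - G) = expand_zw n F - expand_zw n G"
proof -
  have "(\<lambda>r s. (F - G) s r) = (\<lambda>r s. F s r) - (\<lambda>r s. G s r)" by (intro ext) simp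
  then show ?thesis
    by (intro ext) (simp only: expand_zw_def expand_wz_minus[OF assms] minus_apply
        scale_right_diff_distrib)
qed

lemma expand_zw_Suc:
  assumes "lower_bounded (\<lambda>r s. F s r)"
  shows "expand_zw (n + 1) F = expand_zw n (mul_diff F)"
proof (intro ext)
  fix r s
  have 1: "(\<lambda>r s. mul_diff F s r) = (\<lambda>r s. (-1) *s mul_diff (\<lambda>r s. F s r) r s)"
    by (intro ext) (simp add: mul_diff_def)
  have "expand_zw n (mul_diff F) r s = ((-1) powi n * -1) *s expand_wz (n + 1) (\<lambda>r s. F s r) s r"
    unfolding expand_zw_def expand_wz_Suc[OF assms] 1
    by (subst expand_wz_scale) (simp_all add: lower_bounded_mul_diff assms)
  moreover have "(-1) powi n * -1 = (-1 :: 'k) powi (n + 1)" by (simp add: power_int_add)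
  ultimately show "expand_zw (n + 1) F r s = expand_zw n (mul_diff F) r s"
    by (simp only: expand_zw_def)
qed

lemma expand_zw_shift_right:
  "expand_zw n (\<lambda>r s. F r (s - i)) r s = expand_zw n F r (s - i)"
  unfolding expand_zw_def using expand_wz_shift_left[of n "\<lambda>r s. F s r" i s r] by simp

lemma residue_l_step:
  "dom_l X \<Longrightarrow> residue_l t (m + 1) n X - residue_l t m (n + 1) X = residue_l t m n (mul12 X)"
  by (rule residue_step[where R = lower_bounded and \<D> = dom_l])
    (simp_all add: expand_wz_Suc expand_wz_minus expand_wz_shift_right dom_l_regular dom_l_mul)

lemma residue_r_step:
  "dom_r X \<Longrightarrow> residue_r t (m + 1) n X - residue_r t m (n + 1) X = residue_r t m n (mul12 X)"
  by (rule residue_step[where R = "\<lambda>F. lower_bounded (\<lambda>r s. F s r)" and \<D> = dom_r])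
    (simp_all add: expand_zw_Suc expand_zw_minus expand_zw_shift_right dom_r_regular dom_r_mul)

lemma residue_l_swap:
  assumes "dom_l X"
  shows "residue_l t m n X = residue_l t n m (\<lambda>s r t. X r s t)"
proof -
  obtain t0 where t0: "\<And>r s t. t < t0 \<Longrightarrow> X r s t = 0" using assms unfolding dom_l_def by blast
  define K where "K = nat (t - t0 + 1)"
  have K: "t - int i - int j < t0" if "K \<le> i \<or> K \<le> j" for i j using that by (auto simp: K_def)
  have *: "residue_l t m n Z =
      (\<Sum>i<K. \<Sum>j<K. (coef m i * coef n j) *s Z (-1 - m + int i) (-1 - n + int j)
      (t - int i - int j))"
    if Z: "\<And>r s t. t < t0 \<Longrightarrow> Z r s t = 0" for Z m n
  proof -
    have in_sum: "expand_wz n (\<lambda>s t. Z r s t) (-1) (t - int i)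
      = (\<Sum>j<K. coef n j *s Z r (-1 - n + int j) (t - int i - int j))" for r i
      using Z K by (intro expand_wz_eq_sum') simp
    have "residue_l t m n Z = (\<Sum>i<K. coef m i *s expand_wz n (\<lambda>s t. Z (-1 - m + int i) s t) (-1)
        (t - int i))"
      unfolding residue_def
    proof (rule expand_wz_eq_sum')
      fix i assume "K \<le> i"
      then show "expand_wz n (\<lambda>s t. Z (- 1 - m + int i) s t) (- 1) (t - int i) = 0"
        unfolding in_sum using Z K by simp
    qed
    then show ?thesis unfolding in_sum by (simp add: scale_sum_right)
  qed
  have "residue_l t m n X = (\<Sum>i<K. \<Sum>j<K. (coef m i * coef n j) *s X (-1 - m + int i)
      (-1 - n + int j) (t - int i - int j))"
    by (rule *) (rule t0)
  also have "\<dots> = (\<Sum>j<K. \<Sum>i<K. (coef m i * coef n j) *s X (-1 - m + int i) (-1 - n + int j)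
      (t - int i - int j))"
    by (rule sum.swap)
  also have "\<dots> = residue_l t n m (\<lambda>s r t. X r s t)"
    by (subst *, rule t0) (simp_all add: mult.commute diff_right_commute)
  finally show ?thesis .
qed

lemma residue_r_swap:
  assumes "\<And>r s t. r < r0 \<Longrightarrow> X r s t = 0" "\<And>r s t. s < s0 \<Longrightarrow> X r s t = 0"
  shows "residue_r t m n X = residue_r t n m (\<lambda>s r t. X r s t)"
proof -
  define K where "K = nat (max (- r0) (- s0))"
  have K: "-1 - int i < r0" "-1 - int i < s0" if "K \<le> i" for i using that by (auto simp: K_def)
  have *: "residue_r t m n Z = (\<Sum>i<K. \<Sum>j<K. ((-1) powi m * (-1) powi n * coef m i * coef n j) *s
      Z (-1 - int i) (-1 - int j) (t - m + int i - n + int j))"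
    if Z: "\<And>r s t i. K \<le> i \<Longrightarrow> Z (-1 - int i) s t = 0" "\<And>r s t i. K \<le> i \<Longrightarrow> Z r (-1 - int i) t = 0"
        for Z m n
  proof -
    have in_sum: "expand_zw n (\<lambda>s t. Z r s t) (-1) t
      = (-1) powi n *s (\<Sum>j<K. coef n j *s Z r (-1 - int j) (t - n + int j))" for r t
      unfolding expand_zw_def using Z(2)
      by (subst expand_wz_eq_sum'[where m = K]) (simp_all add: algebra_simps)
    have "residue_r t m n Z = (-1) powi m *s
        (\<Sum>i<K. coef m i *s expand_zw n (\<lambda>s t. Z (-1 - int i) s t) (-1) (t - m + int i))"
      unfolding residue_def unfolding expand_zw_def[of m] using Z(1)
      by (subst expand_wz_eq_sum'[where m = K]) (simp_all add: in_sum algebra_simps)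
    then show ?thesis unfolding in_sum by (simp add: scale_sum_right algebra_simps)
  qed
  have X1: "X (-1 - int i) s t = 0" and X2: "X r (-1 - int i) t = 0" if "K \<le> i" for r s t i
    using assms K[OF that] by blast+
  have "residue_r t m n X = (\<Sum>i<K. \<Sum>j<K. ((-1) powi m * (-1) powi n * coef m i * coef n j) *s
      X (-1 - int i) (-1 - int j) (t - m + int i - n + int j))"
    by (rule *) (fact X1 X2)+
  also have "\<dots> = (\<Sum>j<K. \<Sum>i<K. ((-1) powi m * (-1) powi n * coef m i * coef n j) *s
      X (-1 - int i) (-1 - int j) (t - m + int i - n + int j))"
    by (rule sum.swap)
  also have "\<dots> = (\<Sum>j<K. \<Sum>i<K. ((-1) powi n * (-1) powi m * coef n j * coef m i) *s
      X (-1 - int i) (-1 - int j) (t - n + int j - m + int i))"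
    by (intro sum.cong refl arg_cong2[where f = scale] arg_cong[where f = "X _ _"])
        (simp_all add: ac_simps)
  also have "\<dots> = residue_r t n m (\<lambda>s r t. X r s t)"
    by (rule *[symmetric]) (fact X1 X2)+
  finally show ?thesis .
qed

lemma residue_l_scale:
  assumes "dom_l X" shows "residue_l t m n (\<lambda>r s t. c *s X r s t) = c *s residue_l t m n X"
  unfolding residue_def expand_wz_scale[OF dom_l_regular(1)[OF assms]]
    expand_wz_scale[OF dom_l_regular(3)[OF assms]] ..

lemma residue_r_scale:
  assumes "dom_r X" shows "residue_r t m n (\<lambda>r s t. c *s X r s t) = c *s residue_r t m n X"
proof -
  have zw: "expand_zw n (\<lambda>r s. c *s F r s) = (\<lambda>r s. c *s expand_zw n F r s)"
    if "lower_bounded (\<lambda>r s. F s r)" for F n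
    unfolding expand_zw_def expand_wz_scale[OF that] by (simp add: mult.commute)
  show ?thesis
    unfolding residue_def zw[OF dom_r_regular(1)[OF assms]] zw[OF dom_r_regular(3)[OF assms]] ..
qed

end

context char0_space
begin

lemma lmult_lmult:
  assumes \<phi>: "field_op \<phi>" and \<psi>: "field_op \<psi>" and \<chi>: "field_op \<chi>"
  shows "lmult \<phi> m (lmult \<psi> n \<chi>) t v = residue_l t m n (\<lambda>r s t. \<phi> r (\<psi> s (\<chi> t v)))"
proof -
  have "\<phi> r (lmult \<psi> n \<chi> t v) = expand_wz n (\<lambda>s t. \<phi> r (\<psi> s (\<chi> t v))) (-1) t" for r t
    unfolding lmult_def
    using expand_wz_hom[OF lower_bounded_comp[OF \<psi> \<chi>, of "\<lambda>r. r" v], of "\<phi> r" n]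
    by (simp add: field_add[OF \<phi>] field_scale[OF \<phi>])
  then show ?thesis unfolding lmult_def[of \<phi>] residue_def by (simp only:)
qed

lemma rmult_rmult: "rmult \<phi> m (rmult \<psi> n \<chi>) t v = residue_r t m n (\<lambda>r s t. \<chi> t (\<psi> s (\<phi> r v)))"
  unfolding rmult_def residue_def ..

lemma local_mul12:
  assumes \<phi>: "field_op \<phi>" and \<psi>: "field_op \<psi>" and k: "\<And>v. bracket e (int k) \<phi> \<psi> v = 0"
  shows "(mul_diff ^^ k) (\<lambda>r s. \<phi> r (\<psi> s v)) = (\<lambda>r s. e *s (mul_diff ^^ k) (\<lambda>r s. \<psi> s (\<phi> r v)) r s)"
proof -
  have "(mul_diff ^^ k) ((\<lambda>r s. \<phi> r (\<psi> s v)) - (\<lambda>r s. e *s \<psi> s (\<phi> r v))) = 0"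
    using k[of v] unfolding bracket_nat[OF \<phi> \<psi>] by (simp only: fun_diff_def)
  then show ?thesis
    unfolding mul_diff_pow_minus mul_diff_pow_hom[where h = "scale e", OF scale_right_diff_distrib]
    by simp
qed

lemma lmult_local:
  assumes \<phi>: "field_op \<phi>" and \<psi>: "field_op \<psi>" and \<chi>: "field_op \<chi>"
    and k: "\<And>v. bracket e (int k) \<phi> \<psi> v = 0"
  shows "(mul_diff ^^ k) (\<lambda>r s. lmult \<phi> (- r - 1) (lmult \<psi> (- s - 1) \<chi>) t v) =
    (\<lambda>r s. e *s (mul_diff ^^ k) (\<lambda>r s. lmult \<psi> (- s - 1) (lmult \<phi> (- r - 1) \<chi>) t v) r s)"
proof -
  define X where "X = (\<lambda>r s t. \<phi> r (\<psi> s (\<chi> t v)))"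
  define Y where "Y = (\<lambda>r s t. \<psi> s (\<phi> r (\<chi> t v)))"
  obtain t0 where t0: "\<And>t. t < t0 \<Longrightarrow> \<chi> t v = 0" using field_truncE[OF \<chi>] by blast
  have X: "dom_l X"
    unfolding dom_l_def X_def by (intro exI[of _ t0]) (simp add: t0 field_0[OF \<phi>] field_0[OF \<psi>])
  have Y: "dom_l Y"
    unfolding dom_l_def Y_def by (intro exI[of _ t0]) (simp add: t0 field_0[OF \<phi>] field_0[OF \<psi>])
  have dY: "dom_l ((mul12 ^^ k) Y)" using Y by (induction k) (simp_all add: dom_l_mul)
  have XY: "(mul12 ^^ k) X = (\<lambda>r s t. e *s (mul12 ^^ k) Y r s t)"
    unfolding mul12_pow X_def Y_def local_mul12[OF \<phi> \<psi> k] ..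
  have 1: "lmult \<phi> (- r - 1) (lmult \<psi> (- s - 1) \<chi>) t v = residue_l t (- r - 1) (- s - 1) X" for r s
    by (simp add: lmult_lmult \<phi> \<psi> \<chi> X_def)
  have 2: "lmult \<psi> (- s - 1) (lmult \<phi> (- r - 1) \<chi>) t v = residue_l t (- r - 1) (- s - 1) Y" for r s
    unfolding residue_l_swap[OF Y] by (simp add: lmult_lmult \<phi> \<psi> \<chi> Y_def)
  have it: "(mul_diff ^^ k) (\<lambda>r s. residue_l t (- r - 1) (- s - 1) Z)
    = (\<lambda>r s. residue_l t (- r - 1) (- s - 1) ((mul12 ^^ k) Z))" if "dom_l Z" for Z
    by (rule mul_diff_pow_iterate[where \<D> = dom_l])
        (use that in \<open>simp_all add: residue_l_step dom_l_mul\<close>)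
  show ?thesis unfolding 1 2 it[OF X] it[OF Y] XY residue_l_scale[OF dY] ..
qed

lemma rmult_local:
  assumes \<phi>: "field_op \<phi>" and \<psi>: "field_op \<psi>" and \<chi>: "field_op \<chi>"
    and k: "\<And>v. bracket e (int k) \<phi> \<psi> v = 0" and e: "e * e = 1"
  shows "(mul_diff ^^ k) (\<lambda>r s. rmult \<phi> (- r - 1) (rmult \<psi> (- s - 1) \<chi>) t v) =
    (\<lambda>r s. e *s (mul_diff ^^ k) (\<lambda>r s. rmult \<psi> (- s - 1) (rmult \<phi> (- r - 1) \<chi>) t v) r s)"
proof -
  define X where "X = (\<lambda>r s t. \<chi> t (\<psi> s (\<phi> r v)))"
  define Y where "Y = (\<lambda>s r t. \<chi> t (\<phi> r (\<psi> s v)))"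
  have dom: "dom_r (\<lambda>r s t. \<chi> t (\<beta> s (\<alpha> r v)))" if f: "field_op \<alpha>" "field_op \<beta>" for \<alpha> \<beta>
  proof -
    obtain r0 where r0: "\<And>r. r < r0 \<Longrightarrow> \<alpha> r v = 0" using field_truncE[OF f(1)] by blast
    have "\<exists>s0. \<forall>s t. s < s0 \<longrightarrow> \<chi> t (\<beta> s (\<alpha> r v)) = 0" for r
      using f(2) unfolding field_op_def by (metis field_0[OF \<chi>])
    moreover have "\<chi> t (\<beta> s (\<alpha> r v)) = 0" if "r < r0" for r s t
      by (simp add: r0[OF that] field_0[OF f(2)] field_0[OF \<chi>])
    ultimately show ?thesis unfolding dom_r_def by blast
  qed
  have X: "dom_r X" and Y: "dom_r Y" unfolding X_def Y_def using dom \<phi> \<psi> by blast+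
  have dX: "dom_r ((mul12 ^^ k) X)" using X by (induction k) (simp_all add: dom_r_mul)
  have dY: "dom_r ((mul12 ^^ k) Y)" using Y by (induction k) (simp_all add: dom_r_mul)
  have \<chi>d: "\<chi> t (x - y) = \<chi> t x - \<chi> t y" for t x y by (rule field_diff[OF \<chi>])
  have XY: "(mul12 ^^ k) X = (\<lambda>r s t. (e * (-1) ^ k) *s (mul12 ^^ k) Y s r t)"
  proof -
    have "(mul_diff ^^ k) (\<lambda>r s. \<psi> s (\<phi> r v))
        = (\<lambda>r s. e *s (mul_diff ^^ k) (\<lambda>r s. \<phi> r (\<psi> s v)) r s)"
      unfolding local_mul12[OF \<phi> \<psi> k] by (simp add: e)
    moreover have "(mul_diff ^^ k) (\<lambda>r s. \<phi> r (\<psi> s v))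
        = (\<lambda>r s. (-1) ^ k *s (mul_diff ^^ k) (\<lambda>s r. \<phi> r (\<psi> s v)) s r)"
      using mul_diff_pow_flip[of k "\<lambda>s r. \<phi> r (\<psi> s v)"] .
    ultimately have "(mul_diff ^^ k) (\<lambda>r s. \<psi> s (\<phi> r v))
        = (\<lambda>r s. (e * (-1) ^ k) *s (mul_diff ^^ k) (\<lambda>s r. \<phi> r (\<psi> s v)) s r)"
      by simp
    then show ?thesis
      unfolding mul12_pow X_def Y_def mul_diff_pow_hom[of "\<chi> _", OF \<chi>d]
          by (simp only: field_scale[OF \<chi>])
  qed
  have it: "(mul_diff ^^ k) (\<lambda>r s. residue_r t (- r - 1) (- s - 1) Z)
    = (\<lambda>r s. residue_r t (- r - 1) (- s - 1) ((mul12 ^^ k) Z))" if "dom_r Z" for Z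
    by (rule mul_diff_pow_iterate[where \<D> = dom_r])
        (use that in \<open>simp_all add: residue_r_step dom_r_mul\<close>)
  have 1: "(mul_diff ^^ k) (\<lambda>r s. rmult \<phi> (- r - 1) (rmult \<psi> (- s - 1) \<chi>) t v)
      = (\<lambda>r s. residue_r t (- r - 1) (- s - 1) ((mul12 ^^ k) X))"
    unfolding rmult_rmult X_def[symmetric] by (rule it[OF X])
  have 2: "(mul_diff ^^ k) (\<lambda>r s. rmult \<psi> (- s - 1) (rmult \<phi> (- r - 1) \<chi>) t v)
      = (\<lambda>r s. (-1) ^ k *s residue_r t (- s - 1) (- r - 1) ((mul12 ^^ k) Y))"
    unfolding rmult_rmult Y_def[symmetric]
    unfolding mul_diff_pow_flip[of k "\<lambda>s r. residue_r t (- s - 1) (- r - 1) Y"] it[OF Y] ..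
  obtain r0 where r0: "\<And>r s t. r < r0 \<Longrightarrow> (mul12 ^^ k) X r s t = 0" using dX unfolding dom_r_def
      by blast
  obtain s0 where s0: "\<And>s r t. s < s0 \<Longrightarrow> (mul12 ^^ k) Y s r t = 0" using dY unfolding dom_r_def
      by blast
  have s0': "(mul12 ^^ k) X r s t = 0" if "s < s0" for r s t using s0[OF that] unfolding XY by simp
  have "residue_r t m n ((mul12 ^^ k) X) = (e * (-1) ^ k) *s residue_r t n m ((mul12 ^^ k) Y)"
      for m n
  proof -
    have *: "(\<lambda>s r t. (mul12 ^^ k) X r s t) = (\<lambda>s r t. (e * (-1) ^ k) *s (mul12 ^^ k) Y s r t)"
      unfolding XY ..
    note arg_cong[OF *, of "residue_r t n m"]
    note trans[OF this residue_r_scale[OF dY]]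
    with residue_r_swap[where X = "(mul12 ^^ k) X", OF r0 s0'] show ?thesis by (rule trans)
  qed
  then show ?thesis unfolding 1 2 by simp
qed

text \<open>
  Each product on the left has a part in which its factor acts from the left and one in which it
  acts from the right. The mixed terms of the two orders are equal by \<open>lmult_rmult_commute\<close>. In
  the others, locality of \<open>\<phi>\<close> and \<open>\<psi>\<close> applies, since \<open>(w - z)^k\<close> can be moved under the residues.
\<close>
theorem fprod_local:
  assumes \<phi>: "field_op \<phi>" and \<psi>: "field_op \<psi>" and \<chi>: "field_op \<chi>"
    and k: "\<And>v. bracket e (int k) \<phi> \<psi> v = 0" and e: "e * e = 1"
  shows "(mul_diff ^^ k) (\<lambda>r s. fprod (e * e1) (- r - 1) \<phi> (fprod e2 (- s - 1) \<psi> \<chi>) t v) =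
    (\<lambda>r s. e *s (mul_diff ^^ k)
        (\<lambda>r s. fprod (e * e2) (- s - 1) \<psi> (fprod e1 (- r - 1) \<phi> \<chi>) t v) r s)"
proof -
  have expand: "fprod E m \<alpha> (fprod E' n \<beta> \<chi>) t v =
      lmult \<alpha> m (lmult \<beta> n \<chi>) t v - E' *s lmult \<alpha> m (rmult \<beta> n \<chi>) t v
      - E *s rmult \<alpha> m (lmult \<beta> n \<chi>) t v + (E * E') *s rmult \<alpha> m (rmult \<beta> n \<chi>) t v"
    if \<alpha>: "field_op \<alpha>" and \<beta>: "field_op \<beta>" for E E' m n \<alpha> \<beta>
  proof -
    have *: "fprod E' n \<beta> \<chi> = lmult \<beta> n \<chi> + (\<lambda>t v. (- E') *s rmult \<beta> n \<chi> t v)"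
      by (intro ext) (simp add: fprod_eq)
    note f = field_lmult[OF \<beta> \<chi>] field_rmult[OF \<beta> \<chi>]
    have 1: "lmult \<alpha> m (fprod E' n \<beta> \<chi>) t v
        = lmult \<alpha> m (lmult \<beta> n \<chi>) t v + (- E') *s lmult \<alpha> m (rmult \<beta> n \<chi>) t v"
      unfolding * lmult_add_right[OF \<alpha> f(1) field_op_scale[OF f(2)]] mult_scale(1)[OF \<alpha> f(2)] ..
    have 2: "rmult \<alpha> m (fprod E' n \<beta> \<chi>) t v
        = rmult \<alpha> m (lmult \<beta> n \<chi>) t v + (- E') *s rmult \<alpha> m (rmult \<beta> n \<chi>) t v"
      unfolding * rmult_add_right[OF \<alpha> f(1) field_op_scale[OF f(2)]] mult_scale(3)[OF \<alpha> f(2)] ..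
    show ?thesis unfolding fprod_eq[of E] 1 2 by (simp add: algebra_simps)
  qed
  define LL where "LL = (\<lambda>r s. lmult \<phi> (- r - 1) (lmult \<psi> (- s - 1) \<chi>) t v)"
  define LL' where "LL' = (\<lambda>r s. lmult \<psi> (- s - 1) (lmult \<phi> (- r - 1) \<chi>) t v)"
  define RR where "RR = (\<lambda>r s. rmult \<phi> (- r - 1) (rmult \<psi> (- s - 1) \<chi>) t v)"
  define RR' where "RR' = (\<lambda>r s. rmult \<psi> (- s - 1) (rmult \<phi> (- r - 1) \<chi>) t v)"
  define A where "A = (\<lambda>r s. fprod (e * e1) (- r - 1) \<phi> (fprod e2 (- s - 1) \<psi> \<chi>) t v)"
  define A' where "A' = (\<lambda>r s. fprod (e * e2) (- s - 1) \<psi> (fprod e1 (- r - 1) \<phi> \<chi>) t v)"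
  have ee: "e * (e * x) = x" for x using e by (simp add: mult.assoc[symmetric])
  have "A r s - e *s A' r s = (LL r s - e *s LL' r s) + (e * e1 * e2) *s (RR r s - e *s RR' r s)"
      for r s
    unfolding A_def A'_def LL_def LL'_def RR_def RR'_def expand[OF \<phi> \<psi>] expand[OF \<psi> \<phi>]
      lmult_rmult_commute[OF \<phi> \<psi> \<chi>] lmult_rmult_commute[OF \<psi> \<phi> \<chi>]
    by (simp add: algebra_simps ee e)
  then have eq: "A - (\<lambda>r s. e *s A' r s) = (LL - (\<lambda>r s. e *s LL' r s))
      + (\<lambda>r s. (e * e1 * e2) *s (RR - (\<lambda>r s. e *s RR' r s)) r s)"
    by (intro ext) simp
  have sc: "(mul_diff ^^ k) (\<lambda>r s. c *s G r s) = (\<lambda>r s. c *s (mul_diff ^^ k) G r s)" for c G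
    by (rule mul_diff_pow_hom) (rule scale_right_diff_distrib)
  have L: "(mul_diff ^^ k) (LL - (\<lambda>r s. e *s LL' r s)) = 0"
    unfolding mul_diff_pow_minus sc LL_def LL'_def lmult_local[OF \<phi> \<psi> \<chi> k] by simp
  have R: "(mul_diff ^^ k) (RR - (\<lambda>r s. e *s RR' r s)) = 0"
    unfolding mul_diff_pow_minus sc RR_def RR'_def rmult_local[OF \<phi> \<psi> \<chi> k e] by simp
  have "(mul_diff ^^ k) (A - (\<lambda>r s. e *s A' r s)) = 0"
    unfolding eq mul_diff_pow_add L sc R by (intro ext) simp
  then show ?thesis unfolding mul_diff_pow_minus sc A_def[symmetric] A'_def[symmetric] by simp
qed

definition fderiv :: "'u modes \<Rightarrow> 'u modes" where
  "fderiv \<phi> r v = of_int (r + 1) *s \<phi> (r + 1) v"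

definition idf :: "int \<Rightarrow> 'u \<Rightarrow> 'u" where
  "idf r v = (if r = 0 then v else 0)"

lemma field_fderiv: "field_op \<phi> \<Longrightarrow> field_op (fderiv \<phi>)"
proof (rule field_opI)
  fix v assume f: "field_op \<phi>"
  obtain a where "\<And>r. r < a \<Longrightarrow> \<phi> r v = 0" using field_truncE[OF f] by metis
  then show "\<exists>r0. \<forall>r<r0. fderiv \<phi> r v = 0" by (intro exI[of _ "a - 1"]) (simp add: fderiv_def)
qed (simp_all add: fderiv_def field_add field_scale scale_right_distrib mult.commute)

lemma field_idf: "field_op idf"
  by (rule field_opI) (auto simp: idf_def intro: exI[of _ 0])

lemma fprod_fderiv_left:
  assumes "field_op \<phi>" "field_op \<psi>"
  shows "fprod e n (fderiv \<phi>) \<psi> s v = - (of_int n *s fprod e (n - 1) \<phi> \<psi> s v)"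
proof -
  have 1: "expand_wz n (\<lambda>r s. fderiv \<phi> r (\<psi> s v)) (-1) s
      = - (of_int n *s expand_wz (n - 1) (\<lambda>r s. \<phi> r (\<psi> s v)) (-1) s)"
    using expand_wz_deriv_w[OF lower_bounded_comp[OF assms, of "\<lambda>r. r" v], of "-1" n s]
    by (simp add: fderiv_def eq_neg_iff_add_eq_0 add.commute)
  have 2: "expand_wz n (\<lambda>s r. \<psi> s (fderiv \<phi> r v)) s (-1)
      = of_int n *s expand_wz (n - 1) (\<lambda>s r. \<psi> s (\<phi> r v)) s (-1)"
    using expand_wz_deriv_z[OF lower_bounded_comp[OF assms(2,1), of "\<lambda>r. r" v], of "-1" n s]
    by (simp add: fderiv_def field_scale[OF assms(2)])
  have "(-1 :: 'k) powi (n - 1) = - ((-1) powi n)" by (simp add: power_int_diff)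
  then show ?thesis unfolding fprod_eq lmult_def rmult_def expand_zw_def 1 2
    by (simp add: algebra_simps)
qed

lemma fprod_fderiv_right:
  assumes "field_op \<phi>" "field_op \<psi>"
  shows "fprod e n \<phi> (fderiv \<psi>) s v
      = of_int n *s fprod e (n - 1) \<phi> \<psi> s v + fderiv (fprod e n \<phi> \<psi>) s v"
proof -
  have 1: "expand_wz n (\<lambda>r s. \<phi> r (fderiv \<psi> s v)) (-1) s
      = of_int n *s expand_wz (n - 1) (\<lambda>r s. \<phi> r (\<psi> s v)) (-1) s
      + of_int (s + 1) *s expand_wz n (\<lambda>r s. \<phi> r (\<psi> s v)) (-1) (s + 1)"
    using expand_wz_deriv_z[OF lower_bounded_comp[OF assms, of "\<lambda>r. r" v], of s n "-1"]
    by (simp add: fderiv_def field_scale[OF assms(1)])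
  have 2: "expand_wz n (\<lambda>s r. fderiv \<psi> s (\<phi> r v)) s (-1) =
      of_int (s + 1) *s expand_wz n (\<lambda>s r. \<psi> s (\<phi> r v)) (s + 1) (-1) - of_int n *s expand_wz
          (n - 1) (\<lambda>s r. \<psi> s (\<phi> r v)) s (-1)"
    using expand_wz_deriv_w[OF lower_bounded_comp[OF assms(2,1), of "\<lambda>r. r" v], of s n "-1"]
    by (simp add: fderiv_def)
  have "(-1 :: 'k) powi (n - 1) = - ((-1) powi n)" by (simp add: power_int_diff)
  then show ?thesis unfolding fprod_eq lmult_def rmult_def expand_zw_def
      fderiv_def[of "fprod _ _ _ _"] 1 2
    by (simp add: algebra_simps)
qed

lemma fprod_idf_left:
  assumes "field_op \<psi>"
  shows "fprod e n idf \<psi> s v = (if n = -1 then \<psi> s v else 0)"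
proof -
  have "vanishes_below 0 (\<lambda>s r. \<psi> s (idf r v))"
      by (simp add: vanishes_below_def idf_def field_0[OF assms])
  from vanishes_belowD[OF vanishes_below_expand_wz[OF this]] have r: "rmult idf n \<psi> s v = 0"
    by (simp add: rmult_def expand_zw_def)
  have l: "lmult idf n \<psi> s v = Sum_any
      (\<lambda>j. if j = nat (n + 1) \<and> n \<ge> -1 then coef n j *s \<psi> (s - int j) v else 0)"
    unfolding lmult_def expand_wz_def coef_def by (intro Sum_any.cong) (auto simp: idf_def)
  consider "n < -1" | "n = -1" | "n \<ge> 0" by linarith
  then show ?thesis
  proof cases
    case 3
    then obtain k where "n = int k" using nonneg_int_cases by blast
    moreover from this have "nat (n + 1) = Suc k" by simp
    ultimately have "coef n (nat (n + 1)) = 0"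
      by (simp add: coef_def binomial_gbinomial[symmetric])
    then show ?thesis using 3 by (simp add: fprod_eq r l)
  next
    case 1
    then show ?thesis using r l by (simp add: fprod_eq)
  next
    case 2
    then show ?thesis using r l by (simp add: fprod_eq coef_def)
  qed
qed

lemma fprod_idf_right_nat:
  assumes "field_op \<phi>"
  shows "fprod 1 (int k) \<phi> idf s v = 0"
proof -
  have *: "(\<lambda>r s. \<phi> r (idf s v) - 1 *s idf s (\<phi> r v)) = 0"
    by (intro ext) (simp add: idf_def field_0[OF assms])
  show ?thesis
    unfolding fprod_def bracket_nat[OF assms field_idf] *
      by (simp only: mul_diff_pow_0 zero_fun_apply)
qed

lemma fprod_idf_right_minus1:
  assumes "field_op \<phi>"
  shows "fprod 1 (-1) \<phi> idf s v = \<phi> s v"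
proof -
  have c: "coef (-1) j = 1" for j
    using gbinomial_minus[of "1 :: 'k" j]
        by (simp add: coef_def binomial_gbinomial[symmetric] power_mult_distrib[symmetric])
  have l: "lmult \<phi> (-1) idf s v = Sum_any (\<lambda>j. if j = nat s \<and> s \<ge> 0 then \<phi> s v else 0)"
    unfolding lmult_def expand_wz_def coef_def[symmetric] c
    by (intro Sum_any.cong) (auto simp: idf_def field_0[OF assms])
  have r: "rmult \<phi> (-1) idf s v = - Sum_any (\<lambda>j. if j = nat (- s - 1) \<and> s < 0 then \<phi> s v else 0)"
  proof -
    have "(\<Sum>j. coef (-1) j *s idf (s - (-1) + int j) (\<phi> (- 1 - int j) v))
      = (\<Sum>j. if j = nat (- s - 1) \<and> s < 0 then \<phi> s v else 0)"
      unfolding c by (intro Sum_any.cong) (auto simp: idf_def)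
    then show ?thesis
      unfolding rmult_def expand_zw_def expand_wz_def coef_def[symmetric] by simp
  qed
  show ?thesis by (cases "s \<ge> 0") (simp_all add: fprod_eq l r)
qed

lemma fprod_idf_right_minus2:
  assumes "field_op \<phi>"
  shows "fprod 1 (-2) \<phi> idf s v = fderiv \<phi> s v"
  using fprod_fderiv_left[OF assms field_idf, of 1 "-1" s v]
      fprod_idf_right_minus1[OF field_fderiv[OF assms]]
  by simp

lemma local_sym:
  assumes \<phi>: "field_op \<phi>" and \<psi>: "field_op \<psi>" and "e * e = 1" and "is_local e \<phi> \<psi>"
  shows "is_local e \<psi> \<phi>"
proof -
  obtain k where k: "\<And>v. bracket e (int k) \<phi> \<psi> v = 0" using assms unfolding is_local_def by blast
  have "bracket e (int k) \<psi> \<phi> v = 0" for v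
  proof -
    define F where "F = (\<lambda>r s. \<phi> r (\<psi> s v) - e *s \<psi> s (\<phi> r v))"
    have F: "(mul_diff ^^ k) F = 0" using k[of v] unfolding bracket_nat[OF \<phi> \<psi>] F_def .
    have "(\<lambda>r s. \<psi> r (\<phi> s v) - e *s \<phi> s (\<psi> r v)) = (\<lambda>r s. (- e) *s F s r)"
      unfolding F_def using assms(3) by (intro ext) (simp add: algebra_simps)
    moreover have "(mul_diff ^^ k) (\<lambda>r s. (- e) *s F s r)
        = (\<lambda>r s. (- e) *s (mul_diff ^^ k) (\<lambda>r s. F s r) r s)"
      by (rule mul_diff_pow_hom) (rule scale_right_diff_distrib)
    ultimately show ?thesis
      unfolding bracket_nat[OF \<psi> \<phi>] mul_diff_pow_flip[of k F] F by (intro ext) simp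
  qed
  then show ?thesis unfolding is_local_def by blast
qed

lemma local_add:
  assumes \<phi>: "field_op \<phi>" and \<phi>': "field_op \<phi>'" and \<psi>: "field_op \<psi>"
      and "is_local e \<phi> \<psi>" "is_local e \<phi>' \<psi>"
  shows "is_local e (\<phi> + \<phi>') \<psi>"
proof -
  obtain k k' where "\<And>v. bracket e (int k) \<phi> \<psi> v = 0" "\<And>v. bracket e (int k') \<phi>' \<psi> v = 0"
    using assms unfolding is_local_def by metis
  then have k: "bracket e (int (max k k')) \<phi> \<psi> v = 0" "bracket e (int (max k k')) \<phi>' \<psi> v = 0" for v
    using local_mono[OF \<phi> \<psi>, of e k] local_mono[OF \<phi>' \<psi>, of e k'] by simp_all
  have "bracket e (int (max k k')) (\<phi> + \<phi>') \<psi> v = 0" for v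
  proof -
    have "(\<lambda>r s. (\<phi> + \<phi>') r (\<psi> s v) - e *s \<psi> s ((\<phi> + \<phi>') r v))
      = (\<lambda>r s. \<phi> r (\<psi> s v) - e *s \<psi> s (\<phi> r v)) + (\<lambda>r s. \<phi>' r (\<psi> s v) - e *s \<psi> s (\<phi>' r v))"
      by (intro ext) (simp add: field_add[OF \<psi>] algebra_simps)
    then show ?thesis
      using k[of v] unfolding bracket_nat[OF \<phi> \<psi>] bracket_nat[OF \<phi>' \<psi>]
          bracket_nat[OF field_op_add[OF \<phi> \<phi>'] \<psi>]
      by (simp only: mul_diff_pow_add) simp
  qed
  then show ?thesis unfolding is_local_def by blast
qed

lemma local_scale:
  assumes \<phi>: "field_op \<phi>" and \<psi>: "field_op \<psi>" and "is_local e \<phi> \<psi>"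
  shows "is_local e (\<lambda>r v. c *s \<phi> r v) \<psi>"
proof -
  obtain k where k: "\<And>v. bracket e (int k) \<phi> \<psi> v = 0"
    using assms unfolding is_local_def by metis
  have "bracket e (int k) (\<lambda>r v. c *s \<phi> r v) \<psi> v = 0" for v
  proof -
    have "(\<lambda>r s. c *s \<phi> r (\<psi> s v) - e *s \<psi> s (c *s \<phi> r v))
        = (\<lambda>r s. c *s (\<phi> r (\<psi> s v) - e *s \<psi> s (\<phi> r v)))"
      by (intro ext) (simp add: field_scale[OF \<psi>] algebra_simps)
    moreover have "(mul_diff ^^ k) (\<lambda>r s. c *s G r s) = (\<lambda>r s. c *s (mul_diff ^^ k) G r s)" for G
      by (rule mul_diff_pow_hom) (rule scale_right_diff_distrib)
    ultimately show ?thesis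
      using k[of v] unfolding bracket_nat[OF \<phi> \<psi>] bracket_nat[OF field_op_scale[OF \<phi>] \<psi>]
      by simp (intro ext, simp)
  qed
  then show ?thesis unfolding is_local_def by blast
qed

lemma local_idf:
  assumes "field_op \<psi>" shows "is_local 1 idf \<psi>"
proof -
  have "bracket 1 (int 0) idf \<psi> v = 0" for v
    unfolding bracket_nat[OF field_idf assms] by (intro ext) (simp add: idf_def field_0[OF assms])
  then show ?thesis unfolding is_local_def by blast
qed

lemma local_zero:
  assumes "field_op \<psi>" shows "is_local e 0 \<psi>"
proof -
  have "bracket e (int 0) 0 \<psi> v = 0" for v
    unfolding bracket_nat[OF field_op_0 assms] by (intro ext) (simp add: field_0[OF assms])
  then show ?thesis unfolding is_local_def by blast
qed

end

section \<open>The vertex algebra of a maximal system of local fields\<close>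

lemma koszul_sign_square: "koszul_sign p q * koszul_sign p q = 1"
  by (simp add: koszul_sign_def)

lemma koszul_sign_commute: "koszul_sign p q = koszul_sign q p"
  by (auto simp: koszul_sign_def)

lemma koszul_sign_add: "koszul_sign (p + q) r = koszul_sign p r * koszul_sign q r"
  by (cases p; cases q; cases r) (simp_all add: koszul_sign_def)

lemma koszul_sign_0: "koszul_sign 0 p = 1"
  by (simp add: koszul_sign_def)

lemma bit_add_self: "p + p = (0::bit)" "p + (p + q) = (q::bit)"
  by (cases p; cases q; simp)+

context char0_space
begin

definition mutually_local :: "(bit \<times> 'u modes) set \<Rightarrow> bool" where
  "mutually_local X \<longleftrightarrow> (\<forall>(p, \<phi>) \<in> X. field_op \<phi>) \<and>
     (\<forall>(p, \<phi>) \<in> X. \<forall>(q, \<psi>) \<in> X. is_local (koszul_sign p q) \<phi> \<psi>)"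

end

text \<open>
  Maximality makes closure properties automatic: a field that is local with itself and with all
  members is a member.
\<close>
locale local_system = char0_space scale
  for scale :: "'k::field_char_0 \<Rightarrow> 'u::ab_group_add \<Rightarrow> 'u" (infixr "*s" 75) +
  fixes W :: "bit \<Rightarrow> 'u modes set"
  assumes W_field: "\<phi> \<in> W p \<Longrightarrow> field_op \<phi>"
    and W_local: "\<phi> \<in> W p \<Longrightarrow> \<psi> \<in> W q \<Longrightarrow> is_local (koszul_sign p q) \<phi> \<psi>"
    and W_maximal: "field_op \<phi> \<Longrightarrow> is_local (koszul_sign p p) \<phi> \<phi> \<Longrightarrow>
      (\<And>q \<psi>. \<psi> \<in> W q \<Longrightarrow> is_local (koszul_sign p q) \<phi> \<psi>) \<Longrightarrow> \<phi> \<in> W p"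

context char0_space
begin

text \<open>
  Locality is a condition on pairs, so Zorn's lemma applies.
\<close>
lemma local_system_exists:
  assumes "mutually_local X"
  obtains W where "local_system scale W" "\<And>p \<phi>. (p, \<phi>) \<in> X \<Longrightarrow> \<phi> \<in> W p"
proof -
  let ?A = "{Y. mutually_local Y \<and> X \<subseteq> Y}"
  have "\<exists>M\<in>?A. \<forall>Y\<in>?A. M \<subseteq> Y \<longrightarrow> Y = M"
  proof (rule subset_Zorn_nonempty)
    show "?A \<noteq> {}" using assms by blast
  next
    fix \<C> assume C: "\<C> \<noteq> {}" "subset.chain ?A \<C>"
    have ml: "mutually_local Y" "X \<subseteq> Y" if "Y \<in> \<C>" for Y
      using C(2) that unfolding subset.chain_def by blast+
    have "mutually_local (\<Union>\<C>)"
      unfolding mutually_local_def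
    proof (intro conjI ballI, goal_cases)
      case (1 x)
      then obtain Y where Y: "Y \<in> \<C>" "x \<in> Y" by blast
      have "\<forall>(p, \<phi>) \<in> Y. field_op \<phi>" using ml(1)[OF Y(1)] unfolding mutually_local_def
          by (rule conjunct1)
      then show ?case using Y(2) by (rule bspec)
    next
      case (2 x)
      show ?case
      proof (cases x)
        case (Pair p \<phi>)
        have "is_local (koszul_sign p q) \<phi> \<psi>" if y: "(q, \<psi>) \<in> \<Union>\<C>" for q \<psi>
        proof -
          obtain Y Z where YZ: "Y \<in> \<C>" "(p, \<phi>) \<in> Y" "Z \<in> \<C>" "(q, \<psi>) \<in> Z" using 2 y Pair by blast
          then have "Y \<subseteq> Z \<or> Z \<subseteq> Y" using C(2) unfolding subset_chain_def by blast
          then obtain V where "V \<in> \<C>" "(p, \<phi>) \<in> V" "(q, \<psi>) \<in> V" using YZ by blast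
          then show ?thesis using ml(1)[of V] unfolding mutually_local_def by blast
        qed
        then show ?thesis using Pair by blast
      qed
    qed
    then show "\<Union>\<C> \<in> ?A" using C(1) ml(2) by blast
  qed
  then obtain M where MA: "M \<in> ?A" and maxA: "\<forall>Y\<in>?A. M \<subseteq> Y \<longrightarrow> Y = M" by (rule bexE)
  then have M: "mutually_local M" "X \<subseteq> M" by simp_all
  have max: "Y = M" if "mutually_local Y" "M \<subseteq> Y" for Y
  proof -
    have "Y \<in> ?A" using that M(2) by simp
    then show ?thesis using maxA that(2) by simp
  qed
  define W where "W p = {\<phi>. (p, \<phi>) \<in> M}" for p
  have "local_system scale W"
  proof unfold_locales
    show "\<And>\<phi> p. \<phi> \<in> W p \<Longrightarrow> field_op \<phi>" using M(1) unfolding mutually_local_def W_def by blast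
    show "\<And>\<phi> p \<psi> q. \<phi> \<in> W p \<Longrightarrow> \<psi> \<in> W q \<Longrightarrow> is_local (koszul_sign p q) \<phi> \<psi>"
      using M(1) unfolding mutually_local_def W_def by blast
    show "\<phi> \<in> W p" if f: "field_op \<phi>" "is_local (koszul_sign p p) \<phi> \<phi>"
      and l: "\<And>q \<psi>. \<psi> \<in> W q \<Longrightarrow> is_local (koszul_sign p q) \<phi> \<psi>" for \<phi> p
    proof -
      have l2: "is_local (koszul_sign q p) \<psi> \<phi>" if "(q, \<psi>) \<in> M" for q \<psi>
      proof -
        have "field_op \<psi>" using M(1) that unfolding mutually_local_def by blast
        then show ?thesis
          using local_sym[OF f(1) _ koszul_sign_square l, of \<psi> q] that
          unfolding koszul_sign_commute[of q p] W_def by blast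
      qed
      have "mutually_local (insert (p, \<phi>) M)"
        using M(1) f l l2 unfolding mutually_local_def W_def by auto
      then have "insert (p, \<phi>) M = M" by (rule max) blast
      then show ?thesis unfolding W_def by blast
    qed
  qed
  then show thesis using M(2) by (intro that) (auto simp: W_def)
qed

end

context local_system
begin

lemma W_add:
  assumes "\<phi> \<in> W p" "\<psi> \<in> W p" shows "\<phi> + \<psi> \<in> W p"
proof (rule W_maximal)
  note f = W_field[OF assms(1)] W_field[OF assms(2)]
  show f': "field_op (\<phi> + \<psi>)" using f by (rule field_op_add)
  show l: "is_local (koszul_sign p q) (\<phi> + \<psi>) \<chi>" if "\<chi> \<in> W q" for q \<chi>
    using f W_field W_local assms that by (intro local_add) auto
  show "is_local (koszul_sign p p) (\<phi> + \<psi>) (\<phi> + \<psi>)"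
    using l[OF assms(1)] l[OF assms(2)] f f'
    by (intro local_add) (auto intro!: local_sym[OF _ _ koszul_sign_square])
qed

lemma W_scale:
  assumes "\<phi> \<in> W p" shows "(\<lambda>r v. c *s \<phi> r v) \<in> W p"
proof (rule W_maximal)
  note f = W_field[OF assms]
  show f': "field_op (\<lambda>r v. c *s \<phi> r v)" using f by (rule field_op_scale)
  show l: "is_local (koszul_sign p q) (\<lambda>r v. c *s \<phi> r v) \<chi>" if "\<chi> \<in> W q" for q \<chi>
    using f W_field W_local assms that by (intro local_scale) auto
  show "is_local (koszul_sign p p) (\<lambda>r v. c *s \<phi> r v) (\<lambda>r v. c *s \<phi> r v)"
    by (rule local_scale[OF f f']) (rule local_sym[OF f' f koszul_sign_square l[OF assms]])
qed

lemma W_zero: "0 \<in> W p"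
  by (rule W_maximal) (auto intro: field_op_0 local_zero W_field)

lemma W_idf: "idf \<in> W 0"
  by (rule W_maximal) (auto intro: field_idf local_idf W_field simp: koszul_sign_0)

text \<open>
  By Dong's lemma the product is local with each member, in particular with its two factors;
  hence, by the lemma again, also with itself.
\<close>
lemma W_fprod:
  assumes \<phi>: "\<phi> \<in> W p" and \<psi>: "\<psi> \<in> W q" shows "fprod (koszul_sign p q) n \<phi> \<psi> \<in> W (p + q)"
proof (rule W_maximal)
  note f = W_field[OF assms(1)] W_field[OF assms(2)]
  let ?\<theta> = "fprod (koszul_sign p q) n \<phi> \<psi>"
  show f': "field_op ?\<theta>" using f by (rule field_fprod)
  have D: "is_local (koszul_sign (p + q) r) ?\<theta> \<chi>"
    if "field_op \<chi>" "is_local (koszul_sign p r) \<phi> \<chi>" "is_local (koszul_sign q r) \<psi> \<chi>" for r \<chi>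
    unfolding koszul_sign_add by (rule dong_lemma[OF f that(1) f' that(2,3) W_local[OF \<phi> \<psi>]])
  show l: "is_local (koszul_sign (p + q) r) ?\<theta> \<chi>" if "\<chi> \<in> W r" for r \<chi>
    by (rule D) (use that \<phi> \<psi> W_field W_local in auto)
  show "is_local (koszul_sign (p + q) (p + q)) ?\<theta> ?\<theta>"
    using local_sym[OF f' f(1) koszul_sign_square l[OF \<phi>]]
        local_sym[OF f' f(2) koszul_sign_square l[OF \<psi>]]
    by (intro D f') (simp_all only: koszul_sign_commute[of _ "p + q"])
qed

text \<open>
  An element is a pair consisting of an even and an odd field, given as a function of the parity.
  The parity belongs to the element and not to the operators, so the space on which the fields act
  needs no grading. In each parity \<open>q\<close>, the product collects the two ways of writing \<open>q\<close> as a sum.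
\<close>
definition field_va :: "(bit \<Rightarrow> int \<Rightarrow> 'u \<Rightarrow> 'u) va" where
  "field_va = \<lparr>part = \<lambda>p. {a. a p \<in> W p \<and> (\<forall>q. q \<noteq> p \<longrightarrow> a q = 0)},
    nprod = \<lambda>n a b q. fprod (koszul_sign 0 q) n (a 0) (b q) + fprod (koszul_sign 1 (q + 1)) n
        (a 1) (b (q + 1)),
    vac = \<lambda>p. if p = 0 then idf else 0\<rparr>"

definition field_scale_op :: "'k \<Rightarrow> (bit \<Rightarrow> int \<Rightarrow> 'u \<Rightarrow> 'u) \<Rightarrow> bit \<Rightarrow> 'u modes" where
  "field_scale_op c a = (\<lambda>p r v. c *s a p r v)"

lemma part_field_va: "part field_va p = {a. a p \<in> W p \<and> (\<forall>q. q \<noteq> p \<longrightarrow> a q = 0)}"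
  and nprod_field_va: "nprod field_va n a b q = fprod (koszul_sign 0 q) n (a 0) (b q)
      + fprod (koszul_sign 1 (q + 1)) n (a 1) (b (q + 1))"
  and vac_field_va: "vac field_va p = (if p = 0 then idf else 0)"
  by (simp_all add: field_va_def)

lemma carrier_field_va: "va_carrier field_va = {a. \<forall>p. a p \<in> W p}"
proof (intro set_eqI iffI)
  fix a assume "a \<in> va_carrier field_va"
  then obtain x y where a: "a = x + y" "x 0 \<in> W 0" "y 1 \<in> W 1" "x 1 = 0" "y 0 = 0"
    unfolding va_carrier_def part_field_va by (auto; metis bit_not_zero_iff)
  have "a p \<in> W p" for p
    by (cases p) (simp_all add: a)
  then show "a \<in> {a. \<forall>p. a p \<in> W p}" by blast
next
  fix a assume a: "a \<in> {a. \<forall>p. a p \<in> W p}"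
  have "a = (\<lambda>p. if p = 0 then a p else 0) + (\<lambda>p. if p = 1 then a p else 0)" by (intro ext) simp
  moreover have "(\<lambda>p. if p = 0 then a p else 0) \<in> part field_va 0"
      "(\<lambda>p. if p = 1 then a p else 0) \<in> part field_va 1"
    using a by (simp_all add: part_field_va)
  ultimately show "a \<in> va_carrier field_va" unfolding va_carrier_def by blast
qed

lemma nprod_homogeneous:
  assumes a: "a \<in> part field_va p" and b: "b \<in> va_carrier field_va"
  shows "nprod field_va n a b q = fprod (koszul_sign p (q + p)) n (a p) (b (q + p))"
proof -
  have f: "field_op (b q)" for q using b W_field unfolding carrier_field_va by blast
  show ?thesis
  proof (cases "p = 0")
    case True
    then have "a 1 = 0" using a by (simp add: part_field_va)
    then show ?thesis using True by (simp add: nprod_field_va fprod_0_left[OF f])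
  next
    case False
    then have "p = 1" "a 0 = 0" using a by (simp_all add: part_field_va)
    then show ?thesis by (simp add: nprod_field_va fprod_0_left[OF f])
  qed
qed

lemma nprod_in_carrier:
  assumes "a \<in> va_carrier field_va" "b \<in> va_carrier field_va"
  shows "nprod field_va n a b \<in> va_carrier field_va"
proof -
  have ab: "a p \<in> W p" "b p \<in> W p" for p using assms by (simp_all add: carrier_field_va)
  have "fprod (koszul_sign p (p + q)) n (a p) (b (p + q)) \<in> W q" for p q
    using W_fprod[OF ab(1)[of p] ab(2)[of "p + q"], of n] by (simp only: bit_add_self)
  note W_add[OF this[of 0] this[of 1]]
  then show ?thesis
    unfolding carrier_field_va mem_Collect_eq nprod_field_va
        by (simp only: add_0 add.commute[of 1]) blast
qed

lemma D_field_va: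
  assumes "a \<in> va_carrier field_va"
  shows "va_D field_va a = (\<lambda>p. fderiv (a p))"
proof -
  have f: "field_op (a q)" for q using assms W_field unfolding carrier_field_va by blast
  have "va_D field_va a p r v = fderiv (a p) r v" for p r v
    unfolding va_D_def nprod_field_va vac_field_va
    by (cases p) (simp_all add: fprod_0_right[OF f] koszul_sign_def fprod_idf_right_minus2[OF f])
  then show ?thesis by (intro ext)
qed

lemma fprod_eventually_0:
  assumes "a \<in> va_carrier field_va" "b \<in> va_carrier field_va"
  shows "\<exists>n0. \<forall>n\<ge>n0. fprod (koszul_sign p q) n (a p) (b q) = 0"
proof -
  have ab: "a p \<in> W p" "b q \<in> W q" using assms by (simp_all add: carrier_field_va)
  obtain k where k: "\<And>v. bracket (koszul_sign p q) (int k) (a p) (b q) v = 0"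
    using W_local[OF ab] unfolding is_local_def by blast
  have "fprod (koszul_sign p q) n (a p) (b q) = 0" if "int k \<le> n" for n
    using local_mono[OF W_field[OF ab(1)] W_field[OF ab(2)] k that]
    by (intro ext) (simp add: fprod_def)
  then show ?thesis by blast
qed

lemma char0_space_field_scale_op: "char0_space field_scale_op"
  unfolding char0_space_def
  by unfold_locales (simp_all add: field_scale_op_def fun_eq_iff scale_right_distrib
      scale_left_distrib)

lemma part_in_carrier: "a \<in> part field_va p \<Longrightarrow> a \<in> va_carrier field_va"
  using W_zero unfolding carrier_field_va part_field_va by (auto; metis)

lemma component_field: "a \<in> va_carrier field_va \<Longrightarrow> field_op (a p)"
  using W_field unfolding carrier_field_va by blast

text \<open>
  Each parity component of the locality identity is an instance of \<open>fprod_local\<close>, in which the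
  scalars \<open>e1\<close> and \<open>e2\<close> are the Koszul signs against the third field.
\<close>
lemma locality_field_va:
  assumes a: "a \<in> part field_va p" and b: "b \<in> part field_va q"
  shows "\<exists>M. local_at field_scale_op field_va p q a b M"
proof -
  interpret T: char0_space field_scale_op by (rule char0_space_field_scale_op)
  note WC = part_in_carrier and f = component_field
  note aC = WC[OF a] and bC = WC[OF b]
  obtain k where k: "\<And>v. bracket (koszul_sign p q) (int k) (a p) (b q) v = 0"
    using W_local[of "a p" p "b q" q] a b unfolding is_local_def part_field_va by blast
  have "local_at field_scale_op field_va p q a b (int k)"
    unfolding local_at_def
  proof (intro ballI allI)
    fix c r s assume c: "c \<in> va_carrier field_va"
    define F where "F = (\<lambda>r s. nprod field_va (- r - 1) a (nprod field_va (- s - 1) b c))"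
    define F' where "F' = (\<lambda>r s. nprod field_va (- s - 1) b (nprod field_va (- r - 1) a c))"
    have z: "nprod field_va n x 0 = 0" if "x \<in> va_carrier field_va" for n x
      by (intro ext) (simp add: nprod_field_va fprod_0_right[OF f[OF that]])
    have tr: "\<exists>s0. \<forall>s<s0. nprod field_va (- s - 1) x c = 0" if x: "x \<in> part field_va p'" for x p'
    proof -
      have "\<exists>n0. \<forall>n\<ge>n0. nprod field_va n x c p = 0" for p
        unfolding nprod_homogeneous[OF x c] by (rule fprod_eventually_0[OF WC[OF x] c])
      then obtain n0 n1 where "\<forall>n\<ge>n0. nprod field_va n x c 0 = 0"
          "\<forall>n\<ge>n1. nprod field_va n x c 1 = 0"
        by blast
      then have "nprod field_va n x c p = 0" if "n \<ge> max n0 n1" for n p using that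
          by (cases p) simp_all
      then have "nprod field_va n x c = 0" if "n \<ge> max n0 n1" for n using that by (intro ext) simp
      moreover have "max n0 n1 \<le> - s - 1" if "s < - max n0 n1" for s using that by linarith
      ultimately show ?thesis by blast
    qed
    have lb: "lower_bounded F" using tr[OF b] unfolding F_def
      by (metis (no_types, lifting) lower_boundedI z[OF aC])
    have lb': "lower_bounded (\<lambda>r s. F' s r)" using tr[OF a] unfolding F'_def
      by (metis (no_types, lifting) lower_boundedI z[OF bC])
    have bc: "nprod field_va n b c \<in> va_carrier field_va"
        "nprod field_va n a c \<in> va_carrier field_va" for n
      using nprod_in_carrier aC bC c by blast+
    have comp: "(mul_diff ^^ k) G r s \<rho> t v = (mul_diff ^^ k) (\<lambda>r s. G r s \<rho> t v) r s"
      for G :: "int \<Rightarrow> int \<Rightarrow> bit \<Rightarrow> 'u modes" and \<rho> t v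
      using mul_diff_pow_hom[of "\<lambda>x. x \<rho> t v" k G] by simp
    have "(mul_diff ^^ k) F r s = field_scale_op (koszul_sign p q) ((mul_diff ^^ k) F' r s)"
    proof (intro ext)
      fix \<rho> t v
      define \<sigma> where "\<sigma> = (\<rho> + p) + q"
      have \<sigma>': "(\<rho> + q) + p = \<sigma>" and q\<sigma>: "\<rho> + p = q + \<sigma>" and p\<sigma>: "\<rho> + q = p + \<sigma>"
        unfolding \<sigma>_def by (cases \<rho>; cases p; cases q; simp)+
      have 1: "F r s \<rho> t v = fprod (koszul_sign p q * koszul_sign p \<sigma>) (- r - 1) (a p)
         (fprod (koszul_sign q \<sigma>) (- s - 1) (b q) (c \<sigma>)) t v" for r s
        unfolding F_def nprod_homogeneous[OF a bc(1)] nprod_homogeneous[OF b c]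
        unfolding \<sigma>_def[symmetric] unfolding q\<sigma> koszul_sign_commute[of p "q + \<sigma>"] koszul_sign_add
        by (simp only: koszul_sign_commute[of _ p])
      have 2: "F' r s \<rho> t v = fprod (koszul_sign p q * koszul_sign q \<sigma>) (- s - 1) (b q)
         (fprod (koszul_sign p \<sigma>) (- r - 1) (a p) (c \<sigma>)) t v" for r s
        unfolding F'_def nprod_homogeneous[OF b bc(2)] nprod_homogeneous[OF a c]
        unfolding \<sigma>' unfolding p\<sigma> koszul_sign_commute[of q "p + \<sigma>"] koszul_sign_add
        by (simp only: koszul_sign_commute[of _ q])
      show "(mul_diff ^^ k) F r s \<rho> t v
          = field_scale_op (koszul_sign p q) ((mul_diff ^^ k) F' r s) \<rho> t v"
        unfolding field_scale_op_def comp 1 2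
        unfolding fprod_local[OF f[OF aC] f[OF bC] f[OF c] k koszul_sign_square] ..
    qed
    then show "Sum_any (\<lambda>(i, j). field_scale_op (iota_wz (int k) i j)
        (Y_coeff field_va a (r - i) (Y_coeff field_va b (s - j) c))) =
      field_scale_op (koszul_sign p q)
          (Sum_any (\<lambda>(i, j). field_scale_op (iota_zw (int k) i j)
          (Y_coeff field_va b (s - j) (Y_coeff field_va a (r - i) c))))"
      using T.expand_wz_iota[of "int k" F r s, unfolded T.expand_wz_nat[OF lb]]
        T.expand_zw_iota[OF lb', of "int k" r s, unfolded T.expand_zw_nat[OF lb']]
      unfolding F_def F'_def Y_coeff_def by (simp only:)
  qed
  then show ?thesis by blast
qed

theorem vertex_algebra_field_va: "vertex_algebra field_scale_op field_va"
proof -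
  interpret T: char0_space field_scale_op by (rule char0_space_field_scale_op)
  note C = carrier_field_va and WC = part_in_carrier and f = component_field
  have Dleft: "nprod field_va n (va_D field_va a) b
      = field_scale_op (- of_int n) (nprod field_va (n - 1) a b)"
    if a: "a \<in> va_carrier field_va" and b: "b \<in> va_carrier field_va" for a b n
    unfolding D_field_va[OF a]
    by (intro ext) (simp add: nprod_field_va field_scale_op_def
        fprod_fderiv_left[OF f[OF a] f[OF b]] algebra_simps)
  have DC: "va_D field_va a \<in> va_carrier field_va" if "a \<in> va_carrier field_va" for a
    unfolding va_D_def using that W_idf W_zero
    by (intro nprod_in_carrier) (auto simp: C vac_field_va)
  have right1: "nprod field_va (-1) a (vac field_va) = a" if a: "a \<in> va_carrier field_va" for a
  proof (intro ext)
    fix p r v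
    show "nprod field_va (-1) a (vac field_va) p r v = a p r v"
      unfolding nprod_field_va vac_field_va
      by (cases p) (simp_all add: fprod_0_right[OF f[OF a]] koszul_sign_def
          fprod_idf_right_minus1[OF f[OF a]])
  qed
  have vacC: "vac field_va \<in> va_carrier field_va" using W_idf W_zero by (auto simp: C vac_field_va)
  \<comment> \<open>As \<open>D\<close> lowers the index of its left factor by one, \<open>a\<^sub>n\<close> on the vacuum follows from the case \<open>n = - 1\<close>.\<close>
  have rightneg: "nprod field_va (- int k - 1) a (vac field_va)
      = va_Ddiv field_scale_op field_va k a"
    if "a \<in> va_carrier field_va" for a k
    using that
  proof (induction k arbitrary: a)
    case 0
    then show ?case using right1 by (simp add: va_Ddiv_def)
  next
    case (Suc k)
    have "field_scale_op (of_nat (Suc k)) (nprod field_va (- int (Suc k) - 1) a (vac field_va))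
      = nprod field_va (- int k - 1) (va_D field_va a) (vac field_va)"
      using Dleft[OF Suc.prems vacC, of "- int k - 1"] by (simp add: algebra_simps)
    also have "\<dots> = field_scale_op (1 / fact k) ((va_D field_va ^^ Suc k) a)"
      using Suc.IH[OF DC[OF Suc.prems]] by (simp add: va_Ddiv_def funpow_swap1)
    finally have "field_scale_op (1 / of_nat (Suc k))
        (field_scale_op (of_nat (Suc k)) (nprod field_va (- int (Suc k) - 1) a (vac field_va)))
      = field_scale_op (1 / of_nat (Suc k))
          (field_scale_op (1 / fact k) ((va_D field_va ^^ Suc k) a))"
      by (rule arg_cong)
    then show ?case by (simp add: va_Ddiv_def del: of_nat_Suc funpow.simps)
  qed
  show ?thesis
  proof (unfold_locales, goal_cases)
    case (1 p)
    show ?case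
      by (rule T.subspaceI) (auto simp: part_field_va W_zero W_add W_scale field_scale_op_def
          zero_fun_def[symmetric])
  next
    case 2
    have "a = 0" if "a \<in> part field_va 0 \<inter> part field_va 1" for a
    proof
      fix p show "a p = 0 p" using that by (cases p) (simp_all add: part_field_va)
    qed
    moreover have "0 \<in> part field_va p" for p by (simp add: part_field_va W_zero)
    ultimately show ?case by blast
  next
    case (3 a p b q n)
    show ?case
      unfolding part_field_va mem_Collect_eq nprod_homogeneous[OF 3(1) WC[OF 3(2)]]
    proof (intro conjI allI impI)
      have "p + q + p = q" by (cases p; cases q; simp)
      then show "fprod (koszul_sign p (p + q + p)) n (a p) (b (p + q + p)) \<in> W (p + q)"
        using 3 by (simp only:) (rule W_fprod; simp add: part_field_va)
      fix \<rho> assume "\<rho> \<noteq> p + q"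
      then have "\<rho> + p \<noteq> q" by (cases p; cases q; cases \<rho>; simp)
      then have "b (\<rho> + p) = 0" using 3(2) unfolding part_field_va by blast
      then show "fprod (koszul_sign p (\<rho> + p)) n (a p) (b (\<rho> + p)) = 0"
        using fprod_0_right[OF f[OF WC[OF 3(1)]]] by simp
    qed
  next
    case (4 a a' b n)
    then show ?case
      by (intro ext) (simp add: nprod_field_va fprod_add_left f algebra_simps)
  next
    case (5 a b b' n)
    then show ?case
      by (intro ext) (simp add: nprod_field_va fprod_add_right f algebra_simps)
  next
    case (6 a b n r)
    then show ?case
      by (intro ext) (simp add: nprod_field_va field_scale_op_def fprod_scale_left f
          scale_right_distrib)
  next
    case (7 a b n r)
    then show ?case
      by (intro ext) (simp add: nprod_field_va field_scale_op_def fprod_scale_right f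
          scale_right_distrib)
  next
    case 8
    show ?case by (simp add: part_field_va vac_field_va W_idf)
  next
    case (9 a b)
    have "\<exists>n0. \<forall>n\<ge>n0. nprod field_va n a b p = 0" for p
    proof -
      obtain n0 n1 where "\<forall>n\<ge>n0. fprod (koszul_sign 0 p) n (a 0) (b p) = 0"
        "\<forall>n\<ge>n1. fprod (koszul_sign 1 (p + 1)) n (a 1) (b (p + 1)) = 0"
        using fprod_eventually_0[OF 9] by meson
      then show ?thesis by (intro exI[of _ "max n0 n1"]) (simp add: nprod_field_va)
    qed
    then obtain n0 n1 where "\<forall>n\<ge>n0. nprod field_va n a b 0 = 0" "\<forall>n\<ge>n1. nprod field_va n a b 1 = 0"
      by blast
    then have "nprod field_va n a b p = 0" if "n \<ge> max n0 n1" for n p using that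
        by (cases p) simp_all
    then have "nprod field_va n a b = 0" if "n \<ge> max n0 n1" for n using that by (intro ext) simp
    then show ?case by blast
  next
    case (10 a n)
    then show ?case
      by (intro ext) (simp add: nprod_field_va vac_field_va koszul_sign_0 fprod_idf_left
          fprod_0_left f)
  next
    case (11 a n)
    have "fprod 1 n \<phi> idf = 0" if "field_op \<phi>" for \<phi>
      using fprod_idf_right_nat[OF that, of "nat n"] 11(2) by (intro ext) simp
    then have "nprod field_va n a (vac field_va) p = 0" for p
      using 11 by (cases p) (simp_all add: nprod_field_va vac_field_va koszul_sign_def
          fprod_0_right f)
    then show ?case by (intro ext) simp
  next
    case (12 a n)
    then show ?case using rightneg[of a "nat (- n - 1)"] by simp
  next
    case (13 a b n)
    then show ?case by (rule Dleft)
  next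
    case (14 a b n)
    have D: "va_D field_va (nprod field_va n a b) = (\<lambda>p. fderiv (nprod field_va n a b p))"
      by (rule D_field_va[OF nprod_in_carrier[OF 14]])
    have fa: "fderiv (\<phi> + \<psi>) r v = fderiv \<phi> r v + fderiv \<psi> r v" for \<phi> \<psi> r v
      by (simp add: fderiv_def scale_right_distrib)
    show ?case unfolding D unfolding D_field_va[OF 14(2)]
      by (intro ext) (simp add: nprod_field_va field_scale_op_def fprod_fderiv_right f[OF 14(1)]
          f[OF 14(2)] fa
          scale_right_distrib add.assoc add.left_commute)
  next
    case (15 a p b q)
    then show ?case by (rule locality_field_va)
  qed
qed

end

section \<open>Fields evaluating Laurent polynomials\<close>

context char0_space
begin

text \<open>
  On a vector \<open>v\<close> for which \<open>\<phi>(z) v\<close> and \<open>\<psi>(z) v\<close> contain no negative powers of \<open>z\<close>, products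
  behave as on the vacuum: the state-field correspondence turns products of fields into modes
  applied to states.
\<close>
lemma fprod_vacuum_like:
  assumes \<phi>: "field_op \<phi>" and \<psi>: "field_op \<psi>"
    and \<phi>0: "\<And>r. r < 0 \<Longrightarrow> \<phi> r v = 0" and \<psi>0: "\<And>r. r < 0 \<Longrightarrow> \<psi> r v = 0"
  shows "r < 0 \<Longrightarrow> fprod e n \<phi> \<psi> r v = 0" and "fprod e n \<phi> \<psi> 0 v = \<phi> (- n - 1) (\<psi> 0 v)"
proof -
  have 1: "vanishes_below 0 (\<lambda>s r. \<psi> s (\<phi> r v))" using \<phi>0
      by (simp add: vanishes_below_def field_0[OF \<psi>])
  have R: "rmult \<phi> n \<psi> t v = 0" for t
    using vanishes_belowD[OF vanishes_below_expand_wz[OF 1]] by (simp add: rmult_def expand_zw_def)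
  have 2: "vanishes_below 0 (\<lambda>r s. \<phi> r (\<psi> s v))" using \<psi>0
      by (simp add: vanishes_below_def field_0[OF \<phi>])
  show "r < 0 \<Longrightarrow> fprod e n \<phi> \<psi> r v = 0"
    using vanishes_belowD[OF vanishes_below_expand_wz[OF 2]] by (simp add: fprod_eq R lmult_def)
  show "fprod e n \<phi> \<psi> 0 v = \<phi> (- n - 1) (\<psi> 0 v)"
    using expand_wz_lowest[OF 2, of n "- 1"] minus_diff_commute[of 1 n]
    by (simp only: fprod_eq R lmult_def scale_zero_right diff_zero)
qed

lemma bracket_scale:
  assumes "field_op \<phi>" "field_op \<psi>"
  shows "bracket e n \<phi> \<psi> (c *s x) r s = c *s bracket e n \<phi> \<psi> x r s"
proof -
  note lb = lower_bounded_comp[OF assms, of "\<lambda>r. r"] lower_bounded_comp[OF assms(2,1), of "\<lambda>r. r"]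
  show ?thesis
    unfolding bracket_def expand_zw_def field_scale[OF assms(1)] field_scale[OF assms(2)]
      expand_wz_scale[OF lb(1)] expand_wz_scale[OF lb(2)]
    by (simp add: algebra_simps)
qed

lemma expand_zw_expand_zw:
  assumes "lower_bounded (\<lambda>r s. F s r)"
  shows "expand_zw m (expand_zw n F) = expand_zw (m + n) F"
proof (intro ext)
  fix r s
  have "(\<lambda>r s. expand_zw n F s r) = (\<lambda>r s. (-1) powi n *s expand_wz n (\<lambda>r s. F s r) r s)"
    unfolding expand_zw_def ..
  then show "expand_zw m (expand_zw n F) r s = expand_zw (m + n) F r s"
    unfolding expand_zw_def[of m] expand_zw_def[of "m + n"]
    by (simp only: expand_wz_scale[OF lower_bounded_expand_wz[OF assms]]
        expand_wz_expand_wz[OF assms])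
      (simp add: power_int_add)
qed

lemma fprod_sum_left:
  assumes "field_op \<psi>" "\<And>i. i \<in> I \<Longrightarrow> field_op (\<phi> i)" "finite I"
  shows "field_op (sum \<phi> I) \<and> fprod e n (sum \<phi> I) \<psi> = (\<Sum>i\<in>I. fprod e n (\<phi> i) \<psi>)"
  using assms(3,2)
proof (induction I rule: finite_induct)
  case (insert x I)
  have fx: "field_op (\<phi> x)" and fI: "field_op (sum \<phi> I)"
    and IH: "fprod e n (sum \<phi> I) \<psi> = (\<Sum>i\<in>I. fprod e n (\<phi> i) \<psi>)"
    using insert by auto
  show ?case
    unfolding sum.insert[OF insert.hyps] fprod_add_left[OF assms(1) fx fI] IH
    using field_op_add[OF fx fI] by (rule conjI) (rule refl)
qed (simp add: field_op_0 fprod_0_left assms(1))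

lemma fprod_sum_right:
  assumes "field_op \<phi>" "\<And>i. i \<in> I \<Longrightarrow> field_op (\<psi> i)" "finite I"
  shows "fprod e n \<phi> (sum \<psi> I) = (\<Sum>i\<in>I. fprod e n \<phi> (\<psi> i))"
  using assms(3,2)
proof (induction I rule: finite_induct)
  case (insert x I)
  have fx: "field_op (\<psi> x)" and IH: "fprod e n \<phi> (sum \<psi> I) = (\<Sum>i\<in>I. fprod e n \<phi> (\<psi> i))"
    using insert by auto
  have fI: "field_op (sum \<psi> I)" using fprod_sum_left[OF assms(1), of I \<psi>] insert by blast
  show ?case unfolding sum.insert[OF insert.hyps] fprod_add_right[OF assms(1) fx fI] IH ..
qed (simp add: fprod_0_right assms(1))

lemma local_sum_left:
  assumes "field_op \<psi>" "\<And>i. i \<in> I \<Longrightarrow> field_op (\<phi> i)" "\<And>i. i \<in> I \<Longrightarrow> is_local e (\<phi> i) \<psi>" "finite I"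
  shows "is_local e (sum \<phi> I) \<psi>"
  using assms(4,2,3)
proof (induction I rule: finite_induct)
  case (insert x I)
  then have "field_op (sum \<phi> I)" using fprod_sum_left[OF assms(1), of I \<phi>] by blast
  then show ?case
    using insert unfolding sum.insert[OF insert.hyps] by (intro local_add assms(1)) auto
qed (simp add: local_zero assms(1))

end

text \<open>
  A basis vector of the space on which the model acts is a Laurent monomial in \<open>z\<^sub>0, z\<^sub>1, z\<^sub>2\<close>.
  The entry \<open>Some x\<close> in slot \<open>i\<close> stands for \<open>z\<^sub>i^x\<close>, and \<open>None\<close> says that the variable \<open>z\<^sub>i\<close> has
  been used up.
\<close>
type_synonym slots = "nat \<Rightarrow> int option"

definition linear_extension :: "('a \<Rightarrow> ('a \<Rightarrow>\<^sub>0 'k::field_char_0)) \<Rightarrow> ('a \<Rightarrow>\<^sub>0 'k) \<Rightarrow> ('a \<Rightarrow>\<^sub>0 'k)" where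
  "linear_extension f v = (\<Sum>\<alpha>\<in>Poly_Mapping.keys v. pm_scale (Poly_Mapping.lookup v \<alpha>) (f \<alpha>))"

lemma pm_scale_0 [simp]: "pm_scale 0 v = 0" and pm_scale_1 [simp]: "pm_scale 1 v = v"
  and pm_scale_0_right [simp]: "pm_scale c 0 = 0"
  and pm_scale_scale [simp]: "pm_scale c (pm_scale d v) = pm_scale (c * d) v"
  by (rule poly_mapping_eqI; simp)+

lemma pm_scale_add: "pm_scale c (u + v) = pm_scale c u + pm_scale c v"
  and pm_scale_add_left: "pm_scale (c + d) v = pm_scale c v + pm_scale d v"
  by (rule poly_mapping_eqI; simp add: lookup_add algebra_simps)+

lemma pm_scale_sum: "pm_scale c (sum f A) = (\<Sum>x\<in>A. pm_scale c (f x))"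
  by (induction A rule: infinite_finite_induct) (simp_all add: pm_scale_add)

lemma linear_extension_superset:
  assumes "finite A" "Poly_Mapping.keys v \<subseteq> A"
  shows "linear_extension f v = (\<Sum>\<alpha>\<in>A. pm_scale (Poly_Mapping.lookup v \<alpha>) (f \<alpha>))"
  unfolding linear_extension_def
  by (rule sum.mono_neutral_left) (use assms in \<open>auto simp: in_keys_iff\<close>)

lemma linear_extension_add:
  "linear_extension f (u + v) = linear_extension f u + linear_extension f v"
proof -
  let ?A = "Poly_Mapping.keys u \<union> Poly_Mapping.keys v"
  have "Poly_Mapping.keys (u + v) \<subseteq> ?A" by (rule Poly_Mapping.keys_add)
  then show ?thesis
    using linear_extension_superset[of ?A u f] linear_extension_superset[of ?A v f]
      linear_extension_superset[of ?A "u + v" f]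
    by (simp add: lookup_add pm_scale_add_left sum.distrib)
qed

lemma linear_extension_scale:
  "linear_extension f (pm_scale c v) = pm_scale c (linear_extension f v)"
proof -
  have "Poly_Mapping.keys (pm_scale c v) \<subseteq> Poly_Mapping.keys v" by (auto simp: in_keys_iff)
  then show ?thesis
    using linear_extension_superset[of "Poly_Mapping.keys v" "pm_scale c v" f]
    by (simp add: linear_extension_def pm_scale_sum)
qed

lemma linear_extension_single:
  "linear_extension f (Poly_Mapping.single \<alpha> c) = pm_scale c (f \<alpha>)"
  using linear_extension_superset[of "{\<alpha>}" "Poly_Mapping.single \<alpha> c" f] by simp

lemma poly_mapping_span_induct:
  fixes v :: "'a \<Rightarrow>\<^sub>0 'k::field_char_0"
  assumes "P 0" "\<And>u v. P u \<Longrightarrow> P v \<Longrightarrow> P (u + v)" "\<And>c \<alpha>. P (pm_scale c (Poly_Mapping.single \<alpha> 1))"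
  shows "P v"
proof -
  have "v = (\<Sum>\<alpha>\<in>Poly_Mapping.keys v. pm_scale (Poly_Mapping.lookup v \<alpha>) (Poly_Mapping.single \<alpha> 1))"
  proof (rule poly_mapping_eqI)
    fix \<beta>
    have "Poly_Mapping.lookup (\<Sum>\<alpha>\<in>Poly_Mapping.keys v. pm_scale (Poly_Mapping.lookup v \<alpha>)
        (Poly_Mapping.single \<alpha> 1)) \<beta>
      = (\<Sum>\<alpha>\<in>Poly_Mapping.keys v. if \<alpha> = \<beta> then Poly_Mapping.lookup v \<alpha> else 0)"
      unfolding lookup_sum by (rule sum.cong) (auto simp: lookup_single when_def)
    then show "Poly_Mapping.lookup v \<beta>
        = Poly_Mapping.lookup (\<Sum>\<alpha>\<in>Poly_Mapping.keys v. pm_scale (Poly_Mapping.lookup v \<alpha>)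
        (Poly_Mapping.single \<alpha> 1)) \<beta>"
      by (simp add: in_keys_iff)
  qed
  moreover have "P (\<Sum>\<alpha>\<in>A. pm_scale (Poly_Mapping.lookup v \<alpha>) (Poly_Mapping.single \<alpha> 1))"
      if "finite A" for A
    using that by (induction A rule: finite_induct) (simp_all add: assms)
  ultimately show ?thesis using finite_keys by metis
qed

definition permutes3 :: "nat \<Rightarrow> nat \<Rightarrow> nat \<Rightarrow> bool" where
  "permutes3 i j k \<longleftrightarrow> i < 3 \<and> j < 3 \<and> k < 3 \<and> i \<noteq> j \<and> i \<noteq> k \<and> j \<noteq> k"

lemma less3: "(i::nat) < 3 \<longleftrightarrow> i = 0 \<or> i = 1 \<or> i = 2"
  by linarith

lemma permutes3_exists: "i < 3 \<Longrightarrow> j < 3 \<Longrightarrow> i \<noteq> j \<Longrightarrow> \<exists>k. permutes3 i j k"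
  by (intro exI[of _ "3 - i - j"]) (unfold permutes3_def, presburger)

text \<open>
  \<open>M i j\<close> is the order of locality of the fields of the slots \<open>i\<close> and \<open>j\<close>, and \<open>\<kappa> i j\<close> a sign
  which occurs when slot \<open>i\<close> is evaluated while slot \<open>j\<close> is still present.
\<close>
locale slot_fields =
  fixes M :: "nat \<Rightarrow> nat \<Rightarrow> int" and \<kappa> :: "nat \<Rightarrow> nat \<Rightarrow> 'k::field_char_0"
begin

sublocale char0_space "pm_scale :: 'k \<Rightarrow> (slots \<Rightarrow>\<^sub>0 'k) \<Rightarrow> slots \<Rightarrow>\<^sub>0 'k"
  unfolding char0_space_def by (rule vector_space_pm_scale)

text \<open>
  Multiplication of \<open>z\<^sub>j^y\<close> by \<open>\<kappa> i j (z\<^sub>j - z)^(-M i j)\<close>, expanded in nonnegative powers of \<open>z\<close>,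
  gives at \<open>z^l\<close> the coefficient \<open>weight\<close> times the monomial described by \<open>shift\<close>. A used slot
  contributes the factor 1.
\<close>
definition weight :: "nat \<Rightarrow> nat \<Rightarrow> nat \<Rightarrow> int option \<Rightarrow> 'k" where
  "weight i j l a = (case a of None \<Rightarrow> if l = 0 then 1 else 0 | Some _ \<Rightarrow> \<kappa> i j * coef (- M i j) l)"

definition shift :: "nat \<Rightarrow> nat \<Rightarrow> nat \<Rightarrow> int option \<Rightarrow> int option" where
  "shift i j l a = map_option (\<lambda>y. y - M i j - int l) a"

definition basis :: "slots \<Rightarrow> slots \<Rightarrow>\<^sub>0 'k" where
  "basis \<alpha> = Poly_Mapping.single \<alpha> 1"

text \<open>
  The coefficient of \<open>z^m\<close> in the image of a monomial: \<open>z\<^sub>i\<close> is set to \<open>z\<close>, and the factors for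
  the other two slots \<open>j\<close> and \<open>k\<close> contribute the powers \<open>l\<close> and \<open>m - x - l\<close> of \<open>z\<close>.
\<close>
definition slot_op :: "nat \<Rightarrow> nat \<Rightarrow> nat \<Rightarrow> int \<Rightarrow> slots \<Rightarrow> slots \<Rightarrow>\<^sub>0 'k" where
  "slot_op i j k m \<alpha> = (case \<alpha> i of None \<Rightarrow> 0 | Some x \<Rightarrow> if m < x then 0 else
     (\<Sum>l\<le>nat (m - x). pm_scale (weight i j l (\<alpha> j) * weight i k (nat (m - x) - l) (\<alpha> k))
        (basis (\<alpha>(i := None, j := shift i j l (\<alpha> j), k := shift i k (nat (m - x) - l) (\<alpha> k))))))"

definition slot_field :: "nat \<Rightarrow> int \<Rightarrow> (slots \<Rightarrow>\<^sub>0 'k) \<Rightarrow> slots \<Rightarrow>\<^sub>0 'k" where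
  "slot_field i m = linear_extension (slot_op i ((i + 1) mod 3) ((i + 2) mod 3) m)"

lemma slot_op_swap:
  assumes "j \<noteq> k" shows "slot_op i j k m \<alpha> = slot_op i k j m \<alpha>"
proof (cases "\<alpha> i")
  case (Some x)
  define n where "n = nat (m - x)"
  define f where "f l l' = pm_scale (weight i j l (\<alpha> j) * weight i k l' (\<alpha> k))
        (basis (\<alpha>(i := None, j := shift i j l (\<alpha> j), k := shift i k l' (\<alpha> k))))" for l l'
  have "(\<Sum>l\<le>n. f l (n - l)) = (\<Sum>l\<le>n. f (n - l) l)"
    by (rule sum.reindex_bij_witness[of _ "\<lambda>l. n - l" "\<lambda>l. n - l"]) auto
  then show ?thesis
    using assms Some unfolding slot_op_def n_def[symmetric] f_def
    by (simp add: fun_upd_twist mult.commute n_def[symmetric])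
qed (simp add: slot_op_def)

lemma slot_field_basis:
  assumes "permutes3 i j k"
  shows "slot_field i m (basis \<alpha>) = slot_op i j k m \<alpha>"
proof -
  have "(j = (i + 1) mod 3 \<and> k = (i + 2) mod 3) \<or> (k = (i + 1) mod 3 \<and> j = (i + 2) mod 3)"
    using assms unfolding permutes3_def less3 by auto
  moreover have "j \<noteq> k" using assms by (simp add: permutes3_def)
  ultimately show ?thesis
    unfolding slot_field_def basis_def linear_extension_single
    using slot_op_swap[of j k] by auto
qed

lemma field_slot_field: "field_op (slot_field i)"
proof (rule field_opI)
  fix v :: "slots \<Rightarrow>\<^sub>0 'k"
  let ?f = "slot_op i ((i + 1) mod 3) ((i + 2) mod 3)"
  have "\<exists>r0. \<forall>\<alpha>\<in>A. \<forall>r<r0. ?f r \<alpha> = 0" if "finite A" for A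
    using that
  proof (induction A rule: finite_induct)
    case (insert \<alpha> A)
    then obtain r0 where "\<forall>\<alpha>\<in>A. \<forall>r<r0. ?f r \<alpha> = 0" by blast
    moreover have "\<exists>r1. \<forall>r<r1. ?f r \<alpha> = 0"
    proof (cases "\<alpha> i")
      case (Some x)
      then show ?thesis by (intro exI[of _ x]) (simp add: slot_op_def)
    qed (simp add: slot_op_def)
    then obtain r1 where "\<forall>r<r1. ?f r \<alpha> = 0" by blast
    ultimately show ?case by (intro exI[of _ "min r0 r1"]) auto
  qed simp
  then obtain r0 where "\<forall>\<alpha>\<in>Poly_Mapping.keys v. \<forall>r<r0. ?f r \<alpha> = 0" using finite_keys by metis
  then show "\<exists>r0. \<forall>r<r0. slot_field i r v = 0"
    unfolding slot_field_def linear_extension_def by (intro exI[of _ r0]) simp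
qed (simp_all add: slot_field_def linear_extension_add linear_extension_scale)

lemma bracket_basis:
  assumes "field_op \<phi>" "field_op \<psi>" "\<And>\<alpha>. bracket e n \<phi> \<psi> (basis \<alpha>) = 0"
  shows "bracket e n \<phi> \<psi> v = 0"
proof -
  have "\<forall>r s. bracket e n \<phi> \<psi> v r s = 0"
  proof (induction v rule: poly_mapping_span_induct)
    case 1
    have "bracket e n \<phi> \<psi> (0 + 0) r s = bracket e n \<phi> \<psi> 0 r s + bracket e n \<phi> \<psi> 0 r s" for r s
      by (rule bracket_add[OF assms(1,2)])
    then show ?case by simp
  next
    case (2 u v)
    then show ?case by (simp add: bracket_add[OF assms(1,2)])
  next
    case (3 c \<alpha>)
    then show ?case using assms(3) by (simp add: bracket_scale[OF assms(1,2)] basis_def)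
  qed
  then show ?thesis by (intro ext) simp
qed

lemma shift_None [simp]: "shift i j l a = None \<longleftrightarrow> a = None" "shift i j l None = None"
  by (simp_all add: shift_def)

lemma weight_shift [simp]: "weight i j l (shift i' j' l' a) = weight i j l a"
  by (cases a) (simp_all add: weight_def shift_def)

lemma shift_commute: "shift i j l (shift i' j' l' a) = shift i' j' l' (shift i j l a)"
  by (cases a) (simp_all add: shift_def)

definition removed :: "nat \<Rightarrow> (slots \<Rightarrow>\<^sub>0 'k) \<Rightarrow> bool" where
  "removed i v \<longleftrightarrow> (\<forall>\<alpha>. Poly_Mapping.lookup v \<alpha> \<noteq> 0 \<longrightarrow> \<alpha> i = None)"

lemma slot_field_removed:
  assumes "removed i v" shows "slot_field i m v = 0"
  unfolding slot_field_def linear_extension_def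
proof (intro sum.neutral ballI)
  fix \<alpha> assume "\<alpha> \<in> Poly_Mapping.keys v"
  then have "\<alpha> i = None" using assms by (simp add: removed_def in_keys_iff)
  then show "pm_scale (Poly_Mapping.lookup v \<alpha>) (slot_op i ((i + 1) mod 3) ((i + 2) mod 3) m \<alpha>) = 0"
    by (simp add: slot_op_def)
qed

lemma removed_basis: "\<alpha> i = None \<Longrightarrow> removed i (basis \<alpha>)"
  by (simp add: removed_def basis_def lookup_single when_def)

lemma removed_slot_field:
  assumes "i = j \<or> removed i v" "j < 3"
  shows "removed i (slot_field j m v)"
  unfolding removed_def
proof (intro allI impI)
  let ?j1 = "(j + 1) mod 3" and ?j2 = "(j + 2) mod 3"
  have j: "?j1 \<noteq> j" "?j2 \<noteq> j" using assms(2) by presburger+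
  fix \<beta> assume "Poly_Mapping.lookup (slot_field j m v) \<beta> \<noteq> 0"
  then have "(\<Sum>\<alpha>\<in>Poly_Mapping.keys v. Poly_Mapping.lookup v \<alpha> * Poly_Mapping.lookup
      (slot_op j ?j1 ?j2 m \<alpha>) \<beta>) \<noteq> 0"
    by (simp add: slot_field_def linear_extension_def lookup_sum)
  then obtain \<alpha> where \<alpha>: "\<alpha> \<in> Poly_Mapping.keys v"
      "Poly_Mapping.lookup (slot_op j ?j1 ?j2 m \<alpha>) \<beta> \<noteq> 0"
    by (metis (no_types, lifting) mult_zero_right sum.neutral)
  obtain x where x: "\<alpha> j = Some x" using \<alpha>(2) by (cases "\<alpha> j") (simp_all add: slot_op_def)
  define u where "u l = \<alpha>(j := None, ?j1 := shift j ?j1 l (\<alpha> ?j1), ?j2 := shift j ?j2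
      (nat (m - x) - l) (\<alpha> ?j2))" for l
  have "slot_op j ?j1 ?j2 m \<alpha> =
      (if m < x then 0 else (\<Sum>l\<le>nat (m - x). pm_scale
      (weight j ?j1 l (\<alpha> ?j1) * weight j ?j2 (nat (m - x) - l) (\<alpha> ?j2)) (basis (u l))))"
    unfolding slot_op_def x u_def option.case ..
  then have "(\<Sum>l\<le>nat (m - x). Poly_Mapping.lookup
      (pm_scale (weight j ?j1 l (\<alpha> ?j1) * weight j ?j2 (nat (m - x) - l) (\<alpha> ?j2)) (basis (u l)))
      \<beta>) \<noteq> 0"
    using \<alpha>(2) by (simp add: lookup_sum split: if_splits)
  then obtain l where "Poly_Mapping.lookup
      (pm_scale (weight j ?j1 l (\<alpha> ?j1) * weight j ?j2 (nat (m - x) - l) (\<alpha> ?j2)) (basis (u l)))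
      \<beta> \<noteq> 0"
    by (metis (no_types, lifting) sum.neutral)
  then have "\<beta> = u l" by (auto simp: basis_def lookup_single when_def split: if_splits)
  moreover have "u l i = None"
    using assms(1) \<alpha>(1) j unfolding u_def removed_def in_keys_iff by auto
  ultimately show "\<beta> i = None" by simp
qed

lemma slot_field_twice:
  assumes "\<alpha> i' = None \<or> i' = i" and "i < 3"
  shows "slot_field i' m (slot_field i m' (basis \<alpha>)) = 0"
  using assms by (intro slot_field_removed removed_slot_field) (auto intro: removed_basis)

lemma slot_field_remove_second:
  assumes ijk: "permutes3 i j k" and "\<alpha> i = Some x" "\<alpha> j = None"
  shows "slot_field i m (basis \<alpha>) = (if m < x then 0 else
    pm_scale (weight i k (nat (m - x)) (\<alpha> k))
        (basis (\<alpha>(i := None, k := shift i k (nat (m - x)) (\<alpha> k)))))"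
proof -
  have d: "i \<noteq> j" "i \<noteq> k" "j \<noteq> k" using ijk by (simp_all add: permutes3_def)
  have "slot_field i m (basis \<alpha>) = (if m < x then 0 else
    (\<Sum>l\<le>nat (m - x). if l = 0 then pm_scale (weight i k (nat (m - x)) (\<alpha> k))
        (basis (\<alpha>(i := None, k := shift i k (nat (m - x)) (\<alpha> k)))) else 0))"
  proof -
    have "\<alpha>(i := None, j := None, k := y) = \<alpha>(i := None, k := y)" for y
      using assms(3) d by (auto simp: fun_eq_iff)
    then have "pm_scale (weight i j l (\<alpha> j) * weight i k (nat (m - x) - l) (\<alpha> k))
        (basis (\<alpha>(i := None, j := shift i j l (\<alpha> j), k := shift i k (nat (m - x) - l) (\<alpha> k))))
      = (if l = 0 then pm_scale (weight i k (nat (m - x)) (\<alpha> k))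
          (basis (\<alpha>(i := None, k := shift i k (nat (m - x)) (\<alpha> k)))) else 0)" for l
      by (simp add: assms(3) weight_def[of i j])
    then show ?thesis
      unfolding slot_field_basis[OF ijk] slot_op_def assms(2) option.case by (simp only:)
  qed
  then show ?thesis by simp
qed

text \<open>
  The coefficient of \<open>w^r z^s\<close> after setting \<open>z\<^sub>i\<close> to \<open>w\<close> and \<open>z\<^sub>j\<close> to \<open>z\<close> and multiplying by the
  factors of both with \<open>z\<^sub>k\<close>, but without the mutual factor of the slots \<open>i\<close> and \<open>j\<close>.
\<close>
definition double_contraction :: "nat \<Rightarrow> nat \<Rightarrow> nat \<Rightarrow> int \<Rightarrow> int \<Rightarrow> slots \<Rightarrow> int \<Rightarrow> int \<Rightarrow> slots \<Rightarrow>\<^sub>0 'k"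
    where
  "double_contraction i j k x y \<alpha> r s = (if r < x \<or> s < y then 0 else
      pm_scale (weight i k (nat (r - x)) (\<alpha> k) * weight j k (nat (s - y)) (\<alpha> k))
       (basis (\<alpha>(i := None, j := None, k := shift i k (nat (r - x))
           (shift j k (nat (s - y)) (\<alpha> k))))))"

text \<open>
  Slot \<open>j\<close> is evaluated at \<open>z\<close> while \<open>z\<^sub>i\<close> is present, which gives the factor
  \<open>(z\<^sub>i - z)^(-M i j)\<close>; afterwards \<open>z\<^sub>i\<close> becomes \<open>w\<close>.
\<close>
lemma slot_field_slot_field:
  assumes ijk: "permutes3 i j k" and "\<alpha> i = Some x" "\<alpha> j = Some y" and sym: "M i j = M j i"
  defines "H \<equiv> double_contraction i j k x y \<alpha>"
  shows "slot_field i r (slot_field j s (basis \<alpha>)) = pm_scale (\<kappa> j i) (expand_wz (- M i j) H r s)"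
proof -
  have d: "i \<noteq> j" "i \<noteq> k" "j \<noteq> k" using ijk by (simp_all add: permutes3_def)
  have jik: "permutes3 j i k" using ijk by (auto simp: permutes3_def)
  have H: "vanishes_below y H" by (simp add: vanishes_below_def H_def double_contraction_def)
  show ?thesis
  proof (cases "s < y")
    case True
    then show ?thesis
      using vanishes_belowD[OF vanishes_below_expand_wz[OF H] True] assms(3)
      by (simp add: slot_field_basis[OF jik] slot_op_def field_0[OF field_slot_field])
  next
    case False
    define n where "n = nat (s - y)"
    define st where "st l = \<alpha>(j := None, i := shift j i l (\<alpha> i), k := shift j k (n - l) (\<alpha> k))"
        for l
    have 1: "slot_field i r (basis (st l)) = (if r < x - M j i - int l then 0 else
        pm_scale (weight i k (nat (r - (x - M j i - int l))) (\<alpha> k))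
          (basis (\<alpha>(i := None, j := None, k := shift i k (nat (r - (x - M j i - int l)))
              (shift j k (n - l) (\<alpha> k))))))" for l
    proof -
      have "st l i = Some (x - M j i - int l)" "st l j = None"
        using d assms(2) by (simp_all add: st_def shift_def)
      from slot_field_remove_second[OF ijk this, of r]
      have "slot_field i r (basis (st l)) = (if r < x - M j i - int l then 0 else
        pm_scale (weight i k (nat (r - (x - M j i - int l))) (st l k))
          (basis ((st l)(i := None, k := shift i k (nat (r - (x - M j i - int l))) (st l k)))))" .
      moreover have "st l k = shift j k (n - l) (\<alpha> k)" using d by (simp add: st_def)
      moreover have "(st l)(i := None, k := z) = \<alpha>(i := None, j := None, k := z)" for z
        using d by (auto simp: st_def fun_eq_iff)
      ultimately show ?thesis by simp
    qed
    have "slot_field j s (basis \<alpha>)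
        = (\<Sum>l\<le>n. pm_scale (\<kappa> j i * coef (- M j i) l * weight j k (n - l) (\<alpha> k)) (basis (st l)))"
      using False assms(2,3)
        by (simp add: slot_field_basis[OF jik] slot_op_def n_def st_def weight_def[of j i])
    then have "slot_field i r (slot_field j s (basis \<alpha>))
      = (\<Sum>l\<le>n. pm_scale (\<kappa> j i * coef (- M j i) l * weight j k (n - l) (\<alpha> k))
          (slot_field i r (basis (st l))))"
      by (simp add: field_sum[OF field_slot_field] field_scale[OF field_slot_field])
    also have "\<dots> = (\<Sum>l\<le>n. pm_scale (\<kappa> j i)
        (pm_scale (coef (- M i j) l) (H (r + M i j + int l) (s - int l))))"
    proof (rule sum.cong)
      fix l assume "l \<in> {..n}"
      then have nl: "nat (s - int l - y) = n - l" "\<not> s - int l < y" using False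
          by (auto simp: n_def)
      have eqs: "r + M i j + int l - x = r - (x - M j i - int l)"
          "r + M i j + int l < x \<longleftrightarrow> r < x - M j i - int l"
        using sym by auto
      show "pm_scale (\<kappa> j i * coef (- M j i) l * weight j k (n - l) (\<alpha> k))
          (slot_field i r (basis (st l)))
        = pm_scale (\<kappa> j i) (pm_scale (coef (- M i j) l) (H (r + M i j + int l) (s - int l)))"
        unfolding 1 H_def double_contraction_def nl(1) eqs using nl(2) sym by (simp add: ac_simps)
    qed simp
    also have "\<dots> = pm_scale (\<kappa> j i)
        (\<Sum>l<Suc n. pm_scale (coef (- M i j) l) (H (r - (- M i j) + int l) (s - int l)))"
      by (simp add: pm_scale_sum lessThan_Suc_atMost)
    also have "\<dots> = pm_scale (\<kappa> j i) (expand_wz (- M i j) H r s)"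
      using expand_wz_eq_sum[OF H, of s "Suc n" "- M i j" r] False by (simp add: coef_def n_def)
    finally show ?thesis .
  qed
qed

text \<open>
  Both orders are expansions of \<open>(w - z)^(-M i j)\<close> times the same distribution, up to the signs;
  the hypothesis on \<open>\<kappa>\<close> says that the signs agree.
\<close>
lemma slot_field_bracket:
  assumes ij: "i < 3" "j < 3" and sym: "M i j = M j i"
    and \<kappa>: "i \<noteq> j \<Longrightarrow> \<kappa> j i = e * (-1) powi (M i j) * \<kappa> i j"
  shows "bracket e (M i j) (slot_field i) (slot_field j) v = 0"
proof (rule bracket_basis[OF field_slot_field field_slot_field])
  fix \<alpha>
  show "bracket e (M i j) (slot_field i) (slot_field j) (basis \<alpha>) = 0"
  proof (cases "i = j \<or> \<alpha> i = None \<or> \<alpha> j = None")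
    case True
    have "slot_field i r (slot_field j s (basis \<alpha>)) = 0"
        "slot_field j s (slot_field i r (basis \<alpha>)) = 0" for r s
    proof -
      show "slot_field i r (slot_field j s (basis \<alpha>)) = 0"
      proof (cases "\<alpha> j = None")
        case False
        then show ?thesis using True ij by (intro slot_field_twice) auto
      qed (simp add: slot_field_removed removed_basis field_0[OF field_slot_field])
      show "slot_field j s (slot_field i r (basis \<alpha>)) = 0"
      proof (cases "\<alpha> i = None")
        case False
        then show ?thesis using True ij by (intro slot_field_twice) auto
      qed (simp add: slot_field_removed removed_basis field_0[OF field_slot_field])
    qed
    then show ?thesis by (intro ext) (simp add: bracket_def expand_zw_def expand_wz_zero)
  next
    case False
    then obtain x y where x: "\<alpha> i = Some x" and y: "\<alpha> j = Some y" by auto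
    obtain k where ijk: "permutes3 i j k" using permutes3_exists ij False by blast
    have jik: "permutes3 j i k" using ijk by (auto simp: permutes3_def)
    define H where "H = double_contraction i j k x y \<alpha>"
    have 1: "slot_field i r (slot_field j s (basis \<alpha>))
        = pm_scale (\<kappa> j i) (expand_wz (- M i j) H r s)" for r s
      unfolding H_def by (rule slot_field_slot_field[OF ijk x y sym])
    have flipH: "(\<lambda>s r. H r s) = double_contraction j i k y x \<alpha>"
      using False unfolding H_def double_contraction_def
      by (intro ext) (simp add: mult.commute shift_commute fun_upd_twist disj_commute)
    have lb: "lower_bounded H"
        by (rule lower_boundedI[of y]) (simp add: H_def double_contraction_def)
    have lb': "lower_bounded (\<lambda>s r. H r s)"
        by (rule lower_boundedI[of x]) (simp add: H_def double_contraction_def)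
    have "slot_field j s (slot_field i r (basis \<alpha>))
        = pm_scale (\<kappa> i j) (expand_wz (- M i j) (\<lambda>s r. H r s) s r)" for r s
      unfolding flipH using slot_field_slot_field[OF jik y x sym[symmetric], of s r] sym by simp
    then have 2: "slot_field j s (slot_field i r (basis \<alpha>))
        = pm_scale (\<kappa> i j * (-1) powi (M i j)) (expand_zw (- M i j) H r s)" for r s
    proof -
      have "(-1) powi (M i j) * (-1 :: 'k) powi (- M i j) = 1"
          by (simp add: power_int_add[symmetric])
      then show ?thesis
        using \<open>\<And>s r. slot_field j s (slot_field i r (basis \<alpha>)) = _ s r\<close>
        by (simp add: expand_zw_def mult.assoc)
    qed
    have A: "expand_wz (M i j) (\<lambda>r s. pm_scale (\<kappa> j i) (expand_wz (- M i j) H r s))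
        = (\<lambda>r s. pm_scale (\<kappa> j i) (H r s))"
      unfolding expand_wz_scale[OF lower_bounded_expand_wz[OF lb]] expand_wz_expand_wz[OF lb]
          by (simp add: expand_wz_0)
    have B: "expand_zw (M i j) (\<lambda>r s. pm_scale c (expand_zw (- M i j) H r s))
        = (\<lambda>r s. pm_scale c (H r s))" for c
    proof -
      have f: "lower_bounded (\<lambda>r s. expand_zw (- M i j) H s r)"
        by (rule lower_boundedI[of x])
          (use vanishes_belowD[OF vanishes_below_expand_wz, of x "\<lambda>s r. H r s"]
              in \<open>simp add: expand_zw_def vanishes_below_def H_def double_contraction_def\<close>)
      have "expand_zw (M i j) (\<lambda>r s. pm_scale c (expand_zw (- M i j) H r s))
          = (\<lambda>r s. pm_scale c (expand_zw (M i j) (expand_zw (- M i j) H) r s))"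
        unfolding expand_zw_def[of "M i j"] expand_wz_scale[OF f] by (simp add: mult.commute)
      also have "expand_zw (M i j) (expand_zw (- M i j) H) = H"
        unfolding expand_zw_expand_zw[OF lb'] using expand_zw_nat[OF lb', of 0] by simp
      finally show ?thesis .
    qed
    have "\<kappa> j i = e * (\<kappa> i j * (-1) powi (M i j))" using \<kappa> False
        by (simp add: mult.assoc mult.commute)
    then have "pm_scale (\<kappa> j i) h - pm_scale e (pm_scale (\<kappa> i j * (-1) powi (M i j)) h) = 0"
        for h :: "slots \<Rightarrow>\<^sub>0 'k"
      by simp
    then show ?thesis
      by (intro ext) (simp only: bracket_def 1 2 A B zero_fun_apply)
  qed
qed

end

context slot_fields
begin

lemma slot_field_vacuum:
  assumes "permutes3 i j k" "\<alpha> i = Some x" "\<alpha> j = Some y" "\<alpha> k = Some z"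
  shows "m < x \<Longrightarrow> slot_field i m (basis \<alpha>) = 0"
    and "slot_field i x (basis \<alpha>) = pm_scale (\<kappa> i j * \<kappa> i k)
      (basis (\<alpha>(i := None, j := Some (y - M i j), k := Some (z - M i k))))"
  unfolding slot_field_basis[OF assms(1)] slot_op_def
  by (simp_all add: assms weight_def shift_def coef_def)

text \<open>
  The exponents are chosen such that the last field extracts the only power of \<open>z\<close> that is left:
  after two evaluations, slot \<open>k\<close> carries the single monomial \<open>z\<^sub>k^r\<close>.
\<close>
lemma slot_field_triple:
  assumes p: "permutes3 i j k" and \<alpha>: "\<alpha> i = Some x" "\<alpha> j = Some y" "\<alpha> k = Some z"
      and "0 \<le> x" "0 \<le> y"
    and r: "r = z + y - M i k - M j k - int n"
  shows "slot_field k r (slot_field j (int n - M i j) (slot_field i 0 (basis \<alpha>))) =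
    (if x = 0 \<and> y \<le> int n
     then pm_scale (\<kappa> i j * \<kappa> i k * \<kappa> j k * coef (- M j k) (n - nat y))
         (basis (\<alpha>(i := None, j := None, k := None)))
     else 0)"
proof (cases "x = 0")
  case True
  have d: "i \<noteq> j" "i \<noteq> k" "j \<noteq> k" and p2: "permutes3 j i k" and p3: "permutes3 k i j"
    using p by (auto simp: permutes3_def)
  define \<beta> where "\<beta> = \<alpha>(i := None, j := Some (y - M i j), k := Some (z - M i k))"
  have 1: "slot_field i 0 (basis \<alpha>) = pm_scale (\<kappa> i j * \<kappa> i k) (basis \<beta>)"
    using slot_field_vacuum(2)[OF p \<alpha>] True by (simp add: \<beta>_def)
  have \<beta>: "\<beta> j = Some (y - M i j)" "\<beta> i = None" "\<beta> k = Some (z - M i k)" using d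
      by (simp_all add: \<beta>_def)
  define \<gamma> where "\<gamma> = \<beta>(j := None, k := shift j k (n - nat y) (\<beta> k))"
  have n: "nat (int n - M i j - (y - M i j)) = n - nat y" using \<open>0 \<le> y\<close> by simp
  have 2: "slot_field j (int n - M i j) (basis \<beta>) = (if int n < y then 0 else
    pm_scale (\<kappa> j k * coef (- M j k) (n - nat y)) (basis \<gamma>))"
    unfolding slot_field_remove_second[OF p2 \<beta>(1,2)] n \<gamma>_def by (simp add: weight_def \<beta>(3))
  have 3: "slot_field k r (basis \<gamma>) = basis (\<alpha>(i := None, j := None, k := None))" if "y \<le> int n"
  proof -
    have \<gamma>k: "\<gamma> k = Some r"
      using that \<open>0 \<le> y\<close> unfolding \<gamma>_def r by (simp add: \<beta>(3) shift_def)
    have \<gamma>i: "\<gamma> i = None" and \<gamma>j: "\<gamma> j = None" using d \<beta> by (simp_all add: \<gamma>_def)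
    have "\<gamma>(k := None, j := None) = \<alpha>(i := None, j := None, k := None)"
      using d by (auto simp: \<gamma>_def \<beta>_def fun_eq_iff)
    then show ?thesis
      using slot_field_remove_second[OF p3 \<gamma>k \<gamma>i, of r] by (simp add: \<gamma>j weight_def)
  qed
  show ?thesis
    unfolding 1 field_scale[OF field_slot_field] 2
    using 3 True by (simp add: field_scale[OF field_slot_field] field_0[OF field_slot_field]
        ac_simps)
next
  case False
  then have "slot_field i 0 (basis \<alpha>) = 0" using slot_field_vacuum(1)[OF p \<alpha>] \<open>0 \<le> x\<close> by simp
  then show ?thesis using False by (simp add: field_0[OF field_slot_field])
qed

lemma slot_field_not_permutes:
  assumes "i < 3" "j < 3" "k < 3" "\<not> permutes3 i j k"
  shows "slot_field k r (slot_field j s (slot_field i t v)) = 0"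
proof (cases "j = i")
  case True
  then have "slot_field j s (slot_field i t v) = 0"
    using assms by (intro slot_field_removed removed_slot_field) auto
  then show ?thesis by (simp add: field_0[OF field_slot_field])
next
  case False
  then have "k = i \<or> k = j" using assms by (auto simp: permutes3_def)
  then show ?thesis
    using assms by (intro slot_field_removed removed_slot_field) (auto intro: removed_slot_field)
qed

end

section \<open>Attaining the bound\<close>

text \<open>
  A field of parity \<open>n\<close> mod 2 that satisfies locality with itself with exponent \<open>n\<close> needs no extra
  sign.
\<close>
lemma koszul_sign_parity: "koszul_sign (of_int n) (of_int n) = (-1) powi n"
proof (cases "even n")
  case True
  then obtain m where "n = 2 * m" by blast
  then have "(of_int n :: bit) = 0" by simp
  then show ?thesis using True by (simp add: koszul_sign_def)
next
  case False
  then obtain m where "n = 2 * m + 1" by (blast elim: oddE)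
  then have "(of_int n :: bit) = 1" by simp
  then show ?thesis using False by (simp add: koszul_sign_def)
qed

text \<open>
  Here \<open>n\<close> is the index \<open>k\<close> of the product \<open>b a\<close>, and \<open>l\<close> is the number of derivatives of \<open>b\<close> that
  remain in the leading term: in lattice notation this term is a multiple of
  \<open>S\<^sub>l(b) exp(a + b + c)\<close> with a Schur polynomial \<open>S\<^sub>l\<close>, and it appears with the binomial
  coefficient of index \<open>n - l\<close>. The three slots carry the labels \<open>a, b, c\<close>, a generator is the sum
  of the fields of the slots that carry its name, and the vacuum-like vector is the monomial
  \<open>z\<^sub>1^l\<close>. Each way of assigning distinct slots to \<open>a, b, c\<close> contributes the same nonzero scalar
  or zero, so nothing cancels in characteristic 0.
\<close>
theorem nonvanishing_model:
  fixes N :: "'b \<Rightarrow> 'b \<Rightarrow> int" and n l :: nat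
  assumes sym: "\<And>x y. x \<in> \<B> \<Longrightarrow> y \<in> \<B> \<Longrightarrow> N x y = N y x" and gens: "a \<in> \<B>" "b \<in> \<B>" "c \<in> \<B>"
    and l: "l \<le> n" "l = 0 \<or> (of_int (- N b c) gchoose n :: 'k::field_char_0) = 0"
    and nz: "(of_int (- N b c) gchoose (n - l) :: 'k::field_char_0) \<noteq> 0"
  obtains t :: "'k::field_char_0 \<Rightarrow> (bit \<Rightarrow> int \<Rightarrow> (slots \<Rightarrow>\<^sub>0 'k) \<Rightarrow> slots \<Rightarrow>\<^sub>0 'k) \<Rightarrow> _"
    and A :: "(bit \<Rightarrow> int \<Rightarrow> (slots \<Rightarrow>\<^sub>0 'k) \<Rightarrow> slots \<Rightarrow>\<^sub>0 'k) va" and \<iota>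
  where "vertex_algebra t A" "locality_map \<B> N A \<iota>"
    "nprod A (N a c + N b c + int n - int l - 1) (\<iota> c)
        (nprod A (N a b - int n - 1) (\<iota> b) (\<iota> a)) \<noteq> 0"
proof -
  define label where "label i = (if i = 0 then a else if i = 1 then b else c)" for i :: nat
  \<comment> \<open>The signs are put into the pairs of labels that are out of order. Equal labels need none.\<close>
  define rank where "rank x = (if x = a then 0 else if x = b then 1 else 2 :: nat)" for x
  define M where "M i j = N (label i) (label j)" for i j
  define sg :: "'b \<Rightarrow> 'b \<Rightarrow> 'k" where "sg x y = koszul_sign (of_int (N x x)) (of_int (N y y))" for x y
  define \<kappa>l :: "'b \<Rightarrow> 'b \<Rightarrow> 'k" where
    "\<kappa>l x y = (if rank x \<le> rank y then 1 else sg x y * (-1) powi (N x y))" for x y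
  define \<kappa> where "\<kappa> i j = \<kappa>l (label i) (label j)" for i j
  interpret slot_fields M \<kappa> .
  have lab: "label i \<in> {a, b, c}" "label i \<in> \<B>" for i using gens by (simp_all add: label_def)
  have sg_sq: "sg x y * sg x y = 1" for x y by (simp add: sg_def koszul_sign_square)
  have sg_self: "sg x x = (-1) powi (N x x)" for x by (simp add: sg_def koszul_sign_parity)
  have pm: "(-1 :: 'k) powi m * (-1) powi m = 1" for m by simp
  have \<kappa>_sym: "\<kappa>l y x = sg x y * (-1) powi (N x y) * \<kappa>l x y"
    if "x \<in> {a, b, c}" "y \<in> {a, b, c}" for x y
  proof -
    have xy: "x \<in> \<B>" "y \<in> \<B>" using that gens by auto
    have "rank x = rank y \<Longrightarrow> x = y" using that by (auto simp: rank_def split: if_splits)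
    moreover have "N y x = N x y" using sym xy by simp
    moreover have "sg y x = sg x y" by (simp add: sg_def koszul_sign_commute)
    ultimately show ?thesis
      using sg_sq[of x y] pm[of "N x y"] sg_self[of x]
      by (cases "rank x" "rank y" rule: linorder_cases)
          (auto simp: \<kappa>l_def mult.assoc mult.left_commute[of _ "sg x y"])
  qed
  have br: "bracket (sg (label i) (label j)) (N (label i) (label j)) (slot_field i)
      (slot_field j) v = 0"
    if "i < 3" "j < 3" for i j v
    using slot_field_bracket[OF that, of "sg (label i) (label j)" v]
        sym[OF lab(2) lab(2), of i j] \<kappa>_sym[OF lab(1) lab(1), of j i]
    by (simp add: M_def \<kappa>_def)
  define I where "I x = {i. i < 3 \<and> label i = x}" for x
  have finI: "finite (I x)" for x by (simp add: I_def)
  define gen where "gen x = sum slot_field (I x)" for x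
  have fgen: "field_op (gen x)" for x
    unfolding gen_def using fprod_sum_left[OF field_op_0, of "I x" slot_field] field_slot_field
        finI by blast
  have gen_apply: "gen x r v = (\<Sum>i\<in>I x. slot_field i r v)" for x r v
  proof -
    have "sum slot_field J r v = (\<Sum>i\<in>J. slot_field i r v)" if "finite J" for J
      using that by (induction J rule: finite_induct) simp_all
    then show ?thesis using finI by (simp add: gen_def)
  qed
  have prod0: "fprod (sg x y) m (gen x) (gen y) = 0" if "N x y \<le> m" for x y m
  proof -
    have "fprod (sg x y) m (slot_field i) (slot_field j) = 0" if "i \<in> I x" "j \<in> I y" for i j
    proof -
      have ij: "i < 3" "j < 3" "label i = x" "label j = y" using that by (simp_all add: I_def)
      have "bracket (sg x y) (N x y) (slot_field i) (slot_field j) v = 0" for v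
        using br[OF ij(1,2)] by (simp add: ij)
      from local_mono[OF field_slot_field field_slot_field this \<open>N x y \<le> m\<close>]
      show ?thesis by (intro ext) (simp add: fprod_def)
    qed
    then have "fprod (sg x y) m (slot_field i) (gen y) = 0" if "i \<in> I x" for i
      unfolding gen_def using fprod_sum_right[OF field_slot_field field_slot_field finI] that
      by (simp add: sum.neutral)
    then show ?thesis
      using fprod_sum_left[OF fgen[of y] field_slot_field finI[of x], of "\<lambda>i. i"]
      unfolding gen_def[of x] by (simp add: sum.neutral)
  qed
  have loc: "is_local (sg x y) (gen x) (gen y)" for x y
  proof -
    have l1: "is_local (sg x y) (slot_field i) (slot_field j)" if "i \<in> I x" "j \<in> I y" for x y i j
    proof -
      have ij: "i < 3" "j < 3" "label i = x" "label j = y" using that by (simp_all add: I_def)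
      have "bracket (sg x y) (N x y) (slot_field i) (slot_field j) v = 0" for v
        using br[OF ij(1,2)] by (simp add: ij)
      then have "bracket (sg x y) (int (nat (N x y))) (slot_field i) (slot_field j) v = 0" for v
        by (rule local_mono[OF field_slot_field field_slot_field]) simp
      then show ?thesis unfolding is_local_def by blast
    qed
    have l2: "is_local (sg x y) (gen x) (slot_field j)" if "j \<in> I y" for x y j
      unfolding gen_def by (rule local_sum_left[OF field_slot_field field_slot_field l1 finI])
          (use that in auto)
    have sgc: "sg y x = sg x y" for x y by (simp add: sg_def koszul_sign_commute)
    have "is_local (sg y x) (slot_field j) (gen x)" if "j \<in> I y" for x y j
      unfolding sgc[of y x] by (rule local_sym[OF fgen field_slot_field sg_sq l2[OF that]])
    then show ?thesis
      unfolding gen_def[of x] by (intro local_sum_left[OF fgen field_slot_field _ finI])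
  qed
  have ml: "mutually_local ((\<lambda>x. (of_int (N x x), gen x)) ` \<B>)"
    unfolding mutually_local_def using fgen loc by (auto simp: sg_def)
  obtain W where W: "local_system (pm_scale :: 'k \<Rightarrow> (slots \<Rightarrow>\<^sub>0 'k) \<Rightarrow> _) W"
    and W2: "\<And>p \<phi>. (p, \<phi>) \<in> (\<lambda>x. (of_int (N x x), gen x)) ` \<B> \<Longrightarrow> \<phi> \<in> W p"
    by (rule local_system_exists[OF ml], rule that)
  have genW: "gen x \<in> W (of_int (N x x))" if "x \<in> \<B>" for x by (rule W2) (use that in blast)
  interpret local_system "pm_scale :: 'k \<Rightarrow> (slots \<Rightarrow>\<^sub>0 'k) \<Rightarrow> _" W by (rule W)
  define \<iota> where "\<iota> x = (\<lambda>p :: bit. if p = of_int (N x x) then gen x else 0)" for x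
  have \<iota>: "\<iota> x \<in> part field_va (of_int (N x x))" if "x \<in> \<B>" for x
    using genW[OF that] by (simp add: part_field_va \<iota>_def)
  have \<iota>C: "\<iota> x \<in> va_carrier field_va" if "x \<in> \<B>" for x
    using genW[OF that] W_zero by (simp add: carrier_field_va \<iota>_def)
  have "locality_map \<B> N field_va \<iota>"
    unfolding locality_map_def
  proof (intro conjI ballI allI impI)
    fix x y m assume xy: "x \<in> \<B>" "y \<in> \<B>" "N x y \<le> m"
    show "nprod field_va m (\<iota> x) (\<iota> y) = 0"
    proof
      fix q
      show "nprod field_va m (\<iota> x) (\<iota> y) q = 0 q"
        unfolding nprod_homogeneous[OF \<iota>[OF xy(1)] \<iota>C[OF xy(2)]]
        using prod0[OF xy(3)] fprod_0_right[OF fgen] by (auto simp: \<iota>_def sg_def)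
    qed
  qed (rule \<iota>)
  moreover have "nprod field_va (N a c + N b c + int n - int l - 1) (\<iota> c)
      (nprod field_va (N a b - int n - 1) (\<iota> b) (\<iota> a)) \<noteq> 0"
  proof
    define m m' where "m = N a c + N b c + int n - int l - 1" and "m' = N a b - int n - 1"
    assume "nprod field_va (N a c + N b c + int n - int l - 1) (\<iota> c)
        (nprod field_va (N a b - int n - 1) (\<iota> b) (\<iota> a)) = 0"
    then have zero: "nprod field_va m (\<iota> c) (nprod field_va m' (\<iota> b) (\<iota> a)) q = 0" for q
      by (simp add: m_def m'_def)
    define pa pb pc where "pa = (of_int (N a a) :: bit)" and "pb = (of_int (N b b) :: bit)"
        and "pc = (of_int (N c c) :: bit)"
    define q where "q = (pa + pb) + pc"
    have q: "q + pc = pa + pb" "(q + pc) + pb = pa"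
      unfolding q_def by (cases pa; cases pb; cases pc; simp)+
    obtain e e' where "nprod field_va m (\<iota> c) (nprod field_va m' (\<iota> b) (\<iota> a)) q
        = fprod e m (gen c) (fprod e' m' (gen b) (gen a))"
      using nprod_homogeneous[OF \<iota>[OF gens(3)]
          nprod_in_carrier[OF \<iota>C[OF gens(2)] \<iota>C[OF gens(1)]], of m m' q]
        nprod_homogeneous[OF \<iota>[OF gens(2)] \<iota>C[OF gens(1)], of m' "q + pc"]
      unfolding pc_def[symmetric] pb_def[symmetric] q(2)
      by (simp add: \<iota>_def pa_def pb_def pc_def)
    then have Z: "fprod e m (gen c) (fprod e' m' (gen b) (gen a)) = 0" using zero by simp
    \<comment> \<open>The vacuum-like vector \<open>z\<^sub>1^l\<close>.\<close>
    define \<alpha> :: slots where "\<alpha> i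
        = (if i = 0 \<or> i = 2 then Some 0 else if i = 1 then Some (int l) else None)" for i
    define \<epsilon> :: slots where "\<epsilon> = (\<lambda>i. None)"
    have ex: "\<exists>j k. permutes3 i j k" if "i < 3" for i
      using that permutes3_exists[of i "(i + 1) mod 3"]
          by (metis less3 permutes3_exists zero_neq_one)
    have \<alpha>S: "\<exists>x\<ge>0. \<alpha> i = Some x" if "i < 3" for i using that unfolding less3 \<alpha>_def by auto
    have vac: "gen x r (basis \<alpha>) = 0" if "r < 0" for x r
    proof -
      have "slot_field i r (basis \<alpha>) = 0" if i: "i < 3" for i
      proof -
        obtain j k where p: "permutes3 i j k" using ex[OF i] by blast
        then obtain x y z where "\<alpha> i = Some x" "\<alpha> j = Some y" "\<alpha> k = Some z" "0 \<le> x"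
          using \<alpha>S unfolding permutes3_def by metis
        then show ?thesis using slot_field_vacuum(1)[OF p] \<open>r < 0\<close> by simp
      qed
      then show ?thesis unfolding gen_apply by (intro sum.neutral) (simp add: I_def)
    qed
    have G0: "gen c (- m - 1) (gen b (- m' - 1) (gen a 0 (basis \<alpha>))) = 0"
    proof -
      have ba1: "fprod e' m' (gen b) (gen a) r (basis \<alpha>) = 0" if "r < 0" for r
        by (rule fprod_vacuum_like(1)[OF fgen fgen vac vac that])
      have ba2: "fprod e' m' (gen b) (gen a) 0 (basis \<alpha>) = gen b (- m' - 1) (gen a 0 (basis \<alpha>))"
        by (rule fprod_vacuum_like(2)[OF fgen fgen vac vac])
      have "fprod e m (gen c) (fprod e' m' (gen b) (gen a)) 0 (basis \<alpha>)
          = gen c (- m - 1) (fprod e' m' (gen b) (gen a) 0 (basis \<alpha>))"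
        by (rule fprod_vacuum_like(2)[OF fgen field_fprod[OF fgen fgen] vac ba1])
      then show ?thesis unfolding Z ba2 by simp
    qed
    define K where "K = \<kappa>l a b * \<kappa>l a c * \<kappa>l b c * coef (- N b c) (n - l)"
    define S where "S = {(i, j, k). i \<in> I a \<and> j \<in> I b \<and> k \<in> I c \<and> permutes3 i j k \<and> \<alpha> i
        = Some 0 \<and> \<alpha> j = Some (int l)}"
    have T: "slot_field k (- m - 1) (slot_field j (- m' - 1) (slot_field i 0 (basis \<alpha>)))
      = (if (i, j, k) \<in> S then pm_scale K (basis \<epsilon>) else 0)"
      if ijk: "i \<in> I a" "j \<in> I b" "k \<in> I c" for i j k
    proof (cases "permutes3 i j k")
      case p: True
      have "i < 3 \<and> j < 3 \<and> k < 3" using p by (simp add: permutes3_def)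
      then obtain x y z where xyz: "\<alpha> i = Some x" "\<alpha> j = Some y" "\<alpha> k = Some z" "0 \<le> x" "0 \<le> y"
          using \<alpha>S by metis
      have tot: "x + y + z = int l"
        using p xyz(1-3) unfolding permutes3_def less3 \<alpha>_def by (auto split: if_splits)
      have Ms: "M i j = N a b" "M i k = N a c" "M j k = N b c" "\<kappa> i j = \<kappa>l a b" "\<kappa> i k = \<kappa>l a c"
          "\<kappa> j k = \<kappa>l b c"
        using ijk by (simp_all add: I_def M_def \<kappa>_def)
      have e: "\<alpha>(i := None, j := None, k := None) = \<epsilon>"
        using p unfolding permutes3_def less3 \<alpha>_def \<epsilon>_def by (auto simp: fun_eq_iff)
      have v: "slot_field k (- m - 1) (slot_field j (int n - M i j) (slot_field i 0 (basis \<alpha>))) =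
        (if x = 0 \<and> y \<le> int n then pm_scale (\<kappa> i j * \<kappa> i k * \<kappa> j k * coef (- M j k) (n - nat y))
            (basis \<epsilon>) else 0)"
        if "x = 0"
        unfolding e[symmetric]
        by (rule slot_field_triple[OF p xyz]) (use tot that in \<open>simp add: m_def Ms\<close>)
      have jm: "int n - M i j = - m' - 1" by (simp add: m'_def Ms)
      show ?thesis
      proof (cases "x = 0")
        case True
        have y: "y = int l \<or> y = 0" using p xyz(2) unfolding permutes3_def less3 \<alpha>_def
            by (auto split: if_splits)
        show ?thesis
        proof (cases "y = int l")
          case yl: True
          then have "(i, j, k) \<in> S" using ijk p xyz True by (simp add: S_def)
          then show ?thesis using v[OF True] yl True l(1) unfolding jm by (simp add: Ms K_def)
        next
          \<comment> \<open>The factor \<open>z\<^sub>1^l\<close> sits in the slot used for \<open>c\<close>; by hypothesis the binomial coefficient is then zero.\<close>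
          case False
          then have "y = 0" "coef (- N b c) n = 0" using y l(2) by (auto simp: coef_def)
          moreover have "(i, j, k) \<notin> S" using False xyz by (simp add: S_def)
          ultimately show ?thesis using v[OF True] unfolding jm by (simp add: Ms)
        qed
      next
        case False
        then have "slot_field i 0 (basis \<alpha>) = 0" using slot_field_vacuum(1)[OF p xyz(1-3)] xyz(4)
            by simp
        moreover have "(i, j, k) \<notin> S" using False xyz by (simp add: S_def)
        ultimately show ?thesis by (simp add: field_0[OF field_slot_field])
      qed
    next
      case False
      then show ?thesis
        using slot_field_not_permutes[of i j k] ijk by (simp add: S_def I_def)
    qed
    have "gen c (- m - 1) (gen b (- m' - 1) (gen a 0 (basis \<alpha>)))
      = (\<Sum>i\<in>I a. \<Sum>j\<in>I b. \<Sum>k\<in>I c. slot_field k (- m - 1)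
          (slot_field j (- m' - 1) (slot_field i 0 (basis \<alpha>))))"
      unfolding gen_apply[of a] field_sum[OF fgen] unfolding gen_apply[of b] field_sum[OF fgen]
          unfolding gen_apply[of c] ..
    also have "\<dots> = (\<Sum>i\<in>I a. \<Sum>j\<in>I b. \<Sum>k\<in>I c. if (i, j, k) \<in> S then pm_scale K (basis \<epsilon>) else 0)"
      using T by (intro sum.cong refl) auto
    also have "\<dots> = (\<Sum>u\<in>I a \<times> I b \<times> I c. if u \<in> S then pm_scale K (basis \<epsilon>) else 0)"
      by (simp add: sum.cartesian_product split_beta)
    also have "\<dots> = (\<Sum>u\<in>S. pm_scale K (basis \<epsilon>))"
    proof -
      have "S \<subseteq> I a \<times> I b \<times> I c" by (auto simp: S_def)
      then show ?thesis using finI by (simp add: sum.If_cases Int_absorb1)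
    qed
    finally have "(\<Sum>u\<in>S. pm_scale K (basis \<epsilon>)) = 0" unfolding G0 by simp
    then have "Poly_Mapping.lookup (\<Sum>u\<in>S. pm_scale K (basis \<epsilon>)) \<epsilon> = 0" by simp
    then have "of_nat (card S) * K = 0" by (simp add: lookup_sum basis_def)
    moreover have "finite S" by (rule finite_subset[of _ "I a \<times> I b \<times> I c"])
        (use finI in \<open>auto simp: S_def\<close>)
    moreover have "(0, 1, 2) \<in> S" by (simp add: S_def I_def label_def permutes3_def \<alpha>_def)
    then have "S \<noteq> {}" by blast
    moreover have "\<kappa>l x y \<noteq> 0" for x y
      using sg_sq[of x y] by (auto simp: \<kappa>l_def)
    ultimately show False using nz by (simp add: K_def coef_def)
  qed
  ultimately show thesis using vertex_algebra_field_va by (intro that)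
qed

lemma gbinomial_neg_pos_nonzero: "0 < N \<Longrightarrow> (of_int (- N) gchoose k :: 'k::field_char_0) \<noteq> 0"
proof -
  assume "0 < N"
  then obtain p where p: "N = int (Suc p)" by (metis gr0_implies_Suc zero_less_imp_eq_int)
  have "(of_int (- N) gchoose k :: 'k) = (-1) ^ k * (of_nat (p + k) gchoose k)"
    using gbinomial_minus[of "of_nat (Suc p) :: 'k" k] by (simp add: p add.commute)
  moreover have "(of_nat (p + k) gchoose k :: 'k) = of_nat ((p + k) choose k)"
    by (simp only: binomial_gbinomial)
  ultimately show ?thesis by simp
qed

theorem mainTheorem4:
  fixes scale :: "'k::field_char_0 \<Rightarrow> 'v::ab_group_add \<Rightarrow> 'v"
    and \<FF> :: "'v va"
    and \<B> :: "'b set"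
    and N :: "'b \<Rightarrow> 'b \<Rightarrow> int"
    and g :: "'b \<Rightarrow> 'v"
    and a b c :: 'b
    and n k :: int
  assumes sym: "\<And>x y. \<lbrakk>x \<in> \<B>; y \<in> \<B>\<rbrakk> \<Longrightarrow> N x y = N y x"
    and free: "is_free_vertex_algebra scale \<FF> \<B> N g"
    and gens: "a \<in> \<B>" "b \<in> \<B>" "c \<in> \<B>"
    and k: "0 \<le> k"
    and n: "n = N a b - k - 1"
  shows "(N b c > 0 \<or> (0 \<le> k \<and> k \<le> - N b c) \<longrightarrow>
            is_order_of_locality \<FF> (g c) (nprod \<FF> n (g b) (g a)) (N a c + N b c + k)) \<and>
         (N b c = 0 \<or> (0 < - N b c \<and> - N b c \<le> k) \<longrightarrow>
            is_order_of_locality \<FF> (g c) (nprod \<FF> n (g b) (g a)) (N a c))"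
proof -
  interpret F: vertex_algebra scale \<FF> using free by (simp add: is_free_vertex_algebra_def)
  have loc: "locality_map \<B> N \<FF> g" using free by (simp add: is_free_vertex_algebra_def)
  then have gpart: "g x \<in> part \<FF> (of_int (N x x))" if "x \<in> \<B>" for x
    using that by (simp add: locality_map_def)
  have gz: "nprod \<FF> m (g x) (g y) = 0" if "x \<in> \<B>" "y \<in> \<B>" "N x y \<le> m" for x y m
    using loc that by (simp add: locality_map_def)
  obtain k' where k': "k = int k'" using k nonneg_int_cases by blast
  have n': "n = N b a - int k' - 1" using n k' sym gens by simp
  note parts = F.in_carrier[OF gpart[OF gens(1)]] gpart[OF gens(2)] gpart[OF gens(3)]
  have upper1: "nprod \<FF> m (g c) (nprod \<FF> n (g b) (g a)) = 0" if "N c a + N c b + k \<le> m" for m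
    unfolding n'
    by (rule F.order_upper_bound(1)[OF parts, where Ncb = "N c b" and Nca = "N c a"])
      (use gz gens that k' in auto)
  have upper2: "nprod \<FF> m (g c) (nprod \<FF> n (g b) (g a)) = 0" if "N c b \<le> 0" "N c a \<le> m" for m
    unfolding n'
    by (rule F.order_upper_bound(2)[OF parts, where Ncb = "N c b" and Nca = "N c a"])
      (use gz gens that in auto)
  have nonzero: "nprod \<FF> (N a c + N b c + k - int l - 1) (g c) (nprod \<FF> n (g b) (g a)) \<noteq> 0"
    if l: "l \<le> k'" "l = 0 \<or> (of_int (- N b c) gchoose k' :: 'k) = 0"
      "(of_int (- N b c) gchoose (k' - l) :: 'k) \<noteq> 0" for l
  proof -
    obtain t :: "'k \<Rightarrow> (bit \<Rightarrow> int \<Rightarrow> (slots \<Rightarrow>\<^sub>0 'k) \<Rightarrow> slots \<Rightarrow>\<^sub>0 'k) \<Rightarrow> _"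
      and A :: "(bit \<Rightarrow> int \<Rightarrow> (slots \<Rightarrow>\<^sub>0 'k) \<Rightarrow> slots \<Rightarrow>\<^sub>0 'k) va" and \<iota>
      where A: "vertex_algebra t A" "locality_map \<B> N A \<iota>"
      and nz: "nprod A (N a c + N b c + int k' - int l - 1) (\<iota> c)
          (nprod A (N a b - int k' - 1) (\<iota> b) (\<iota> a)) \<noteq> 0"
      using nonvanishing_model[OF sym gens l] by blast
    obtain \<phi> where \<phi>: "va_hom scale \<FF> t A \<phi>" and \<phi>g: "\<And>b. b \<in> \<B> \<Longrightarrow> \<phi> (g b) = \<iota> b"
      using free_vertex_algebra_universal[OF free A] unfolding universal_hom_def by blast
    interpret A: vertex_algebra t A by (rule A)
    have C: "g x \<in> va_carrier \<FF>" if "x \<in> \<B>" for x using F.in_carrier gpart that by blast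
    have hom: "\<phi> (nprod \<FF> m x y) = nprod A m (\<phi> x) (\<phi> y)"
        if "x \<in> va_carrier \<FF>" "y \<in> va_carrier \<FF>" for m x y
      using \<phi> that unfolding va_hom_def by blast
    have "\<phi> (scale 0 0) = t 0 (\<phi> 0)"
      using \<phi> F.subspace_0[OF F.subspace_carrier] unfolding va_hom_def by blast
    then have "\<phi> 0 = 0" by simp
    moreover have "\<phi> (nprod \<FF> (N a c + N b c + k - int l - 1) (g c) (nprod \<FF> n (g b) (g a))) \<noteq> 0"
      using nz by (simp add: hom C gens F.nprod_closed \<phi>g k' n)
    ultimately show ?thesis by metis
  qed
  have order: "is_order_of_locality \<FF> x y M"
    if "\<And>m. M \<le> m \<Longrightarrow> nprod \<FF> m x y = 0" "nprod \<FF> (M - 1) x y \<noteq> 0" for x y M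
  proof -
    have "M \<le> M'" if "\<forall>m\<ge>M'. nprod \<FF> m x y = 0" for M'
      using that \<open>nprod \<FF> (M - 1) x y \<noteq> 0\<close> by (metis linorder_not_le zle_diff1_eq)
    then show ?thesis unfolding is_order_of_locality_def using that(1) by blast
  qed
  have Ns: "N c a = N a c" "N c b = N b c" using sym gens by simp_all
  have binom: "(of_int (- N b c) gchoose j :: 'k) = of_nat (nat (- N b c) choose j)"
      if "N b c \<le> 0" for j
  proof -
    have "of_int (- N b c) = (of_nat (nat (- N b c)) :: 'k)" using that by simp
    then show ?thesis by (simp only: binomial_gbinomial)
  qed
  show ?thesis
  proof (intro conjI impI)
    assume *: "N b c > 0 \<or> (0 \<le> k \<and> k \<le> - N b c)"
    have "(of_int (- N b c) gchoose k' :: 'k) \<noteq> 0"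
    proof (cases "N b c > 0")
      case True
      then show ?thesis by (rule gbinomial_neg_pos_nonzero)
    next
      case False
      then have "N b c \<le> 0" "k' \<le> nat (- N b c)" using * k' by auto
      then show ?thesis unfolding binom[OF \<open>N b c \<le> 0\<close>] by (simp add: binomial_eq_0_iff)
    qed
    then have "nprod \<FF> (N a c + N b c + k - 1) (g c) (nprod \<FF> n (g b) (g a)) \<noteq> 0"
      using nonzero[of 0] by simp
    then show "is_order_of_locality \<FF> (g c) (nprod \<FF> n (g b) (g a)) (N a c + N b c + k)"
      using upper1 by (intro order) (simp_all add: Ns)
  next
    assume *: "N b c = 0 \<or> (0 < - N b c \<and> - N b c \<le> k)"
    \<comment> \<open>The last nonzero binomial coefficient has index \<open>k' - l = - N b c\<close>.\<close>
    define l where "l = nat (k + N b c)"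
    have l: "l \<le> k'" "int l = k + N b c" "k' - l = nat (- N b c)" using * k k' by (auto simp: l_def)
    have Nbc: "N b c \<le> 0" using * by auto
    have "l = 0 \<or> (of_int (- N b c) gchoose k' :: 'k) = 0"
      unfolding binom[OF Nbc] using * l k' by (auto simp: binomial_eq_0_iff)
    moreover have "(of_int (- N b c) gchoose (k' - l) :: 'k) \<noteq> 0" unfolding binom[OF Nbc] l(3)
        by simp
    ultimately have "nprod \<FF> (N a c - 1) (g c) (nprod \<FF> n (g b) (g a)) \<noteq> 0"
      using nonzero[OF l(1)] l(2) by simp
    then show "is_order_of_locality \<FF> (g c) (nprod \<FF> n (g b) (g a)) (N a c)"
      using upper2 Nbc by (intro order) (simp_all add: Ns)
  qed
qed

end
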